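(* Suppose that the closed $3$-manifold $M$ supports $\mathrm{Sol}$-geometry with metric $g$ and holonomy representation $\rho_{\mathrm{geom}}\colon\pi_1(M)\to G=\mathrm{Isom}_e\mathrm{Sol}=\mathrm{Sol}$. Then the volume form of the standard $\mathrm{Sol}$ metric agrees with the left-invariant volume form $\mathrm{vol}_G$ normalized by $\mathrm{vol}_G=X^*\wedge Y^*\wedge Z^*$ at the identity, and $$\mathrm{CS}^{\mathrm{vol}}_{\mathrm{Sol}}(M,\rho_{\mathrm{geom}})=\mathrm{Vol}_G(M,\rho_{\mathrm{geom}})=\mathrm{Vol}(M,g).$$
   Context: $M$ is a connected closed oriented $3$-manifold. "Supports $\mathrm{Sol}$-geometry" means $M$ carries a $(\mathrm{Sol},G)$-structure with developing map $D\colon\widetilde M\to\mathrm{Sol}$ equivariant under $\rho_{\mathrm{geom}}$ (holonomy in the identity component $G$ of the isometry group); $g$ is the metric induced via $D$ from the standard metric, and $M$ is oriented via $D$. $\mathrm{Vol}(M,g)$ is the Riemannian volume. Sol geometry. $\mathrm{Sol}=\mathbb R^3$, $(x,y,z)$ corresponding to $\begin{pmatrix}e^{-z}&0&x\\0&e^z&y\\0&0&1\end{pmatrix}$, with left-invariant frame $X=e^{-z}\partial_x$, $Y=e^z\partial_y$, $Z=\partial_z$ (positively oriented); the standard metric $e^{2z}dx^2+e^{-2z}dy^2+dz^2$ makes it orthonormal. Nontrivial brackets: $[X,Z]=X$, $[Y,Z]=-Y$. Let $p=\langle\cdot,\cdot\rangle$ be the $\mathrm{Ad}(G)$-invariant symmetric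 bilinear form on $\mathfrak g$ whose only nonzero component is $\langle Z,Z\rangle=1/2$. Volume of $\rho\colon\pi_1(M)\to G$. $P_\rho=\widetilde M\times_\rho G$ with flat connection $\omega_\rho$; $P_\rho$ has sections since $G$ is contractible. $\mathrm{pr}_2^*\mathrm{vol}_G$ on $\widetilde M\times G$ descends to a closed $3$-form $\mathrm{vol}_\rho$ on $P_\rho$, and $\mathrm{Vol}_G(M,\rho)=\int_Ms^*\mathrm{vol}_\rho$ for any section $s$. $\mathrm{CS}^{\mathrm{vol}}_{\mathrm{Sol}}(M,\rho)$. For a section $s\colon M\to P_\rho$ write $s^*\omega_\rho=\alpha X+\beta Y+\gamma Z$; $\omega^s$ is the unique connection on $P_\rho$ with $s^*\omega^s=(\alpha+\beta)Z$. With $a=\omega^s-\omega_\rho$ (an $\mathrm{ad}P_\rho$-valued $1$-form on $M$) and $d_{\omega_\rho}a=da+[\omega_\rho,a]$, $\mathrm{CS}^{\mathrm{vol}}_{\mathrm{Sol}}(M,\rho)=\int_M\big(\langle a,d_{\omega_\rho}a\rangle+\frac13\langle a,[a,a]\rangle\big)\in\mathbb R$, where $[\alpha\otimes\xi,\beta\otimes\eta]=(\alpha\wedge\beta)\otimes[\xi,\eta]$ and $\langle\alpha\otimes\xi,\beta\otimes\eta\rangle=(\alpha\wedge\beta)\langle\xi,\eta\rangle$. This is independent of $s$ and of gauge transformations of either connection. *)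

theory Defs
  imports "HOL-Analysis.Analysis" "HOL-Algebra.Group"
begin

section \<open>Smooth maps between Euclidean spaces\<close>

fun Ck_on :: "nat \<Rightarrow> 'e::real_normed_vector set \<Rightarrow> ('e \<Rightarrow> 'f::real_normed_vector) \<Rightarrow> bool" where
  "Ck_on 0 S f \<longleftrightarrow> continuous_on S f"
| "Ck_on (Suc k) S f \<longleftrightarrow> (\<forall>x\<in>S. f differentiable (at x)) \<and>
     (\<forall>v. Ck_on k S (\<lambda>x. frechet_derivative f (at x) v))"

text \<open>Only used for open \<open>S\<close>.\<close>
definition smooth_on :: "'e::real_normed_vector set \<Rightarrow> ('e \<Rightarrow> 'f::real_normed_vector) \<Rightarrow> bool" where
  "smooth_on S f \<longleftrightarrow> (\<forall>k. Ck_on k S f)"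

section \<open>Manifolds, tangent vectors, differential forms\<close>

text \<open>A chart is a domain together with a coordinate map; the values of the coordinate map
  outside the domain are irrelevant.\<close>

type_synonym ('a, 'e) chart = "'a set \<times> ('a \<Rightarrow> 'e)"

abbreviation cdom :: "('a, 'e) chart \<Rightarrow> 'a set" where "cdom \<equiv> fst"
abbreviation cmap :: "('a, 'e) chart \<Rightarrow> 'a \<Rightarrow> 'e" where "cmap \<equiv> snd"

definition cinv :: "('a, 'e) chart \<Rightarrow> 'e \<Rightarrow> 'a" where
  "cinv c = inv_into (cdom c) (cmap c)"

definition topological_chart :: "('a::topological_space, 'e::euclidean_space) chart \<Rightarrow> bool" where
  "topological_chart c \<longleftrightarrow> open (cdom c) \<and> open (cmap c ` cdom c) \<and>
     homeomorphism (cdom c) (cmap c ` cdom c) (cmap c) (cinv c)"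

definition smooth_atlas :: "('a::topological_space, 'e::euclidean_space) chart set \<Rightarrow> bool" where
  "smooth_atlas A \<longleftrightarrow> (\<Union>c\<in>A. cdom c) = UNIV \<and> (\<forall>c\<in>A. topological_chart c) \<and>
     (\<forall>c\<in>A. \<forall>c'\<in>A. smooth_on (cmap c ` (cdom c \<inter> cdom c')) (cmap c' \<circ> cinv c))"

definition oriented_atlas :: "('a::topological_space, real^3) chart set \<Rightarrow> bool" where
  "oriented_atlas A \<longleftrightarrow> smooth_atlas A \<and>
     (\<forall>c\<in>A. \<forall>c'\<in>A. \<forall>x\<in>cdom c \<inter> cdom c'.
        det (matrix (frechet_derivative (cmap c' \<circ> cinv c) (at (cmap c x)))) > 0)"

text \<open>The manifold is the whole type; a compact Hausdorff manifold is automatically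
  second countable.\<close>

definition closed_oriented_3manifold :: "('a::t2_space, real^3) chart set \<Rightarrow> bool" where
  "closed_oriented_3manifold A \<longleftrightarrow>
     compact (UNIV :: 'a set) \<and> connected (UNIV :: 'a set) \<and> oriented_atlas A"

text \<open>A tangent vector at \<open>x\<close> is the family of its coordinate vectors in all the charts of the
  atlas around \<open>x\<close>, related by the derivatives of the coordinate changes, and extended by \<open>0\<close> to
  all other charts.\<close>

type_synonym ('a, 'e) tvec = "('a, 'e) chart \<Rightarrow> 'e"

definition coord_vec :: "('a, 'e::euclidean_space) chart set \<Rightarrow> ('a, 'e) chart \<Rightarrow> 'a \<Rightarrow> 'e \<Rightarrow> ('a, 'e) tvec" where
  "coord_vec A c x e = (\<lambda>c'. if c' \<in> A \<and> x \<in> cdom c'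
     then frechet_derivative (cmap c' \<circ> cinv c) (at (cmap c x)) e else 0)"

definition tangent_space :: "('a, 'e::euclidean_space) chart set \<Rightarrow> 'a \<Rightarrow> ('a, 'e) tvec set" where
  "tangent_space A x =
     {v. (\<forall>c. \<not> (c \<in> A \<and> x \<in> cdom c) \<longrightarrow> v c = 0) \<and>
         (\<forall>c\<in>A. x \<in> cdom c \<longrightarrow> v = coord_vec A c x (v c))}"

definition chart_at :: "('a, 'e) chart set \<Rightarrow> 'a \<Rightarrow> ('a, 'e) chart" where
  "chart_at A x = (SOME c. c \<in> A \<and> x \<in> cdom c)"

text \<open>The differential at \<open>x\<close> of a map into a vector space, of a map between manifolds, and of a
  map from a vector space into a manifold. Open subsets of a vector space have the vector space
  itself as tangent space.\<close>

definition diff_fun :: "('a, 'e::euclidean_space) chart set \<Rightarrow> ('a \<Rightarrow> 'f::real_normed_vector) \<Rightarrow>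
    'a \<Rightarrow> ('a, 'e) tvec \<Rightarrow> 'f" where
  "diff_fun A f x v = (let c = chart_at A x
     in frechet_derivative (f \<circ> cinv c) (at (cmap c x)) (v c))"

definition diff_map :: "('a, 'e::euclidean_space) chart set \<Rightarrow> ('b, 'f::euclidean_space) chart set \<Rightarrow>
    ('a \<Rightarrow> 'b) \<Rightarrow> 'a \<Rightarrow> ('a, 'e) tvec \<Rightarrow> ('b, 'f) tvec" where
  "diff_map A B f x v =
     (\<lambda>c. if c \<in> B \<and> f x \<in> cdom c then diff_fun A (cmap c \<circ> f) x v else 0)"

definition diff_from :: "('b, 'f::euclidean_space) chart set \<Rightarrow> ('e::euclidean_space \<Rightarrow> 'b) \<Rightarrow>
    'e \<Rightarrow> 'e \<Rightarrow> ('b, 'f) tvec" where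
  "diff_from B f x e =
     (\<lambda>c. if c \<in> B \<and> f x \<in> cdom c then frechet_derivative (cmap c \<circ> f) (at x) e else 0)"

definition smooth_map :: "('a, 'e::euclidean_space) chart set \<Rightarrow> ('b, 'f::euclidean_space) chart set \<Rightarrow>
    ('a \<Rightarrow> 'b) \<Rightarrow> bool" where
  "smooth_map A B f \<longleftrightarrow> (\<forall>x. \<exists>c\<in>A. \<exists>c'\<in>B. \<exists>N. x \<in> N \<and> N \<subseteq> cdom c \<and> open (cmap c ` N) \<and>
     f ` N \<subseteq> cdom c' \<and> smooth_on (cmap c ` N) (cmap c' \<circ> f \<circ> cinv c))"

definition smooth_fun :: "('a, 'e::euclidean_space) chart set \<Rightarrow> ('a \<Rightarrow> 'f::real_normed_vector) \<Rightarrow> bool" where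
  "smooth_fun A f \<longleftrightarrow> (\<forall>c\<in>A. smooth_on (cmap c ` cdom c) (f \<circ> cinv c))"

type_synonym ('a, 'e, 'k) form1 = "'a \<Rightarrow> ('a, 'e) tvec \<Rightarrow> 'k"
type_synonym ('a, 'e, 'k) form2 = "'a \<Rightarrow> ('a, 'e) tvec \<Rightarrow> ('a, 'e) tvec \<Rightarrow> 'k"
type_synonym ('a, 'e, 'k) form3 = "'a \<Rightarrow> ('a, 'e) tvec \<Rightarrow> ('a, 'e) tvec \<Rightarrow> ('a, 'e) tvec \<Rightarrow> 'k"

definition smooth_form1 :: "('a, 'e::euclidean_space) chart set \<Rightarrow>
    ('a, 'e, 'k::real_normed_vector) form1 \<Rightarrow> bool" where
  "smooth_form1 A \<omega> \<longleftrightarrow>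
     (\<forall>c\<in>A. (\<forall>x\<in>cdom c. linear (\<lambda>e. \<omega> x (coord_vec A c x e))) \<and>
        (\<forall>e. smooth_on (cmap c ` cdom c) (\<lambda>u. \<omega> (cinv c u) (coord_vec A c (cinv c u) e))))"

text \<open>The wedge product with respect to a bilinear map \<open>b\<close>, that is
  \<open>(\<alpha> \<otimes> \<xi>, \<beta> \<otimes> \<eta>) \<mapsto> (\<alpha> \<and> \<beta>) \<otimes> b \<xi> \<eta>\<close>, normalized by
  \<open>(\<alpha> \<and> \<beta>) u v = \<alpha> u * \<beta> v - \<alpha> v * \<beta> u\<close>.\<close>

definition wedge11 :: "('k \<Rightarrow> 'l \<Rightarrow> 'm::ab_group_add) \<Rightarrow> ('v \<Rightarrow> 'k) \<Rightarrow> ('v \<Rightarrow> 'l) \<Rightarrow> 'v \<Rightarrow> 'v \<Rightarrow> 'm" where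
  "wedge11 b \<alpha> \<beta> u v = b (\<alpha> u) (\<beta> v) - b (\<alpha> v) (\<beta> u)"

definition wedge12 :: "('k \<Rightarrow> 'l \<Rightarrow> 'm::ab_group_add) \<Rightarrow> ('v \<Rightarrow> 'k) \<Rightarrow> ('v \<Rightarrow> 'v \<Rightarrow> 'l) \<Rightarrow>
    'v \<Rightarrow> 'v \<Rightarrow> 'v \<Rightarrow> 'm" where
  "wedge12 b \<alpha> \<beta> u v w = b (\<alpha> u) (\<beta> v w) - b (\<alpha> v) (\<beta> u w) + b (\<alpha> w) (\<beta> u v)"

text \<open>In the coordinates of a chart, the derivative of \<open>\<omega>(v)\<close> along \<open>u\<close> minus the derivative of
  \<open>\<omega>(u)\<close> along \<open>v\<close>, for vector fields with constant coefficients.\<close>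

definition ext_deriv :: "('a, 'e::euclidean_space) chart set \<Rightarrow>
    ('a, 'e, 'k::real_normed_vector) form1 \<Rightarrow> ('a, 'e, 'k) form2" where
  "ext_deriv A \<omega> x u v =
     (let c = chart_at A x; W = (\<lambda>e t. \<omega> (cinv c t) (coord_vec A c (cinv c t) e))
      in frechet_derivative (W (v c)) (at (cmap c x)) (u c)
       - frechet_derivative (W (u c)) (at (cmap c x)) (v c))"

definition pullback1 :: "('a, 'e::euclidean_space) chart set \<Rightarrow> ('b, 'f::euclidean_space) chart set \<Rightarrow>
    ('a \<Rightarrow> 'b) \<Rightarrow> ('b, 'f, 'k) form1 \<Rightarrow> ('a, 'e, 'k) form1" where
  "pullback1 A B f \<omega> x u = \<omega> (f x) (diff_map A B f x u)"

definition pullback3 :: "('a, 'e::euclidean_space) chart set \<Rightarrow> ('b, 'f::euclidean_space) chart set \<Rightarrow>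
    ('a \<Rightarrow> 'b) \<Rightarrow> ('b, 'f, 'k) form3 \<Rightarrow> ('a, 'e, 'k) form3" where
  "pullback3 A B f \<omega> x u v w =
     \<omega> (f x) (diff_map A B f x u) (diff_map A B f x v) (diff_map A B f x w)"

section \<open>Integration on compact oriented 3-manifolds\<close>

definition partition_of_unity :: "('a::topological_space, real^3) chart set \<Rightarrow> nat \<Rightarrow>
    (nat \<Rightarrow> ('a, real^3) chart) \<Rightarrow> (nat \<Rightarrow> 'a \<Rightarrow> real) \<Rightarrow> bool" where
  "partition_of_unity A n c f \<longleftrightarrow>
     (\<forall>i<n. c i \<in> A \<and> smooth_fun A (f i) \<and> (\<forall>x. 0 \<le> f i x) \<and>
        closure {x. f i x \<noteq> 0} \<subseteq> cdom (c i)) \<and>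
     (\<forall>x. (\<Sum>i<n. f i x) = 1)"

text \<open>The coefficient of \<open>dx\<^sub>1 \<and> dx\<^sub>2 \<and> dx\<^sub>3\<close>.\<close>

definition coeff3 :: "('a, real^3) chart set \<Rightarrow> ('a, real^3) chart \<Rightarrow> ('a, real^3, real) form3 \<Rightarrow>
    'a \<Rightarrow> real" where
  "coeff3 A c \<omega> x =
     \<omega> x (coord_vec A c x (axis 1 1)) (coord_vec A c x (axis 2 1)) (coord_vec A c x (axis 3 1))"

definition manifold_integral :: "('a::topological_space, real^3) chart set \<Rightarrow>
    ('a, real^3, real) form3 \<Rightarrow> real" where
  "manifold_integral A \<omega> =
     (THE I. \<forall>n c f. partition_of_unity A n c f \<longrightarrow>
        I = (\<Sum>i<n. integral (cmap (c i) ` cdom (c i))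
               (\<lambda>u. f i (cinv (c i) u) * coeff3 A (c i) \<omega> (cinv (c i) u))))"

text \<open>The volume form of an inner product on the standardly oriented \<open>\<real>\<^sup>3\<close>, and of a Riemannian
  metric on a manifold with an oriented atlas.\<close>

definition inner_vol :: "(real^3 \<Rightarrow> real^3 \<Rightarrow> real) \<Rightarrow> real^3 \<Rightarrow> real^3 \<Rightarrow> real^3 \<Rightarrow> real" where
  "inner_vol q u v w =
     sqrt (det (\<chi> i j. q (axis i 1) (axis j 1))) * det (vector [u, v, w] :: real^3^3)"

definition riemannian_vol_form :: "('a, real^3) chart set \<Rightarrow> ('a, real^3, real) form2 \<Rightarrow>
    ('a, real^3, real) form3" where
  "riemannian_vol_form A g x u v w = (let c = chart_at A x
     in inner_vol (\<lambda>d e. g x (coord_vec A c x d) (coord_vec A c x e)) (u c) (v c) (w c))"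

definition riemannian_volume :: "('a::topological_space, real^3) chart set \<Rightarrow>
    ('a, real^3, real) form2 \<Rightarrow> real" where
  "riemannian_volume A g = manifold_integral A (riemannian_vol_form A g)"

section \<open>Products and quotients\<close>

definition prod_atlas :: "('a, 'e) chart set \<Rightarrow> ('b, 'f) chart set \<Rightarrow> ('a \<times> 'b, 'e \<times> 'f) chart set" where
  "prod_atlas A B =
     {(cdom c \<times> cdom c', \<lambda>(x, y). (cmap c x, cmap c' y)) | c c'. c \<in> A \<and> c' \<in> B}"

definition vec_atlas :: "('e, 'e) chart set" where
  "vec_atlas = {(UNIV, id)}"

text \<open>The atlas making a covering \<open>p\<close> of the manifold with atlas \<open>A\<close> a local diffeomorphism.\<close>

definition cover_atlas :: "('b::topological_space \<Rightarrow> 'a) \<Rightarrow> ('a, 'e) chart set \<Rightarrow> ('b, 'e) chart set" where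
  "cover_atlas p A =
     {(W, cmap c \<circ> p) | W c. c \<in> A \<and> open W \<and> inj_on p W \<and> p ` W \<subseteq> cdom c}"

text \<open>The atlas on a quotient making the quotient map \<open>q\<close> a local diffeomorphism.\<close>

definition quotient_atlas :: "('a \<Rightarrow> 'b) \<Rightarrow> ('a, 'e) chart set \<Rightarrow> ('b, 'e) chart set" where
  "quotient_atlas q A = {(q ` cdom c, cmap c \<circ> inv_into (cdom c) q) | c. c \<in> A \<and> inj_on q (cdom c)}"

text \<open>Descending forms along a surjective local diffeomorphism \<open>q\<close>: a form on the source which is a
  pullback along \<open>q\<close> is evaluated at an arbitrary preimage of the point, on the preimages of the
  tangent vectors.\<close>

definition lift_vec :: "('a, 'e::euclidean_space) chart set \<Rightarrow> ('b, 'e) chart set \<Rightarrow> ('a \<Rightarrow> 'b) \<Rightarrow>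
    'a \<Rightarrow> ('b, 'e) tvec \<Rightarrow> ('a, 'e) tvec" where
  "lift_vec A B q z v = (THE u. u \<in> tangent_space A z \<and> diff_map A B q z u = v)"

definition descend1 :: "('a, 'e::euclidean_space) chart set \<Rightarrow> ('b, 'e) chart set \<Rightarrow> ('a \<Rightarrow> 'b) \<Rightarrow>
    ('a, 'e, 'k) form1 \<Rightarrow> ('b, 'e, 'k) form1" where
  "descend1 A B q \<omega> y u = (let z = (SOME z. q z = y) in \<omega> z (lift_vec A B q z u))"

definition descend3 :: "('a, 'e::euclidean_space) chart set \<Rightarrow> ('b, 'e) chart set \<Rightarrow> ('a \<Rightarrow> 'b) \<Rightarrow>
    ('a, 'e, 'k) form3 \<Rightarrow> ('b, 'e, 'k) form3" where
  "descend3 A B q \<omega> y u v w = (let z = (SOME z. q z = y)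
     in \<omega> z (lift_vec A B q z u) (lift_vec A B q z v) (lift_vec A B q z w))"

section \<open>Fundamental group and universal covering\<close>

definition loops_at :: "'a::topological_space \<Rightarrow> (real \<Rightarrow> 'a) set" where
  "loops_at x = {c. path c \<and> pathstart c = x \<and> pathfinish c = x}"

definition loop_class :: "'a::topological_space \<Rightarrow> (real \<Rightarrow> 'a) \<Rightarrow> (real \<Rightarrow> 'a) set" where
  "loop_class x c = {d \<in> loops_at x. homotopic_paths UNIV c d}"

definition fundamental_group :: "'a::topological_space \<Rightarrow> (real \<Rightarrow> 'a) set monoid" where
  "fundamental_group x =
     \<lparr>carrier = loop_class x ` loops_at x,
      mult = (\<lambda>C C'. loop_class x ((SOME c. c \<in> C) +++ (SOME c. c \<in> C'))),
      one = loop_class x (\<lambda>_. x)\<rparr>"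

definition universal_covering :: "('b::topological_space \<Rightarrow> 'a::topological_space) \<Rightarrow> bool" where
  "universal_covering p \<longleftrightarrow>
     covering_space UNIV p UNIV \<and> simply_connected (UNIV :: 'b set)"

text \<open>The endpoint of a lift starting at \<open>m\<^sub>0\<close> of a loop in the class \<open>C\<close>.\<close>

definition lift_end :: "('b::topological_space \<Rightarrow> 'a::topological_space) \<Rightarrow> 'b \<Rightarrow> (real \<Rightarrow> 'a) set \<Rightarrow> 'b" where
  "lift_end p m\<^sub>0 C = (SOME y. \<exists>c\<in>C. \<exists>l. path l \<and> pathstart l = m\<^sub>0 \<and> pathfinish l = y \<and>
     (\<forall>t\<in>{0..1}. p (l t) = c t))"

text \<open>The left action of the fundamental group based at \<open>p m\<^sub>0\<close> by deck transformations.\<close>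

definition deck_action :: "('b::topological_space \<Rightarrow> 'a::topological_space) \<Rightarrow> 'b \<Rightarrow>
    (real \<Rightarrow> 'a) set \<Rightarrow> 'b \<Rightarrow> 'b" where
  "deck_action p m\<^sub>0 C = (THE T. (\<exists>T'. homeomorphism UNIV UNIV T T') \<and> p \<circ> T = p \<and>
     T m\<^sub>0 = lift_end p m\<^sub>0 C)"

section \<open>The group Sol\<close>

definition sol_matrix :: "real^3 \<Rightarrow> real^3^3" where
  "sol_matrix a = vector [vector [exp (- a$3), 0, a$1], vector [0, exp (a$3), a$2], vector [0, 0, 1]]"

definition sol_mult :: "real^3 \<Rightarrow> real^3 \<Rightarrow> real^3" where
  "sol_mult a b = vector [a$1 + exp (- a$3) * b$1, a$2 + exp (a$3) * b$2, a$3 + b$3]"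

definition sol_inv :: "real^3 \<Rightarrow> real^3" where
  "sol_inv a = vector [- exp (a$3) * a$1, - exp (- a$3) * a$2, - a$3]"

lemma sol_matrix_mult: "sol_matrix (sol_mult a b) = sol_matrix a ** sol_matrix b"
  by (simp add: sol_matrix_def sol_mult_def matrix_matrix_mult_def vec_eq_iff forall_3 sum_3
      exp_add exp_diff exp_minus field_simps)

definition Sol :: "(real^3) monoid" where
  "Sol = \<lparr>carrier = UNIV, mult = sol_mult, one = 0\<rparr>"

lemma group_Sol: "group Sol"
proof (rule groupI)
  fix a
  assume "a \<in> carrier Sol"
  show "\<exists>y\<in>carrier Sol. y \<otimes>\<^bsub>Sol\<^esub> a = \<one>\<^bsub>Sol\<^esub>"
    by (rule bexI[of _ "sol_inv a"])
      (simp_all add: Sol_def sol_mult_def sol_inv_def vec_eq_iff forall_3 flip: exp_add mult.assoc)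
qed (simp_all add: Sol_def sol_mult_def vec_eq_iff forall_3 field_simps exp_add exp_diff exp_minus)

text \<open>The Lie algebra is the tangent space \<open>\<real>\<^sup>3\<close> at the neutral element \<open>0\<close>, with basis
  \<open>X = axis 1 1\<close>, \<open>Y = axis 2 1\<close>, \<open>Z = axis 3 1\<close>; its bracket is determined by
  \<open>[X,Z] = X\<close>, \<open>[Y,Z] = -Y\<close>, \<open>[X,Y] = 0\<close>.\<close>

definition sol_bracket :: "real^3 \<Rightarrow> real^3 \<Rightarrow> real^3" where
  "sol_bracket \<xi> \<eta> = (\<xi>$1 * \<eta>$3 - \<xi>$3 * \<eta>$1) *\<^sub>R axis 1 1 - (\<xi>$2 * \<eta>$3 - \<xi>$3 * \<eta>$2) *\<^sub>R axis 2 1"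

definition sol_form :: "real^3 \<Rightarrow> real^3 \<Rightarrow> real" where
  "sol_form \<xi> \<eta> = \<xi>$3 * \<eta>$3 / 2"

definition sol_Ad :: "real^3 \<Rightarrow> real^3 \<Rightarrow> real^3" where
  "sol_Ad h \<xi> = frechet_derivative (\<lambda>k. sol_mult (sol_mult h k) (sol_inv h)) (at 0) \<xi>"

definition sol_metric :: "real^3 \<Rightarrow> real^3 \<Rightarrow> real^3 \<Rightarrow> real" where
  "sol_metric a u v = exp (2 * a$3) * u$1 * v$1 + exp (- 2 * a$3) * u$2 * v$2 + u$3 * v$3"

text \<open>The left-invariant Maurer--Cartan form: the differential at \<open>a\<close> of left translation by the
  inverse of \<open>a\<close>.\<close>

definition maurer_cartan :: "real^3 \<Rightarrow> real^3 \<Rightarrow> real^3" where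
  "maurer_cartan a v = frechet_derivative (sol_mult (sol_inv a)) (at a) v"

text \<open>The coframe dual to \<open>exp (-z) \<partial>\<^sub>x\<close>, \<open>exp z \<partial>\<^sub>y\<close>, \<open>\<partial>\<^sub>z\<close>.\<close>

lemma maurer_cartan_eq: "maurer_cartan a v = vector [exp (a$3) * v$1, exp (- a$3) * v$2, v$3]"
proof -
  let ?L = "\<lambda>v::real^3. vector [exp (a$3) * v$1, exp (- a$3) * v$2, v$3] :: real^3"
  have lin: "linear ?L"
    by (rule linearI) (simp_all add: vec_eq_iff forall_3 algebra_simps)
  have "sol_mult (sol_inv a) = (\<lambda>b. sol_inv a + ?L b)"
    by (simp add: fun_eq_iff sol_mult_def sol_inv_def vec_eq_iff forall_3)
  then have "(sol_mult (sol_inv a) has_derivative ?L) (at a)"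
    using has_derivative_add[OF has_derivative_const
        linear_imp_has_derivative[OF lin, of "at a"], of "sol_inv a"] by simp
  from frechet_derivative_at[OF this, symmetric] show ?thesis
    by (simp add: maurer_cartan_def)
qed

text \<open>The left-invariant 3-form with value \<open>X\<^sup>* \<and> Y\<^sup>* \<and> Z\<^sup>*\<close> at the neutral element.\<close>

definition sol_vol :: "real^3 \<Rightarrow> real^3 \<Rightarrow> real^3 \<Rightarrow> real^3 \<Rightarrow> real" where
  "sol_vol a u v w =
     wedge12 (*) (\<lambda>\<xi>. \<xi>$1) (wedge11 (*) (\<lambda>\<xi>. \<xi>$2) (\<lambda>\<xi>. \<xi>$3))
       (maurer_cartan a u) (maurer_cartan a v) (maurer_cartan a w)"

section \<open>Sol geometry\<close>

text \<open>A Sol-structure on the oriented smooth manifold with atlas \<open>A\<close>: an atlas of charts with values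
  in Sol, compatible with the smooth structure and the orientation, whose coordinate changes are
  locally left translations.\<close>

definition sol_structure :: "('a::topological_space, real^3) chart set \<Rightarrow>
    ('a, real^3) chart set \<Rightarrow> bool" where
  "sol_structure A B \<longleftrightarrow> (\<Union>c\<in>B. cdom c) = UNIV \<and> oriented_atlas (A \<union> B) \<and>
     (\<forall>c\<in>B. \<forall>c'\<in>B. \<forall>x\<in>cdom c \<inter> cdom c'. \<exists>N h. open N \<and> x \<in> N \<and> N \<subseteq> cdom c \<inter> cdom c' \<and>
        (\<forall>y\<in>N. cmap c' y = sol_mult h (cmap c y)))"

definition developing_map :: "('a::topological_space, real^3) chart set \<Rightarrow>
    ('b::topological_space \<Rightarrow> 'a) \<Rightarrow> ('b \<Rightarrow> real^3) \<Rightarrow> bool" where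
  "developing_map B p D \<longleftrightarrow>
     (\<forall>c\<in>B. \<forall>m. p m \<in> cdom c \<longrightarrow> (\<exists>N h. open N \<and> m \<in> N \<and> p ` N \<subseteq> cdom c \<and>
        (\<forall>m'\<in>N. D m' = sol_mult h (cmap c (p m')))))"

definition holonomy :: "('b::topological_space \<Rightarrow> 'a::topological_space) \<Rightarrow> 'b \<Rightarrow>
    ('b \<Rightarrow> real^3) \<Rightarrow> ((real \<Rightarrow> 'a) set \<Rightarrow> real^3) \<Rightarrow> bool" where
  "holonomy p m\<^sub>0 D \<rho> \<longleftrightarrow> \<rho> \<in> hom (fundamental_group (p m\<^sub>0)) Sol \<and>
     (\<forall>C\<in>carrier (fundamental_group (p m\<^sub>0)). \<forall>m.
        D (deck_action p m\<^sub>0 C m) = sol_mult (\<rho> C) (D m))"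

text \<open>The pullback of \<open>g\<close> to the universal covering is the pullback of the standard metric
  by \<open>D\<close>.\<close>

definition induced_metric :: "('a, real^3) chart set \<Rightarrow> ('b::topological_space \<Rightarrow> 'a) \<Rightarrow>
    ('b \<Rightarrow> real^3) \<Rightarrow> ('a, real^3, real) form2 \<Rightarrow> bool" where
  "induced_metric A p D g \<longleftrightarrow>
     (let A' = cover_atlas p A in
      \<forall>m. \<forall>u\<in>tangent_space A' m. \<forall>v\<in>tangent_space A' m.
        g (p m) (diff_map A' A p m u) (diff_map A' A p m v) =
        sol_metric (D m) (diff_fun A' D m u) (diff_fun A' D m v))"

section \<open>The flat bundle of a representation\<close>

definition assoc_class :: "('b::topological_space \<Rightarrow> 'a::topological_space) \<Rightarrow> 'b \<Rightarrow>
    ((real \<Rightarrow> 'a) set \<Rightarrow> real^3) \<Rightarrow> 'b \<times> (real^3) \<Rightarrow> ('b \<times> (real^3)) set" where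
  "assoc_class p m\<^sub>0 \<rho> = (\<lambda>(m, h).
     {(deck_action p m\<^sub>0 C m, sol_mult (\<rho> C) h) | C. C \<in> carrier (fundamental_group (p m\<^sub>0))})"

definition flat_bundle :: "('b::topological_space \<Rightarrow> 'a::topological_space) \<Rightarrow> 'b \<Rightarrow>
    ((real \<Rightarrow> 'a) set \<Rightarrow> real^3) \<Rightarrow> ('b \<times> (real^3)) set set" where
  "flat_bundle p m\<^sub>0 \<rho> = range (assoc_class p m\<^sub>0 \<rho>)"

definition bundle_proj :: "('b \<Rightarrow> 'a) \<Rightarrow> ('b \<times> (real^3)) set \<Rightarrow> 'a" where
  "bundle_proj p y = p (fst (SOME z. z \<in> y))"

definition right_act :: "('b \<times> (real^3)) set \<Rightarrow> real^3 \<Rightarrow> ('b \<times> (real^3)) set" where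
  "right_act y h = (\<lambda>(m, k). (m, sol_mult k h)) ` y"

definition total_atlas :: "('a, real^3) chart set \<Rightarrow> ('b::topological_space \<Rightarrow> 'a) \<Rightarrow>
    ('b \<times> (real^3), (real^3) \<times> (real^3)) chart set" where
  "total_atlas A p = prod_atlas (cover_atlas p A) vec_atlas"

definition bundle_atlas :: "('a::topological_space, real^3) chart set \<Rightarrow>
    ('b::topological_space \<Rightarrow> 'a) \<Rightarrow> 'b \<Rightarrow> ((real \<Rightarrow> 'a) set \<Rightarrow> real^3) \<Rightarrow>
    (('b \<times> (real^3)) set, (real^3) \<times> (real^3)) chart set" where
  "bundle_atlas A p m\<^sub>0 \<rho> = quotient_atlas (assoc_class p m\<^sub>0 \<rho>) (total_atlas A p)"

definition smooth_section :: "('a::topological_space, real^3) chart set \<Rightarrow>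
    ('b::topological_space \<Rightarrow> 'a) \<Rightarrow> 'b \<Rightarrow> ((real \<Rightarrow> 'a) set \<Rightarrow> real^3) \<Rightarrow>
    ('a \<Rightarrow> ('b \<times> (real^3)) set) \<Rightarrow> bool" where
  "smooth_section A p m\<^sub>0 \<rho> s \<longleftrightarrow>
     (\<forall>x. s x \<in> flat_bundle p m\<^sub>0 \<rho> \<and> bundle_proj p (s x) = x) \<and>
     smooth_map A (bundle_atlas A p m\<^sub>0 \<rho>) s"

definition flat_connection :: "('a::topological_space, real^3) chart set \<Rightarrow>
    ('b::topological_space \<Rightarrow> 'a) \<Rightarrow> 'b \<Rightarrow> ((real \<Rightarrow> 'a) set \<Rightarrow> real^3) \<Rightarrow>
    (('b \<times> (real^3)) set, (real^3) \<times> (real^3), real^3) form1" where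
  "flat_connection A p m\<^sub>0 \<rho> =
     descend1 (total_atlas A p) (bundle_atlas A p m\<^sub>0 \<rho>) (assoc_class p m\<^sub>0 \<rho>)
       (\<lambda>z u. maurer_cartan (snd z) (diff_fun (total_atlas A p) snd z u))"

definition bundle_vol :: "('a::topological_space, real^3) chart set \<Rightarrow>
    ('b::topological_space \<Rightarrow> 'a) \<Rightarrow> 'b \<Rightarrow> ((real \<Rightarrow> 'a) set \<Rightarrow> real^3) \<Rightarrow>
    (('b \<times> (real^3)) set, (real^3) \<times> (real^3), real) form3" where
  "bundle_vol A p m\<^sub>0 \<rho> =
     descend3 (total_atlas A p) (bundle_atlas A p m\<^sub>0 \<rho>) (assoc_class p m\<^sub>0 \<rho>)
       (\<lambda>z u v w. sol_vol (snd z) (diff_fun (total_atlas A p) snd z u)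
          (diff_fun (total_atlas A p) snd z v) (diff_fun (total_atlas A p) snd z w))"

text \<open>The common value of the integral for all sections.\<close>

definition Vol_G :: "('a::topological_space, real^3) chart set \<Rightarrow>
    ('b::topological_space \<Rightarrow> 'a) \<Rightarrow> 'b \<Rightarrow> ((real \<Rightarrow> 'a) set \<Rightarrow> real^3) \<Rightarrow> real" where
  "Vol_G A p m\<^sub>0 \<rho> = (THE r. \<forall>s. smooth_section A p m\<^sub>0 \<rho> s \<longrightarrow>
     r = manifold_integral A
           (pullback3 A (bundle_atlas A p m\<^sub>0 \<rho>) s (bundle_vol A p m\<^sub>0 \<rho>)))"

section \<open>Chern--Simons invariant\<close>

text \<open>The first condition prescribes the values on the fundamental vector fields, the derivatives
  of the orbit maps at the neutral element.\<close>

definition principal_connection :: "('a::topological_space, real^3) chart set \<Rightarrow>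
    ('b::topological_space \<Rightarrow> 'a) \<Rightarrow> 'b \<Rightarrow> ((real \<Rightarrow> 'a) set \<Rightarrow> real^3) \<Rightarrow>
    (('b \<times> (real^3)) set, (real^3) \<times> (real^3), real^3) form1 \<Rightarrow> bool" where
  "principal_connection A p m\<^sub>0 \<rho> \<omega> \<longleftrightarrow>
     (let P = bundle_atlas A p m\<^sub>0 \<rho> in
      smooth_form1 P \<omega> \<and>
      (\<forall>y\<in>flat_bundle p m\<^sub>0 \<rho>. \<forall>\<xi>. \<omega> y (diff_from P (right_act y) 0 \<xi>) = \<xi>) \<and>
      (\<forall>y\<in>flat_bundle p m\<^sub>0 \<rho>. \<forall>h. \<forall>u\<in>tangent_space P y.
         pullback1 P P (\<lambda>y. right_act y h) \<omega> y u = sol_Ad (sol_inv h) (\<omega> y u)))"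

text \<open>The connection \<open>\<omega>\<^sup>s\<close>, with \<open>\<alpha>\<close>, \<open>\<beta>\<close> the first two components of the pullback by \<open>s\<close> of the
  flat connection. It is unique on tangent vectors of the bundle, which are the only arguments that
  matter below.\<close>

definition section_connection :: "('a::topological_space, real^3) chart set \<Rightarrow>
    ('b::topological_space \<Rightarrow> 'a) \<Rightarrow> 'b \<Rightarrow> ((real \<Rightarrow> 'a) set \<Rightarrow> real^3) \<Rightarrow>
    ('a \<Rightarrow> ('b \<times> (real^3)) set) \<Rightarrow> (('b \<times> (real^3)) set, (real^3) \<times> (real^3), real^3) form1" where
  "section_connection A p m\<^sub>0 \<rho> s =
     (SOME \<omega>. principal_connection A p m\<^sub>0 \<rho> \<omega> \<and>
        (\<forall>x. \<forall>u\<in>tangent_space A x.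
           let P = bundle_atlas A p m\<^sub>0 \<rho>;
               \<theta> = pullback1 A P s (flat_connection A p m\<^sub>0 \<rho>)
           in pullback1 A P s \<omega> x u = (\<theta> x u $ 1 + \<theta> x u $ 2) *\<^sub>R axis 3 1))"

text \<open>The integrand for connections \<open>\<omega>'\<close> and \<open>\<omega>\<close>. Here \<open>a = \<omega>' - \<omega>\<close>, a 1-form on the base with
  values in the adjoint bundle, is regarded as an equivariant horizontal form on the total space;
  the resulting real 3-form is basic, so it corresponds to the form on the base obtained by
  pulling it back along any section.\<close>

definition cs_form :: "('y, 'e::euclidean_space) chart set \<Rightarrow> ('y, 'e, real^3) form1 \<Rightarrow>
    ('y, 'e, real^3) form1 \<Rightarrow> ('y, 'e, real) form3" where
  "cs_form P \<omega>' \<omega> y u v w =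
     (let a = (\<lambda>y u. \<omega>' y u - \<omega> y u);
          da = (\<lambda>u v. ext_deriv P a y u v + wedge11 sol_bracket (\<omega> y) (a y) u v)
      in wedge12 sol_form (a y) da u v w
       + 1/3 * wedge12 sol_form (a y) (wedge11 sol_bracket (a y) (a y)) u v w)"

definition CS_vol :: "('a::topological_space, real^3) chart set \<Rightarrow>
    ('b::topological_space \<Rightarrow> 'a) \<Rightarrow> 'b \<Rightarrow> ((real \<Rightarrow> 'a) set \<Rightarrow> real^3) \<Rightarrow> real" where
  "CS_vol A p m\<^sub>0 \<rho> = (THE r. \<forall>s. smooth_section A p m\<^sub>0 \<rho> s \<longrightarrow>
     r = manifold_integral A
           (pullback3 A (bundle_atlas A p m\<^sub>0 \<rho>) s
             (cs_form (bundle_atlas A p m\<^sub>0 \<rho>)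
                (section_connection A p m\<^sub>0 \<rho> s) (flat_connection A p m\<^sub>0 \<rho>))))"

end

theory Submission
  imports Defs
begin

text \<open>The developing map \<open>D\<close> is a holonomy-equivariant map to Sol, so it trivializes the flat bundle
  and is itself a section; every other section is \<open>D \<cdot> \<psi>\<close> for a map \<open>\<psi>\<close> from \<open>M\<close> to Sol. If
  \<open>\<alpha> X + \<beta> Y + \<gamma> Z\<close> is the pullback of the flat connection by a section, the structure equations give
  \<open>d\<alpha> = \<gamma> \<and> \<alpha>\<close>, \<open>d\<beta> = - \<gamma> \<and> \<beta>\<close>, and since the bilinear form only sees \<open>Z\<close>, the Chern--Simons integrand is
  \<open>(\<alpha> + \<beta> - \<gamma>) \<and> d(\<alpha> + \<beta>) / 2 = \<alpha> \<and> \<beta> \<and> \<gamma>\<close>, pointwise the pullback of the volume form. Changing the section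
  by \<open>\<psi> = (x, y, z)\<close> changes this 3-form by three terms of the form \<open>d\<phi> \<and> \<eta>\<close> with \<open>\<eta>\<close> closed, one for each
  coordinate (Sol is unimodular), so the integral is the same for all sections by Stokes' theorem.
  For the section \<open>D\<close> the form is the Riemannian volume form. Stokes' theorem is only needed for the sums
  over one given partition of unity, because the integral is defined by a property of all of them.\<close>

section \<open>Smooth functions\<close>

text \<open>The holonomy condition is stated through \<open>deck_action\<close>, a definite
  description over lifts of loops. Before it says anything about the classes forming the flat
  bundle, deck transformations must be shown to exist, to be unique and to act transitively on the
  fibres of \<open>p\<close>; this is the purpose of the covering theory. The connection
  \<open>\<omega>\<^sup>s\<close> is an indefinite choice. An explicit connection shows that the
  choice is not empty, and then the prescribed properties alone determine its Z-component. The
  factor in the Chern--Simons integrand arises as follows. With \<kappa> = \<alpha> + \<beta> -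
  \<gamma> one has d\<kappa> = \<gamma> \<and> (\<alpha> - \<beta>), and exactly two products in
  \<kappa> \<and> d\<kappa> survive, both equal to \<alpha> \<and> \<beta> \<and> \<gamma>; the
  normalization <Z,Z> = 1/2 cancels the 2. Every bracket lies in the span of X and Y, which the form
  annihilates. Unimodularity enters through reciprocal scaling: each closed 2-form is dG1 \<and> dG2
  for functions known only in Sol charts, and a left translation multiplies one of them by a
  constant and the other by its inverse, up to additive constants.\<close>

abbreviation FD :: "('a::real_normed_vector \<Rightarrow> 'b::real_normed_vector) \<Rightarrow> 'a \<Rightarrow> 'a \<Rightarrow> 'b" where
  "FD f x \<equiv> frechet_derivative f (at x)"

lemma FD_eqI: "(f has_derivative f') (at x) \<Longrightarrow> FD f x = f'"
  using frechet_derivative_at by metis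

lemma FD_cong:
  assumes "open S" "x \<in> S" "\<And>y. y \<in> S \<Longrightarrow> f y = g y"
  shows "FD f x = FD g x"
proof -
  have "(f has_derivative f') (at x) \<longleftrightarrow> (g has_derivative f') (at x)" for f'
    using assms by (metis has_derivative_transform_within_open)
  then show ?thesis
    by (simp add: frechet_derivative_def)
qed

lemma differentiable_cong:
  assumes "open S" "x \<in> S" "\<And>y. y \<in> S \<Longrightarrow> f y = g y" "f differentiable (at x)"
  shows "g differentiable (at x)"
  using assms by (metis differentiable_def has_derivative_transform_within_open)

lemma FD_has_derivative: "f differentiable (at x) \<Longrightarrow> (f has_derivative FD f x) (at x)"
  by (simp add: frechet_derivative_works)

lemma FD_linear: "f differentiable (at x) \<Longrightarrow> linear (FD f x)"
  using FD_has_derivative has_derivative_linear by blast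

lemma FD_compose:
  assumes "g differentiable (at x)" "f differentiable (at (g x))"
  shows "FD (f \<circ> g) x v = FD f (g x) (FD g x v)"
  using diff_chain_at[OF FD_has_derivative[OF assms(1)] FD_has_derivative[OF assms(2)]]
  by (simp add: FD_eqI)

lemma Ck_on_SucD:
  assumes "Ck_on (Suc k) S f"
  shows "x \<in> S \<Longrightarrow> f differentiable (at x)" "x \<in> S \<Longrightarrow> (f has_derivative FD f x) (at x)"
    "Ck_on k S (\<lambda>x. FD f x v)"
  using assms by (auto simp: FD_has_derivative)

lemma Ck_on_cong:
  assumes "open S" "\<And>x. x \<in> S \<Longrightarrow> f x = g x" "Ck_on k S f"
  shows "Ck_on k S g"
  using assms(2,3)
proof (induction k arbitrary: f g)
  case 0
  then show ?case by (simp cong: continuous_on_cong)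
next
  case (Suc k)
  have "Ck_on k S (\<lambda>x. FD g x v)" for v
  proof (rule Suc.IH)
    show "FD f x v = FD g x v" if "x \<in> S" for x
      using FD_cong[OF assms(1) that, of f g] Suc.prems(1) by auto
    show "Ck_on k S (\<lambda>x. FD f x v)"
      using Suc.prems by simp
  qed
  moreover have "g differentiable (at x)" if "x \<in> S" for x
    using differentiable_cong[of S x f g] assms(1) that Suc.prems(1) Ck_on_SucD(1)[OF Suc.prems(2) that] by blast
  ultimately show ?case by simp
qed

lemma Ck_on_SucI:
  assumes "open S" "\<And>x. x \<in> S \<Longrightarrow> (f has_derivative f' x) (at x)" "\<And>v. Ck_on k S (\<lambda>x. f' x v)"
  shows "Ck_on (Suc k) S f"
proof -
  have "Ck_on k S (\<lambda>x. FD f x v)" for v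
    by (rule Ck_on_cong[OF assms(1) _ assms(3)]) (simp add: FD_eqI[OF assms(2)])
  then show ?thesis
    using assms(2) by (auto simp: differentiable_def)
qed

lemma Ck_on_local:
  assumes "\<And>x. x \<in> S \<Longrightarrow> \<exists>N. open N \<and> x \<in> N \<and> Ck_on k N f"
  shows "Ck_on k S f"
  using assms
proof (induction k arbitrary: f)
  case 0
  then show ?case
    by (auto intro!: continuous_at_imp_continuous_on) (metis continuous_on_eq_continuous_at)
next
  case (Suc k)
  have "Ck_on k S (\<lambda>x. FD f x v)" for v
  proof (rule Suc.IH)
    fix x assume "x \<in> S"
    then obtain N where N: "open N" "x \<in> N" "Ck_on (Suc k) N f"
      using Suc.prems by blast
    show "\<exists>N. open N \<and> x \<in> N \<and> Ck_on k N (\<lambda>x. FD f x v)"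
      using N(1,2) Ck_on_SucD(3)[OF N(3)] by blast
  qed
  moreover have "f differentiable (at x)" if "x \<in> S" for x
    using Suc.prems[OF that] Ck_on_SucD(1) by blast
  ultimately show ?case by simp
qed

lemma Ck_on_subset: "Ck_on k S f \<Longrightarrow> T \<subseteq> S \<Longrightarrow> Ck_on k T f"
  by (induction k arbitrary: f) (auto intro: continuous_on_subset)

lemma Ck_on_Suc: "Ck_on (Suc k) S f \<Longrightarrow> Ck_on k S f"
proof (induction k arbitrary: f)
  case 0
  then show ?case
    by (auto intro!: continuous_at_imp_continuous_on differentiable_imp_continuous_within)
qed auto

lemma Ck_on_const: "Ck_on k S (\<lambda>_. c)"
  by (induction k arbitrary: c) auto

lemma Ck_on_add: "Ck_on k S f \<Longrightarrow> Ck_on k S g \<Longrightarrow> open S \<Longrightarrow> Ck_on k S (\<lambda>x. f x + g x)"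
proof (induction k arbitrary: f g)
  case 0
  then show ?case by (auto intro: continuous_intros)
next
  case (Suc k)
  show ?case
  proof (rule Ck_on_SucI[OF Suc.prems(3)])
    fix x assume "x \<in> S"
    then show "((\<lambda>x. f x + g x) has_derivative (\<lambda>v. FD f x v + FD g x v)) (at x)"
      using Suc.prems by (intro has_derivative_add Ck_on_SucD(2)) auto
  next
    show "Ck_on k S (\<lambda>x. FD f x v + FD g x v)" for v
      using Suc by auto
  qed
qed

lemma Ck_on_sum:
  "finite I \<Longrightarrow> (\<And>i. i \<in> I \<Longrightarrow> Ck_on k S (f i)) \<Longrightarrow> open S \<Longrightarrow> Ck_on k S (\<lambda>x. \<Sum>i\<in>I. f i x)"
  by (induction I rule: finite_induct) (auto intro: Ck_on_add Ck_on_const)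

lemma Ck_on_bounded_linear:
  assumes "bounded_linear L" "Ck_on k S f" "open S"
  shows "Ck_on k S (\<lambda>x. L (f x))"
  using assms(2)
proof (induction k arbitrary: f)
  case 0
  then show ?case
    using assms(1) by (auto intro: bounded_linear.continuous_on)
next
  case (Suc k)
  have D: "((\<lambda>x. L (f x)) has_derivative (\<lambda>v. L (FD f x v))) (at x)" if "x \<in> S" for x
    using Suc.prems that by (auto intro!: bounded_linear.has_derivative[OF assms(1)] FD_has_derivative)
  have "Ck_on k S (\<lambda>x. L (FD f x v))" for v
    using Suc by auto
  from Ck_on_SucI[OF assms(3) D this] show ?case .
qed

lemma Ck_on_bilinear:
  assumes "bounded_bilinear b" "Ck_on k S f" "Ck_on k S g" "open S"
  shows "Ck_on k S (\<lambda>x. b (f x) (g x))"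
  using assms(2,3)
proof (induction k arbitrary: f g)
  case 0
  then show ?case
    using assms(1) by (auto intro: bounded_bilinear.continuous_on)
next
  case (Suc k)
  have D: "((\<lambda>x. b (f x) (g x)) has_derivative (\<lambda>v. b (f x) (FD g x v) + b (FD f x v) (g x))) (at x)"
    if "x \<in> S" for x
    using Suc.prems that by (auto intro!: bounded_bilinear.FDERIV[OF assms(1)] FD_has_derivative)
  have "Ck_on k S (\<lambda>x. b (f x) (FD g x v) + b (FD f x v) (g x))" for v
    using Suc.prems
    by (intro Ck_on_add Suc.IH assms(4)) (auto dest: Ck_on_Suc simp del: Ck_on.simps, auto)
  from Ck_on_SucI[OF assms(4) D this] show ?case .
qed

lemma Ck_on_compose:
  fixes f :: "'b::euclidean_space \<Rightarrow> 'c::real_normed_vector" and g :: "'a::real_normed_vector \<Rightarrow> 'b"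
  assumes "Ck_on k T f" "Ck_on k S g" "g ` S \<subseteq> T" "open S"
  shows "Ck_on k S (f \<circ> g)"
  using assms(1,2)
proof (induction k arbitrary: f)
  case 0
  then show ?case
    using assms(3) by (auto simp: o_def intro: continuous_on_compose2)
next
  case (Suc k)
  have d: "g differentiable (at x)" "f differentiable (at (g x))" if "x \<in> S" for x
    using Suc.prems that assms(3) by auto
  \<comment> \<open>\<open>Ck_on\<close> controls derivatives in a fixed direction, but here the
    direction \<open>FD g x v\<close> moves with \<open>x\<close>. Expanding it in the basis leaves
    fixed directions with variable coefficients.\<close>
  have D: "FD (f \<circ> g) x v = (\<Sum>b\<in>Basis. (FD g x v \<bullet> b) *\<^sub>R (FD f (g x) b))" if "x \<in> S" for x v
  proof -
    have "FD (f \<circ> g) x v = FD f (g x) (\<Sum>b\<in>Basis. (FD g x v \<bullet> b) *\<^sub>R b)"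
      using FD_compose[OF d[OF that]] by (simp add: euclidean_representation)
    then show ?thesis
      using FD_linear[OF d(2)[OF that]] by (simp add: linear_sum linear_cmul)
  qed
  have "Ck_on k S (\<lambda>x. FD f (g x) b)" for b
    using Suc.IH[of "\<lambda>y. FD f y b"] Suc.prems Ck_on_Suc[of k S g] by (auto simp: o_def)
  moreover have "Ck_on k S (\<lambda>x. FD g x v \<bullet> b)" for v b
    using Suc.prems by (intro Ck_on_bounded_linear[OF bounded_linear_inner_left] assms(4)) auto
  ultimately have "Ck_on k S (\<lambda>x. \<Sum>b\<in>Basis. (FD g x v \<bullet> b) *\<^sub>R (FD f (g x) b))" for v
    by (intro Ck_on_sum Ck_on_bilinear[OF bounded_bilinear_scaleR] assms(4)) auto
  then have "Ck_on k S (\<lambda>x. FD (f \<circ> g) x v)" for v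
    using D Ck_on_cong[OF assms(4)] by (metis (no_types, lifting))
  then show ?case
    unfolding Ck_on.simps using d differentiable_chain_at by blast
qed

lemma smooth_on_cong:
  "open S \<Longrightarrow> (\<And>x. x \<in> S \<Longrightarrow> f x = g x) \<Longrightarrow> smooth_on S f \<Longrightarrow> smooth_on S g"
  unfolding smooth_on_def using Ck_on_cong by blast

lemma smooth_on_local:
  assumes "\<And>x. x \<in> S \<Longrightarrow> \<exists>N. open N \<and> x \<in> N \<and> smooth_on N f"
  shows "smooth_on S f"
  unfolding smooth_on_def
proof
  fix k show "Ck_on k S f"
    using assms by (intro Ck_on_local) (meson smooth_on_def)
qed

lemma smooth_on_subset: "smooth_on S f \<Longrightarrow> T \<subseteq> S \<Longrightarrow> smooth_on T f"
  unfolding smooth_on_def using Ck_on_subset by blast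

lemma smooth_on_differentiable: "smooth_on S f \<Longrightarrow> x \<in> S \<Longrightarrow> f differentiable (at x)"
  unfolding smooth_on_def using Ck_on.simps(2) by blast

lemma smooth_on_FD: "smooth_on S f \<Longrightarrow> smooth_on S (\<lambda>x. FD f x v)"
  unfolding smooth_on_def using Ck_on.simps(2) by blast

lemma smooth_on_continuous: "smooth_on S f \<Longrightarrow> continuous_on S f"
  unfolding smooth_on_def using Ck_on.simps(1) by blast

lemma smooth_on_const: "smooth_on S (\<lambda>_. c)"
  by (simp add: smooth_on_def Ck_on_const)

lemma smooth_on_add: "open S \<Longrightarrow> smooth_on S f \<Longrightarrow> smooth_on S g \<Longrightarrow> smooth_on S (\<lambda>x. f x + g x)"
  by (simp add: smooth_on_def Ck_on_add)

lemma smooth_on_bounded_linear: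
  "bounded_linear L \<Longrightarrow> open S \<Longrightarrow> smooth_on S f \<Longrightarrow> smooth_on S (\<lambda>x. L (f x))"
  by (simp add: smooth_on_def Ck_on_bounded_linear)

lemma smooth_on_minus: "open S \<Longrightarrow> smooth_on S f \<Longrightarrow> smooth_on S (\<lambda>x. - f x)"
  by (rule smooth_on_bounded_linear[OF bounded_linear_minus[OF bounded_linear_ident]])

lemma smooth_on_diff: "open S \<Longrightarrow> smooth_on S f \<Longrightarrow> smooth_on S g \<Longrightarrow> smooth_on S (\<lambda>x. f x - g x)"
  using smooth_on_add[of S f "\<lambda>x. - g x"] smooth_on_minus[of S g] by simp

lemma smooth_on_bilinear:
  "bounded_bilinear b \<Longrightarrow> open S \<Longrightarrow> smooth_on S f \<Longrightarrow> smooth_on S g \<Longrightarrow> smooth_on S (\<lambda>x. b (f x) (g x))"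
  by (simp add: smooth_on_def Ck_on_bilinear)

lemmas smooth_on_mult = smooth_on_bilinear[OF bounded_bilinear_mult]
lemmas smooth_on_scaleR = smooth_on_bilinear[OF bounded_bilinear_scaleR]

lemma smooth_on_sum:
  "finite I \<Longrightarrow> open S \<Longrightarrow> (\<And>i. i \<in> I \<Longrightarrow> smooth_on S (f i)) \<Longrightarrow> smooth_on S (\<lambda>x. \<Sum>i\<in>I. f i x)"
  by (simp add: smooth_on_def Ck_on_sum)

lemma smooth_on_compose:
  fixes f :: "'b::euclidean_space \<Rightarrow> 'c::real_normed_vector" and g :: "'a::real_normed_vector \<Rightarrow> 'b"
  shows "smooth_on T f \<Longrightarrow> smooth_on S g \<Longrightarrow> g ` S \<subseteq> T \<Longrightarrow> open S \<Longrightarrow> smooth_on S (f \<circ> g)"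
  unfolding smooth_on_def using Ck_on_compose by blast

lemma smooth_on_id: "smooth_on S (\<lambda>x. x)"
proof -
  have "Ck_on k S (\<lambda>x. x)" for k
    by (cases k) (auto simp: Ck_on_const)
  then show ?thesis by (simp add: smooth_on_def)
qed

lemma smooth_on_Pair:
  assumes "open S" "smooth_on S f" "smooth_on S g"
  shows "smooth_on S (\<lambda>x. (f x, g x))"
proof -
  have "bounded_linear (\<lambda>x::'b. (x, 0::'c))" "bounded_linear (\<lambda>x::'c. (0::'b, x))"
    by (auto intro!: bounded_linear_Pair bounded_linear_ident bounded_linear_zero)
  then have "smooth_on S (\<lambda>x. (f x, 0) + (0, g x))"
    using assms by (intro smooth_on_add) (auto intro: smooth_on_bounded_linear)
  then show ?thesis by simp
qed

lemma smooth_on_fst: "open S \<Longrightarrow> smooth_on S f \<Longrightarrow> smooth_on S (\<lambda>x. fst (f x))"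
  by (rule smooth_on_bounded_linear[OF bounded_linear_fst])

lemma smooth_on_snd: "open S \<Longrightarrow> smooth_on S f \<Longrightarrow> smooth_on S (\<lambda>x. snd (f x))"
  by (rule smooth_on_bounded_linear[OF bounded_linear_snd])

lemma smooth_on_nth: "open S \<Longrightarrow> smooth_on S f \<Longrightarrow> smooth_on S (\<lambda>x. f x $ i)"
  by (rule smooth_on_bounded_linear[OF bounded_linear_vec_nth])

lemma smooth_on_vec:
  fixes f :: "'a::real_normed_vector \<Rightarrow> real^'n"
  assumes "open S" "\<And>i. smooth_on S (\<lambda>x. f x $ i)"
  shows "smooth_on S f"
proof -
  have "smooth_on S (\<lambda>x. \<Sum>i\<in>UNIV. f x $ i *\<^sub>R axis i (1::real))"
    using assms by (intro smooth_on_sum smooth_on_scaleR smooth_on_const) auto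
  moreover have "(\<lambda>x. \<Sum>i\<in>UNIV. f x $ i *\<^sub>R axis i (1::real)) = f"
    by (rule ext) (simp add: basis_expansion flip: scalar_mult_eq_scaleR)
  ultimately show ?thesis by (simp only:)
qed

lemma smooth_on_vector3:
  assumes "open S" "smooth_on S f" "smooth_on S g" "smooth_on S h"
  shows "smooth_on S (\<lambda>x. vector [f x, g x, h x] :: real^3)"
proof (rule smooth_on_vec[OF assms(1)])
  fix i :: 3
  show "smooth_on S (\<lambda>x. (vector [f x, g x, h x] :: real^3) $ i)"
    using exhaust_3[of i] assms by auto
qed

lemma smooth_on_exp:
  fixes f :: "'a::real_normed_vector \<Rightarrow> real"
  assumes "open S" "smooth_on S f"
  shows "smooth_on S (\<lambda>x. exp (f x))"
proof -
  have "Ck_on k UNIV (exp :: real \<Rightarrow> real)" for k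
  proof (induction k)
    case (Suc k)
    have D: "((exp :: real \<Rightarrow> real) has_derivative (\<lambda>v. v * exp x)) (at x)" for x
      using DERIV_exp[of x] by (simp add: has_field_derivative_def mult.commute[of _ "exp x"])
    have "Ck_on k UNIV (\<lambda>x::real. v * exp x)" for v
      using Suc by (intro Ck_on_bounded_linear[OF bounded_linear_mult_right]) auto
    then show ?case
      using D by (auto simp: FD_eqI[OF D] differentiable_def)
  qed (auto intro: continuous_intros)
  then have "smooth_on UNIV (exp :: real \<Rightarrow> real)"
    by (simp add: smooth_on_def)
  from smooth_on_compose[OF this assms(2)] assms(1) show ?thesis
    by (simp add: o_def)
qed

lemmas smooth_intros = smooth_on_const smooth_on_add smooth_on_minus smooth_on_diff smooth_on_mult
  smooth_on_scaleR smooth_on_id smooth_on_Pair smooth_on_fst smooth_on_snd smooth_on_nth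
  smooth_on_vector3 smooth_on_exp smooth_on_FD

section \<open>Symmetry of second derivatives\<close>

lemma second_difference:
  fixes f :: "'a::real_normed_vector \<Rightarrow> real"
  assumes "0 < h" and in_S: "\<And>a b. 0 \<le> a \<Longrightarrow> a \<le> h \<Longrightarrow> 0 \<le> b \<Longrightarrow> b \<le> h \<Longrightarrow> x + a *\<^sub>R u + b *\<^sub>R v \<in> S"
    and C2: "Ck_on (Suc (Suc 0)) S f"
  obtains a b where "0 < a" "a < h" "0 < b" "b < h"
    "f (x + h *\<^sub>R u + h *\<^sub>R v) - f (x + h *\<^sub>R u) - f (x + h *\<^sub>R v) + f x
     = h * (h * FD (\<lambda>y. FD f y u) (x + a *\<^sub>R u + b *\<^sub>R v) v)"
proof -
  have D1: "((\<lambda>s. f (w + s *\<^sub>R u)) has_real_derivative FD f (w + s *\<^sub>R u) u) (at s)"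
    if "w + s *\<^sub>R u \<in> S" for w s
  proof -
    have "f differentiable (at (w + s *\<^sub>R u))"
      using C2 that by simp
    then have "((\<lambda>s. f (w + s *\<^sub>R u)) has_derivative (\<lambda>r. FD f (w + s *\<^sub>R u) (r *\<^sub>R u))) (at s)"
      by (intro has_derivative_compose[of "\<lambda>s. w + s *\<^sub>R u" "\<lambda>r. r *\<^sub>R u" s UNIV f])
        (auto intro!: derivative_eq_intros FD_has_derivative)
    moreover have "(\<lambda>r. FD f (w + s *\<^sub>R u) (r *\<^sub>R u)) = (*) (FD f (w + s *\<^sub>R u) u)"
      using FD_linear[OF \<open>f differentiable _\<close>] by (auto simp: linear_cmul)
    ultimately show ?thesis
      by (simp add: has_field_derivative_def)
  qed
  have D2: "((\<lambda>s. FD f (w + s *\<^sub>R v) u) has_real_derivative FD (\<lambda>y. FD f y u) (w + s *\<^sub>R v) v) (at s)"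
    if "w + s *\<^sub>R v \<in> S" for w s
  proof -
    have "(\<lambda>y. FD f y u) differentiable (at (w + s *\<^sub>R v))"
      using C2 that by simp
    then have "((\<lambda>s. FD f (w + s *\<^sub>R v) u) has_derivative (\<lambda>r. FD (\<lambda>y. FD f y u) (w + s *\<^sub>R v) (r *\<^sub>R v))) (at s)"
      by (intro has_derivative_compose[of "\<lambda>s. w + s *\<^sub>R v" "\<lambda>r. r *\<^sub>R v" s UNIV "\<lambda>y. FD f y u"])
        (auto intro!: derivative_eq_intros FD_has_derivative)
    moreover have "(\<lambda>r. FD (\<lambda>y. FD f y u) (w + s *\<^sub>R v) (r *\<^sub>R v)) = (*) (FD (\<lambda>y. FD f y u) (w + s *\<^sub>R v) v)"
      using FD_linear[OF \<open>(\<lambda>y. FD f y u) differentiable _\<close>] by (auto simp: linear_cmul)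
    ultimately show ?thesis
      by (simp add: has_field_derivative_def)
  qed
  \<comment> \<open>\<open>?\<phi> h - ?\<phi> 0\<close> is the second difference. The mean value
    theorem in direction \<open>u\<close>, and then in direction \<open>v\<close>, produces the two
    intermediate parameters.\<close>
  let ?\<phi> = "\<lambda>s. f ((x + h *\<^sub>R v) + s *\<^sub>R u) - f (x + s *\<^sub>R u)"
  have "DERIV ?\<phi> s :> FD f ((x + h *\<^sub>R v) + s *\<^sub>R u) u - FD f (x + s *\<^sub>R u) u" if "0 \<le> s" "s \<le> h" for s
    using in_S[of s h] in_S[of s 0] that \<open>0 < h\<close>
    by (intro DERIV_diff D1) (simp_all add: algebra_simps)
  from MVT2[OF \<open>0 < h\<close> this] obtain a where a: "0 < a" "a < h"
    "?\<phi> h - ?\<phi> 0 = h * (FD f ((x + h *\<^sub>R v) + a *\<^sub>R u) u - FD f (x + a *\<^sub>R u) u)" by auto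
  let ?\<chi> = "\<lambda>t. FD f ((x + a *\<^sub>R u) + t *\<^sub>R v) u"
  have "DERIV ?\<chi> t :> FD (\<lambda>y. FD f y u) ((x + a *\<^sub>R u) + t *\<^sub>R v) v" if "0 \<le> t" "t \<le> h" for t
    using in_S[of a t] that a by (intro D2) auto
  from MVT2[OF \<open>0 < h\<close> this] obtain b where b: "0 < b" "b < h"
    "?\<chi> h - ?\<chi> 0 = h * FD (\<lambda>y. FD f y u) ((x + a *\<^sub>R u) + b *\<^sub>R v) v" by auto
  show thesis
    using that[of a b] a b by (simp add: algebra_simps)
qed

text \<open>The second difference is symmetric in \<open>u\<close> and \<open>v\<close>. By
  \<open>second_difference\<close> the two mixed derivatives therefore take equal values at two
  points arbitrarily close to \<open>x\<close>, and continuity excludes a gap at \<open>x\<close>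
  itself.\<close>

lemma FD_symmetric:
  fixes f :: "'a::real_normed_vector \<Rightarrow> real"
  assumes "open S" "x \<in> S" and C2: "Ck_on (Suc (Suc 0)) S f"
  shows "FD (\<lambda>y. FD f y u) x v = FD (\<lambda>y. FD f y v) x u"
proof (rule ccontr)
  let ?P = "\<lambda>y. FD (\<lambda>y. FD f y u) y v" and ?Q = "\<lambda>y. FD (\<lambda>y. FD f y v) y u"
  assume "?P x \<noteq> ?Q x"
  then have "0 < dist (?P x) (?Q x) / 2" by simp
  moreover have "continuous (at x) ?P" "continuous (at x) ?Q"
    using C2 assms(1,2) by (auto simp: continuous_on_eq_continuous_at)
  ultimately obtain d1 d2 where d: "0 < d1" "0 < d2"
      "\<And>y. dist y x < d1 \<Longrightarrow> dist (?P y) (?P x) < dist (?P x) (?Q x) / 2"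
      "\<And>y. dist y x < d2 \<Longrightarrow> dist (?Q y) (?Q x) < dist (?P x) (?Q x) / 2"
    unfolding continuous_at_eps_delta by metis
  obtain d3 where d3: "0 < d3" "ball x d3 \<subseteq> S"
    using assms(1,2) open_contains_ball by metis
  \<comment> \<open>This size keeps the whole parallelogram inside all three balls; the summand 1
    makes the denominator positive and the estimate below strict.\<close>
  define h where "h = Min {d1, d2, d3} / (norm u + norm v + 1)"
  have "0 < h" and h: "h * (norm u + norm v + 1) = Min {d1, d2, d3}"
    using d d3 by (auto simp: h_def add_nonneg_pos intro!: divide_pos_pos)
      (smt (verit, best) norm_ge_zero)
  have near: "dist (x + a *\<^sub>R u + b *\<^sub>R v) x < Min {d1, d2, d3}" if "0 \<le> a" "a \<le> h" "0 \<le> b" "b \<le> h" for a b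
  proof -
    have "dist (x + a *\<^sub>R u + b *\<^sub>R v) x = norm (a *\<^sub>R u + b *\<^sub>R v)"
      by (simp add: dist_norm)
    also have "\<dots> \<le> a * norm u + b * norm v"
      using that by (intro order.trans[OF norm_triangle_ineq]) simp
    also have "\<dots> \<le> h * norm u + h * norm v"
      using that by (intro add_mono mult_right_mono) auto
    also have "\<dots> < Min {d1, d2, d3}"
      using \<open>0 < h\<close> by (simp only: distrib_left mult_1_right flip: h)
    finally show ?thesis .
  qed
  have "x + a *\<^sub>R u + b *\<^sub>R v \<in> S" if "0 \<le> a" "a \<le> h" "0 \<le> b" "b \<le> h" for a b
    using near[OF that] d3 by (auto simp: dist_commute)
  from second_difference[OF \<open>0 < h\<close> this C2] obtain a b where
    ab: "0 < a" "a < h" "0 < b" "b < h" and e1: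
    "f (x + h *\<^sub>R u + h *\<^sub>R v) - f (x + h *\<^sub>R u) - f (x + h *\<^sub>R v) + f x = h * (h * ?P (x + a *\<^sub>R u + b *\<^sub>R v))"
    by auto
  have "x + a *\<^sub>R v + b *\<^sub>R u \<in> S" if "0 \<le> a" "a \<le> h" "0 \<le> b" "b \<le> h" for a b
    using near[OF that(3,4,1,2)] d3 by (auto simp: dist_commute algebra_simps)
  from second_difference[OF \<open>0 < h\<close> this C2] obtain a' b' where
    ab': "0 < a'" "a' < h" "0 < b'" "b' < h" and e2:
    "f (x + h *\<^sub>R v + h *\<^sub>R u) - f (x + h *\<^sub>R v) - f (x + h *\<^sub>R u) + f x = h * (h * ?Q (x + a' *\<^sub>R v + b' *\<^sub>R u))"
    by auto
  have "?P (x + a *\<^sub>R u + b *\<^sub>R v) = ?Q (x + b' *\<^sub>R u + a' *\<^sub>R v)"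
    using e1 e2 \<open>0 < h\<close> by (simp add: algebra_simps)
  moreover have "dist (?P (x + a *\<^sub>R u + b *\<^sub>R v)) (?P x) < dist (?P x) (?Q x) / 2"
    using near[of a b] ab by (intro d(3)) auto
  moreover have "dist (?Q (x + b' *\<^sub>R u + a' *\<^sub>R v)) (?Q x) < dist (?P x) (?Q x) / 2"
    using near[of b' a'] ab' by (intro d(4)) auto
  ultimately show False
    by (metis dist_commute dist_triangle_half_r less_irrefl)
qed

section \<open>Calculus in charts\<close>

text \<open>The total space of the flat bundle carries no topology as a type; the calculus below only
  uses the coordinate changes.\<close>

definition pre_atlas :: "('a, 'e::euclidean_space) chart set \<Rightarrow> bool" where
  "pre_atlas A \<longleftrightarrow> (\<forall>c\<in>A. inj_on (cmap c) (cdom c)) \<and>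
     (\<forall>c\<in>A. \<forall>c'\<in>A. open (cmap c ` (cdom c \<inter> cdom c')) \<and>
        smooth_on (cmap c ` (cdom c \<inter> cdom c')) (cmap c' \<circ> cinv c))"

lemma smooth_atlas_imp_pre_atlas:
  assumes "smooth_atlas A"
  shows "pre_atlas A"
proof -
  have "inj_on (cmap c) (cdom c)" if "c \<in> A" for c
    using assms that unfolding smooth_atlas_def topological_chart_def homeomorphism_def
    by (metis inj_on_inverseI)
  moreover have "open (cmap c ` (cdom c \<inter> cdom c'))" if "c \<in> A" "c' \<in> A" for c c'
  proof -
    have "topological_chart c" "topological_chart c'"
      using assms that by (auto simp: smooth_atlas_def)
    then have "openin (top_of_set (cmap c ` cdom c)) (cmap c ` (cdom c \<inter> cdom c'))"
      unfolding topological_chart_def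
      by (intro homeomorphism_imp_open_map[of _ _ _ "cinv c"]) (auto intro: openin_open_Int)
    then show ?thesis
      using \<open>topological_chart c\<close> openin_open_trans topological_chart_def by blast
  qed
  ultimately show ?thesis
    using assms by (auto simp: pre_atlas_def smooth_atlas_def)
qed

context
  fixes A :: "('a, 'e::euclidean_space) chart set"
  assumes pre: "pre_atlas A"
begin

lemma cinv_cmap: "c \<in> A \<Longrightarrow> x \<in> cdom c \<Longrightarrow> cinv c (cmap c x) = x"
  using pre by (auto simp: pre_atlas_def cinv_def)

lemma cmap_cinv: "u \<in> cmap c ` cdom c \<Longrightarrow> cmap c (cinv c u) = u"
  by (simp add: cinv_def f_inv_into_f)

lemma cinv_in: "u \<in> cmap c ` cdom c \<Longrightarrow> cinv c u \<in> cdom c"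
  by (simp add: cinv_def inv_into_into)

lemma open_overlap: "c \<in> A \<Longrightarrow> c' \<in> A \<Longrightarrow> open (cmap c ` (cdom c \<inter> cdom c'))"
  using pre by (auto simp: pre_atlas_def)

lemma open_image: "c \<in> A \<Longrightarrow> open (cmap c ` cdom c)"
  using open_overlap[of c c] by simp

lemma smooth_transition:
  "c \<in> A \<Longrightarrow> c' \<in> A \<Longrightarrow> smooth_on (cmap c ` (cdom c \<inter> cdom c')) (cmap c' \<circ> cinv c)"
  using pre by (auto simp: pre_atlas_def)

lemma transition_differentiable:
  "c \<in> A \<Longrightarrow> c' \<in> A \<Longrightarrow> x \<in> cdom c \<Longrightarrow> x \<in> cdom c' \<Longrightarrow> (cmap c' \<circ> cinv c) differentiable (at (cmap c x))"
  by (rule smooth_on_differentiable[OF smooth_transition]) auto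

lemma change_chart:
  fixes f :: "'a \<Rightarrow> 'f::real_normed_vector"
  assumes c: "c \<in> A" "x \<in> cdom c" and c': "c' \<in> A" "x \<in> cdom c'"
    and d: "(f \<circ> cinv c') differentiable (at (cmap c' x))"
  shows "(f \<circ> cinv c) differentiable (at (cmap c x))"
    and "FD (f \<circ> cinv c) (cmap c x) v = FD (f \<circ> cinv c') (cmap c' x) (FD (cmap c' \<circ> cinv c) (cmap c x) v)"
proof -
  let ?S = "cmap c ` (cdom c \<inter> cdom c')"
  have eq: "((f \<circ> cinv c') \<circ> (cmap c' \<circ> cinv c)) u = (f \<circ> cinv c) u" if "u \<in> ?S" for u
    using that c c' by (auto simp: cinv_cmap)
  have at: "(cmap c' \<circ> cinv c) (cmap c x) = cmap c' x"
    using c by (simp add: cinv_cmap)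
  note S = open_overlap[OF c(1) c'(1)]
  have x: "cmap c x \<in> ?S" using c c' by auto
  note t = transition_differentiable[OF c(1) c'(1) c(2) c'(2)]
  have "((f \<circ> cinv c') \<circ> (cmap c' \<circ> cinv c)) differentiable (at (cmap c x))"
    using differentiable_chain_at[OF t] d at by simp
  then show "(f \<circ> cinv c) differentiable (at (cmap c x))"
    by (rule differentiable_cong[OF S x, rotated]) (rule eq)
  have "FD (f \<circ> cinv c) (cmap c x) = FD ((f \<circ> cinv c') \<circ> (cmap c' \<circ> cinv c)) (cmap c x)"
    by (rule FD_cong[OF S x]) (rule eq[symmetric])
  then show "FD (f \<circ> cinv c) (cmap c x) v = FD (f \<circ> cinv c') (cmap c' x) (FD (cmap c' \<circ> cinv c) (cmap c x) v)"
    using FD_compose[OF t, of "f \<circ> cinv c'"] d at by simp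
qed

lemma transition_id: "c \<in> A \<Longrightarrow> x \<in> cdom c \<Longrightarrow> FD (cmap c \<circ> cinv c) (cmap c x) v = v"
proof -
  assume c: "c \<in> A" "x \<in> cdom c"
  have "FD (cmap c \<circ> cinv c) (cmap c x) = FD (\<lambda>u. u) (cmap c x)"
    using c by (intro FD_cong[OF open_image[OF c(1)]]) (auto simp: cinv_cmap)
  then show ?thesis
    using FD_eqI[OF has_derivative_ident] by metis
qed

lemma coord_vec_same: "c \<in> A \<Longrightarrow> x \<in> cdom c \<Longrightarrow> coord_vec A c x e c = e"
  by (simp add: coord_vec_def transition_id)

text \<open>The chain rule gives the cocycle identity for the derivatives of the coordinate changes,
  so the family built from one chart is recovered from its component in any other.\<close>

lemma coord_vec_tangent: "c \<in> A \<Longrightarrow> x \<in> cdom c \<Longrightarrow> coord_vec A c x e \<in> tangent_space A x"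
proof -
  assume c: "c \<in> A" "x \<in> cdom c"
  have "FD (cmap c'' \<circ> cinv c) (cmap c x) e =
      FD (cmap c'' \<circ> cinv c') (cmap c' x) (FD (cmap c' \<circ> cinv c) (cmap c x) e)"
    if "c' \<in> A" "x \<in> cdom c'" "c'' \<in> A" "x \<in> cdom c''" for c' c''
    using that c by (intro change_chart(2) transition_differentiable)
  note chain = this
  have vec: "coord_vec A b x w b' = FD (cmap b' \<circ> cinv b) (cmap b x) w" if "b' \<in> A" "x \<in> cdom b'" for b b' w
    using that by (simp add: coord_vec_def)
  have zero: "coord_vec A b x w b' = 0" if "\<not> (b' \<in> A \<and> x \<in> cdom b')" for b b' w
    using that by (simp only: coord_vec_def if_False)
  have "coord_vec A c x e = coord_vec A c' x (coord_vec A c x e c')" if c': "c' \<in> A" "x \<in> cdom c'" for c'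
  proof
    fix c''
    show "coord_vec A c x e c'' = coord_vec A c' x (coord_vec A c x e c') c''"
    proof (cases "c'' \<in> A \<and> x \<in> cdom c''")
      case True
      show ?thesis
        unfolding vec[OF conjunct1[OF True] conjunct2[OF True]] vec[OF c']
        by (rule chain[OF c' conjunct1[OF True] conjunct2[OF True]])
    qed (simp add: zero)
  qed
  moreover have "coord_vec A c x e c' = 0" if "\<not> (c' \<in> A \<and> x \<in> cdom c')" for c'
    using that by (simp only: coord_vec_def if_False)
  ultimately show ?thesis
    unfolding tangent_space_def by blast
qed

lemma tangent_coord: "v \<in> tangent_space A x \<Longrightarrow> c \<in> A \<Longrightarrow> x \<in> cdom c \<Longrightarrow> coord_vec A c x (v c) = v"
  unfolding tangent_space_def by simp

lemma tangent_apply: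
  "v \<in> tangent_space A x \<Longrightarrow> c \<in> A \<Longrightarrow> x \<in> cdom c \<Longrightarrow> c' \<in> A \<Longrightarrow> x \<in> cdom c' \<Longrightarrow>
   v c' = FD (cmap c' \<circ> cinv c) (cmap c x) (v c)"
  using fun_cong[OF tangent_coord[of v x c], of c'] by (simp add: coord_vec_def)

lemma chart_at: "c \<in> A \<Longrightarrow> x \<in> cdom c \<Longrightarrow> chart_at A x \<in> A \<and> x \<in> cdom (chart_at A x)"
  unfolding chart_at_def by (rule someI[of _ c]) simp

text \<open>Makes the arbitrary chart inside \<open>diff_fun\<close> harmless: any chart of the
  atlas around \<open>x\<close> computes it.\<close>

lemma diff_fun_eq:
  assumes "c \<in> A" "x \<in> cdom c" "(f \<circ> cinv c) differentiable (at (cmap c x))" "v \<in> tangent_space A x"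
  shows "diff_fun A f x v = FD (f \<circ> cinv c) (cmap c x) (v c)"
proof -
  let ?c = "chart_at A x"
  have c': "?c \<in> A" "x \<in> cdom ?c"
    using chart_at assms by auto
  show ?thesis
    using change_chart(2)[OF c' assms(1-3)] tangent_apply[OF assms(4) c' assms(1,2)]
    unfolding diff_fun_def Let_def by simp
qed

end

text \<open>By the chain rule one chart on each side determines all components of the image vector.
  Pushforwards are computed through this lemma below; \<open>U\<close> keeps the image inside the
  domain of a single target chart.\<close>

lemma diff_map_eq:
  assumes A: "pre_atlas A" and B: "pre_atlas B"
    and c: "c \<in> A" "x \<in> cdom c" and c': "c' \<in> B"
    and U: "open U" "cmap c x \<in> U" "\<And>u. u \<in> U \<Longrightarrow> f (cinv c u) \<in> cdom c'"
    and d: "(cmap c' \<circ> f \<circ> cinv c) differentiable (at (cmap c x))"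
    and v: "v \<in> tangent_space A x"
  shows "diff_map A B f x v = coord_vec B c' (f x) (FD (cmap c' \<circ> f \<circ> cinv c) (cmap c x) (v c))"
proof
  fix c''
  have fx: "f x \<in> cdom c'"
    using U c cinv_cmap[OF A] by metis
  show "diff_map A B f x v c'' = coord_vec B c' (f x) (FD (cmap c' \<circ> f \<circ> cinv c) (cmap c x) (v c)) c''"
  proof (cases "c'' \<in> B \<and> f x \<in> cdom c''")
    case True
    let ?g = "(cmap c'' \<circ> cinv c') \<circ> (cmap c' \<circ> f \<circ> cinv c)"
    have eq: "?g u = (cmap c'' \<circ> f \<circ> cinv c) u" if "u \<in> U" for u
      using U(3)[OF that] c' by (simp add: cinv_cmap[OF B])
    have at: "(cmap c' \<circ> f \<circ> cinv c) (cmap c x) = cmap c' (f x)"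
      using c by (simp add: cinv_cmap[OF A])
    have t: "(cmap c'' \<circ> cinv c') differentiable (at ((cmap c' \<circ> f \<circ> cinv c) (cmap c x)))"
      unfolding at using True c' fx by (intro transition_differentiable[OF B]) auto
    have g: "?g differentiable (at (cmap c x))"
      using differentiable_chain_at[OF d t] .
    have 1: "diff_fun A (cmap c'' \<circ> f) x v = FD (cmap c'' \<circ> f \<circ> cinv c) (cmap c x) (v c)"
      by (intro diff_fun_eq[OF A c _ v] differentiable_cong[OF U(1,2) eq g])
    have 2: "FD (cmap c'' \<circ> f \<circ> cinv c) (cmap c x) = FD ?g (cmap c x)"
      by (rule FD_cong[OF U(1,2)]) (rule eq[symmetric])
    have "diff_fun A (cmap c'' \<circ> f) x v
        = FD (cmap c'' \<circ> cinv c') (cmap c' (f x)) (FD (cmap c' \<circ> f \<circ> cinv c) (cmap c x) (v c))"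
      unfolding 1 2 at[symmetric] by (rule FD_compose[OF d t])
    then show ?thesis
      using True by (simp add: diff_map_def coord_vec_def)
  qed (auto simp: diff_map_def coord_vec_def)
qed

lemma diff_from_eq:
  fixes f :: "'e::euclidean_space \<Rightarrow> 'b"
  assumes B: "pre_atlas B" and c': "c' \<in> B"
    and U: "open U" "t \<in> U" "\<And>u. u \<in> U \<Longrightarrow> f u \<in> cdom c'"
    and d: "(cmap c' \<circ> f) differentiable (at t)"
  shows "diff_from B f t e = coord_vec B c' (f t) (FD (cmap c' \<circ> f) t e)"
proof
  fix c''
  have fx: "f t \<in> cdom c'"
    using U by metis
  show "diff_from B f t e c'' = coord_vec B c' (f t) (FD (cmap c' \<circ> f) t e) c''"
  proof (cases "c'' \<in> B \<and> f t \<in> cdom c''")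
    case True
    let ?g = "(cmap c'' \<circ> cinv c') \<circ> (cmap c' \<circ> f)"
    have eq: "?g u = (cmap c'' \<circ> f) u" if "u \<in> U" for u
      using U(3)[OF that] c' by (simp add: cinv_cmap[OF B])
    have t: "(cmap c'' \<circ> cinv c') differentiable (at ((cmap c' \<circ> f) t))"
      using True c' fx by (simp add: transition_differentiable[OF B])
    have "FD (cmap c'' \<circ> f) t = FD ?g t"
      by (rule FD_cong[OF U(1,2)]) (rule eq[symmetric])
    then have "FD (cmap c'' \<circ> f) t e = FD ?g t e"
      by simp
    also have "\<dots> = FD (cmap c'' \<circ> cinv c') ((cmap c' \<circ> f) t) (FD (cmap c' \<circ> f) t e)"
      by (rule FD_compose[OF d t])
    finally show ?thesis
      using True by (simp add: diff_from_def coord_vec_def)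
  qed (auto simp: diff_from_def coord_vec_def)
qed

section \<open>Covering spaces\<close>

text \<open>Quantifying over all starting points and all points above them is what allows gluing:
  the lift over a second piece can be started at any value of the first lift.\<close>

definition liftable :: "('b::topological_space \<Rightarrow> 'a) \<Rightarrow> 'c::topological_space set \<Rightarrow> ('c \<Rightarrow> 'a) \<Rightarrow> bool" where
  "liftable p R h \<longleftrightarrow> (\<forall>z0\<in>R. \<forall>y. p y = h z0 \<longrightarrow>
     (\<exists>l. continuous_on R l \<and> l z0 = y \<and> (\<forall>z\<in>R. p (l z) = h z)))"

lemma covering_slice:
  fixes p :: "'b::topological_space \<Rightarrow> 'a::topological_space"
  assumes "covering_space UNIV p UNIV"
  obtains V U q where "open V" "m \<in> V" "open U" "homeomorphism V U p q"
proof -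
  obtain V U q where V: "m \<in> V" "openin (top_of_set UNIV) V" "openin (top_of_set UNIV) U" "homeomorphism V U p q"
    using covering_space_local_homeomorphism[OF assms UNIV_I[of m]] by metis
  show thesis
    by (rule that[OF _ V(1) _ V(4)]) (use V(2,3) in \<open>metis open_openin subtopology_UNIV\<close>)+
qed

text \<open>The set of agreement is open because \<open>p\<close> is injective on a sheet around the
  common value, and its complement is open because the total space is Hausdorff; connectedness does
  the rest.\<close>

lemma lift_unique:
  fixes p :: "'b::t2_space \<Rightarrow> 'a::topological_space" and f g :: "'c::topological_space \<Rightarrow> 'b"
  assumes cov: "covering_space UNIV p UNIV" and S: "connected S" "continuous_on S f" "continuous_on S g"
    and eq: "\<And>x. x \<in> S \<Longrightarrow> p (f x) = p (g x)" and a: "a \<in> S" "f a = g a" and x: "x \<in> S"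
  shows "f x = g x"
proof -
  let ?E = "{x \<in> S. f x = g x}"
  have 1: "\<exists>T. openin (top_of_set S) T \<and> x \<in> T \<and> T \<subseteq> ?E" if "x \<in> ?E" for x
  proof -
    obtain V U q where V: "open V" "f x \<in> V" "homeomorphism V U p q"
      using covering_slice[OF cov] by metis
    let ?T = "(S \<inter> f -` V) \<inter> (S \<inter> g -` V)"
    have "openin (top_of_set S) ?T"
      by (intro openin_Int continuous_openin_preimage_gen S V(1))
    moreover have "?T \<subseteq> ?E"
      using V(3) eq by (auto simp: homeomorphism_def) metis
    ultimately show ?thesis
      using that V(2) by (intro exI[of _ ?T]) simp
  qed
  have "openin (top_of_set S) ?E"
    by (subst openin_subopen) (intro ballI 1)
  moreover have 2: "\<exists>T. openin (top_of_set S) T \<and> x \<in> T \<and> T \<subseteq> S - ?E" if "x \<in> S - ?E" for x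
  proof -
    have "f x \<noteq> g x" using that by simp
    then obtain V W where V: "open V" "open W" "f x \<in> V" "g x \<in> W" "V \<inter> W = {}"
      using hausdorff[of "f x" "g x"] by metis
    let ?T = "(S \<inter> f -` V) \<inter> (S \<inter> g -` W)"
    have "openin (top_of_set S) ?T"
      by (intro openin_Int continuous_openin_preimage_gen S V(1,2))
    moreover have "?T \<subseteq> S - ?E"
      using V(5) by auto
    ultimately show ?thesis
      using that V(3,4) by (intro exI[of _ ?T]) simp
  qed
  have "openin (top_of_set S) (S - ?E)"
    by (subst openin_subopen) (intro ballI 2)
  ultimately have "?E = {} \<or> ?E = S"
    using S(1) unfolding connected_clopen by (auto simp: closedin_def)
  then show ?thesis
    using a x by blast
qed

text \<open>The second lift is started at a value of the first over the intersection. Connectedness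
  of the intersection makes the two lifts agree there, and closedness of the pieces makes the
  combined map continuous.\<close>

lemma liftable_Un:
  fixes p :: "'b::t2_space \<Rightarrow> 'a::topological_space" and h :: "'c::topological_space \<Rightarrow> 'a"
  assumes cov: "covering_space UNIV p UNIV" and R: "closed R1" "closed R2" "connected (R1 \<inter> R2)" "R1 \<inter> R2 \<noteq> {}"
    and lift: "liftable p R1 h" "liftable p R2 h"
  shows "liftable p (R1 \<union> R2) h"
proof -
  have *: "\<exists>l. continuous_on (S1 \<union> S2) l \<and> l z0 = y \<and> (\<forall>z\<in>S1 \<union> S2. p (l z) = h z)"
    if S: "closed S1" "closed S2" "connected (S1 \<inter> S2)" "S1 \<inter> S2 \<noteq> {}"
      and L: "liftable p S1 h" "liftable p S2 h" and z0: "z0 \<in> S1" "p y = h z0" for S1 S2 z0 y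
  proof -
    obtain l1 where l1: "continuous_on S1 l1" "l1 z0 = y" "\<And>z. z \<in> S1 \<Longrightarrow> p (l1 z) = h z"
      using L(1) z0 unfolding liftable_def by metis
    obtain w where w: "w \<in> S1" "w \<in> S2" using S by blast
    then obtain l2 where l2: "continuous_on S2 l2" "l2 w = l1 w" "\<And>z. z \<in> S2 \<Longrightarrow> p (l2 z) = h z"
      using L(2) l1(3) unfolding liftable_def by metis
    have agree: "l1 z = l2 z" if "z \<in> S1 \<inter> S2" for z
      by (rule lift_unique[OF cov S(3), of l1 l2 w])
        (use l1 l2 w that in \<open>auto intro: continuous_on_subset\<close>)
    have "continuous_on (S1 \<union> S2) (\<lambda>z. if z \<in> S1 then l1 z else l2 z)"
      using S l1(1) l2(1) agree by (intro continuous_on_cases) auto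
    then show ?thesis
      using z0 l1 l2 by (intro exI[of _ "\<lambda>z. if z \<in> S1 then l1 z else l2 z"]) auto
  qed
  show ?thesis
    unfolding liftable_def
  proof (intro ballI allI impI)
    fix z0 y assume z: "z0 \<in> R1 \<union> R2" "p y = h z0"
    then consider "z0 \<in> R1" | "z0 \<in> R2" by blast
    then show "\<exists>l. continuous_on (R1 \<union> R2) l \<and> l z0 = y \<and> (\<forall>z\<in>R1 \<union> R2. p (l z) = h z)"
    proof cases
      case 1
      then show ?thesis by (rule *[OF R lift _ z(2)])
    next
      case 2
      have "connected (R2 \<inter> R1)" "R2 \<inter> R1 \<noteq> {}" using R by (auto simp: Int_commute)
      from *[OF R(2,1) this lift(2,1) 2 z(2)] show ?thesis by (simp add: Un_commute)
    qed
  qed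
qed

text \<open>Over the preimage of an evenly covered set, \<open>h\<close> followed by the inverse of
  the sheet through \<open>y\<close> is a lift.\<close>

lemma liftable_local:
  fixes p :: "'b::topological_space \<Rightarrow> 'a::topological_space" and h :: "'c::topological_space \<Rightarrow> 'a"
  assumes cov: "covering_space UNIV p UNIV" and h: "continuous_on UNIV h"
  obtains N where "open N" "x \<in> N" "\<And>R. R \<subseteq> N \<Longrightarrow> liftable p R h"
proof -
  obtain T v where T': "h x \<in> T" "openin (top_of_set UNIV) T" "\<Union>v = UNIV \<inter> p -` T"
      "\<forall>u\<in>v. \<exists>q. homeomorphism u T p q"
    using cov UNIV_I[of "h x"] unfolding covering_space_def by blast
  have "open T"
    using T'(2) by (metis open_openin subtopology_UNIV)
  have v: "\<Union>v = p -` T"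
    using T'(3) by simp
  note T = T'(1) \<open>open T\<close> v bspec[OF T'(4)]
  have "liftable p R h" if R: "R \<subseteq> h -` T" for R
    unfolding liftable_def
  proof (intro ballI allI impI)
    fix z0 y assume z: "z0 \<in> R" "p y = h z0"
    then have "y \<in> \<Union>v" using T R by auto
    then obtain u q where u: "y \<in> u" "homeomorphism u T p q"
      using T(4) by blast
    have "continuous_on R (q \<circ> h)"
      using u(2) R h by (intro continuous_on_compose) (auto simp: homeomorphism_def intro: continuous_on_subset)
    moreover have "(q \<circ> h) z0 = y"
      using z u by (auto simp: homeomorphism_def)
    moreover have "p ((q \<circ> h) z) = h z" if "z \<in> R" for z
      using u(2) R that by (auto simp: homeomorphism_def)
    ultimately show "\<exists>l. continuous_on R l \<and> l z0 = y \<and> (\<forall>z\<in>R. p (l z) = h z)"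
      by blast
  qed
  moreover have "open (h -` T)"
    using h T(2) by (simp add: continuous_on_open_vimage)
  ultimately show thesis
    using that[of "h -` T"] T(1) by auto
qed

text \<open>Bisection in both directions, with \<open>liftable_Un\<close> joining neighbouring
  rectangles along a common edge, which is connected.\<close>

lemma liftable_rectangle:
  fixes p :: "'b::t2_space \<Rightarrow> 'a::topological_space" and h :: "real \<times> real \<Rightarrow> 'a"
  assumes cov: "covering_space UNIV p UNIV" and h: "continuous_on UNIV h" and "a \<le> b" "c \<le> d"
  shows "liftable p ({a..b} \<times> {c..d}) h"
proof -
  \<comment> \<open>Bisection of the vertical side alone: over a sufficiently narrow strip around
    \<open>s\<close> the whole height can be lifted. The width \<open>e\<close> shrinks whenever two
    pieces are joined.\<close>
  have small: "\<exists>e>0. \<forall>a b. a \<le> s \<and> s \<le> b \<and> b - a < e \<longrightarrow> liftable p ({a..b} \<times> {c..d}) h" for s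
    using \<open>c \<le> d\<close>
  proof (induction rule: Bolzano)
    case (trans c e d)
    then obtain e1 e2 where "0 < e1" "0 < e2"
      and e: "\<And>a b. a \<le> s \<and> s \<le> b \<and> b - a < e1 \<Longrightarrow> liftable p ({a..b} \<times> {c..e}) h"
        "\<And>a b. a \<le> s \<and> s \<le> b \<and> b - a < e2 \<Longrightarrow> liftable p ({a..b} \<times> {e..d}) h"
      by metis
    have "liftable p ({a..b} \<times> {c..d}) h" if ab: "a \<le> s" "s \<le> b" "b - a < min e1 e2" for a b
    proof -
      have split: "{a..b} \<times> {c..d} = {a..b} \<times> {c..e} \<union> {a..b} \<times> {e..d}"
        and int: "{a..b} \<times> {c..e} \<inter> {a..b} \<times> {e..d} = {a..b} \<times> {e}"
        using trans by auto
      show ?thesis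
        unfolding split
      proof (rule liftable_Un[OF cov])
        show "connected ({a..b} \<times> {c..e} \<inter> {a..b} \<times> {e..d})"
          unfolding int by (intro connected_Times) auto
        show "{a..b} \<times> {c..e} \<inter> {a..b} \<times> {e..d} \<noteq> {}"
          unfolding int using ab by auto
      qed (use e[of a b] ab in \<open>auto intro!: closed_Times\<close>)
    qed
    then show ?case
      using \<open>0 < e1\<close> \<open>0 < e2\<close> by (intro exI[of _ "min e1 e2"]) auto
  next
    case (local t)
    obtain N where N: "open N" "(s, t) \<in> N" "\<And>R. R \<subseteq> N \<Longrightarrow> liftable p R h"
      using liftable_local[OF cov h] by metis
    then obtain A B where AB: "open A" "open B" "s \<in> A" "t \<in> B" "A \<times> B \<subseteq> N"
      by (auto elim: open_prod_elim)
    obtain e1 e2 where "0 < e1" "ball s e1 \<subseteq> A" "0 < e2" "ball t e2 \<subseteq> B"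
      using AB open_contains_ball by metis
    then have "{a..b} \<times> {c..d} \<subseteq> N"
      if "a \<le> s" "s \<le> b" "b - a < e1" "c \<le> t" "t \<le> d" "d - c < e2" for a b c d
      using that AB(5) by (fastforce simp: dist_real_def subset_iff)
    then show ?case
      using N(3) \<open>0 < e1\<close> \<open>0 < e2\<close> by meson
  qed
  show ?thesis
    using \<open>a \<le> b\<close>
  proof (induction rule: Bolzano)
    case (trans a e b)
    have split: "{a..b} \<times> {c..d} = {a..e} \<times> {c..d} \<union> {e..b} \<times> {c..d}"
      and int: "({a..e} \<times> {c..d}) \<inter> ({e..b} \<times> {c..d}) = {e} \<times> {c..d}"
      using trans by auto
    show ?case
      unfolding split
    proof (rule liftable_Un[OF cov])
      show "connected (({a..e} \<times> {c..d}) \<inter> ({e..b} \<times> {c..d}))"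
        unfolding int by (intro connected_Times) auto
      show "({a..e} \<times> {c..d}) \<inter> ({e..b} \<times> {c..d}) \<noteq> {}"
        unfolding int using \<open>c \<le> d\<close> by auto
    qed (use trans in \<open>auto intro!: closed_Times\<close>)
  next
    case (local s)
    then show ?case using small by metis
  qed
qed

section \<open>Lifts of squares and paths, and monodromy\<close>

lemma lift_square:
  fixes p :: "'b::t2_space \<Rightarrow> 'a::topological_space" and h :: "real \<times> real \<Rightarrow> 'a"
  assumes cov: "covering_space UNIV p UNIV" and h: "continuous_on ({0..1} \<times> {0..1}) h" and y: "p y = h (0, 0)"
  obtains l where "continuous_on ({0..1} \<times> {0..1}) l" "l (0, 0) = y"
    "\<And>s t. s \<in> {0..1} \<Longrightarrow> t \<in> {0..1} \<Longrightarrow> p (l (s, t)) = h (s, t)"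
proof -
  \<comment> \<open>The retraction of the line onto the unit interval extends \<open>h\<close>
    continuously to the whole plane, where the local lifts are formed on open sets.\<close>
  define r :: "real \<Rightarrow> real" where "r = (\<lambda>s. max 0 (min 1 s))"
  define h' where "h' = h \<circ> (\<lambda>z. (r (fst z), r (snd z)))"
  have "continuous_on UNIV (\<lambda>z::real \<times> real. (r (fst z), r (snd z)))"
    unfolding r_def by (intro continuous_intros)
  then have "continuous_on UNIV h'"
    unfolding h'_def by (rule continuous_on_compose)
      (auto simp: r_def intro!: continuous_on_subset[OF h])
  from liftable_rectangle[OF cov this, of 0 1 0 1] have L: "liftable p ({0..1} \<times> {0..1}) h'" by simp
  have h': "h' (s, t) = h (s, t)" if "s \<in> {0..1}" "t \<in> {0..1}" for s t
    using that by (simp add: h'_def r_def)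
  from L obtain l where l: "continuous_on ({0..1} \<times> {0..1}) l" "l (0, 0) = y"
      "\<forall>z\<in>{0..1} \<times> {0..1}. p (l z) = h' z"
    unfolding liftable_def using y h'[of 0 0] by (metis SigmaI atLeastAtMost_iff order_refl zero_le_one)
  show thesis
    using that[OF l(1,2)] l(3) h' by auto
qed

lemma lift_path:
  fixes p :: "'b::t2_space \<Rightarrow> 'a::topological_space"
  assumes cov: "covering_space UNIV p UNIV" and c: "path c" and y: "p y = c 0"
  obtains l where "path l" "l 0 = y" "\<And>t. t \<in> {0..1} \<Longrightarrow> p (l t) = c t"
proof -
  \<comment> \<open>The path is treated as a homotopy that is constant in its first
    variable.\<close>
  have "continuous_on ({0..1} \<times> {0..1}) (c \<circ> (snd :: real \<times> real \<Rightarrow> real))"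
    using c unfolding path_def
    by (intro continuous_on_compose continuous_on_snd continuous_on_id) (simp add: snd_image_times)
  then show thesis
  proof (rule lift_square[OF cov, of _ y])
    show "p y = (c \<circ> snd) (0, 0)" by (simp add: y)
  next
    fix l :: "real \<times> real \<Rightarrow> 'b"
    assume l: "continuous_on ({0..1} \<times> {0..1}) l" "l (0, 0) = y"
      "\<And>s t. s \<in> {0..1} \<Longrightarrow> t \<in> {0..1} \<Longrightarrow> p (l (s, t)) = (c \<circ> snd) (s, t)"
    show thesis
    proof (rule that[of "\<lambda>t. l (0, t)"])
      show "path (\<lambda>t. l (0, t))"
        unfolding path_def by (rule continuous_on_compose2[OF l(1)]) (auto intro: continuous_intros)
    qed (use l in auto)
  qed
qed

lemma path_lift_unique:
  fixes p :: "'b::t2_space \<Rightarrow> 'a::topological_space"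
  assumes cov: "covering_space UNIV p UNIV" and "path l1" "path l2" "l1 0 = l2 0"
    and "\<And>t. t \<in> {0..1} \<Longrightarrow> p (l1 t) = p (l2 t)" and "t \<in> {0..1}"
  shows "l1 t = l2 t"
  by (rule lift_unique[OF cov, of "{0..1}" l1 l2 0]) (use assms in \<open>auto simp: path_def\<close>)

text \<open>The edges of the lifted square over constant edges are constant.\<close>

lemma monodromy:
  fixes p :: "'b::t2_space \<Rightarrow> 'a::topological_space"
  assumes cov: "covering_space UNIV p UNIV" and hom: "homotopic_paths UNIV c d"
    and l: "path l1" "path l2" "l1 0 = l2 0"
    and lc: "\<And>t. t \<in> {0..1} \<Longrightarrow> p (l1 t) = c t" and ld: "\<And>t. t \<in> {0..1} \<Longrightarrow> p (l2 t) = d t"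
  shows "l1 1 = l2 1"
proof -
  obtain h :: "real \<times> real \<Rightarrow> 'a" where h: "continuous_on ({0..1} \<times> {0..1}) h"
    and h0: "\<forall>t\<in>{0..1}. h (0, t) = c t" and h1: "\<forall>t\<in>{0..1}. h (1, t) = d t"
    and ends: "\<forall>s\<in>{0..1}. h (s, 0) = c 0 \<and> h (s, 1) = c 1"
    using hom unfolding homotopic_paths pathstart_def pathfinish_def comp_def by blast
  obtain H where H: "continuous_on ({0..1} \<times> {0..1}) H" "H (0, 0) = l1 0"
    "\<And>s t. s \<in> {0..1} \<Longrightarrow> t \<in> {0..1} \<Longrightarrow> p (H (s, t)) = h (s, t)"
    by (rule lift_square[OF cov h, of "l1 0"]) (use lc h0 in auto)
  have row: "path (\<lambda>t. H (s, t))" and col: "path (\<lambda>t. H (t, s))" if "s \<in> {0..1}" for s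
    unfolding path_def using that by (auto intro!: continuous_on_compose2[OF H(1)] continuous_intros)
  have const: "path (\<lambda>t::real. x)" for x :: 'b
    by (simp add: path_def)
  have "H (0, 1) = l1 1"
    by (rule path_lift_unique[OF cov row[of 0] l(1)]) (use H h0 lc in auto)
  moreover have "H (1, 0) = l1 0"
    by (rule path_lift_unique[OF cov col[of 0] const]) (use H ends lc in auto)
  then have "H (1, 1) = l2 1"
    by - (rule path_lift_unique[OF cov row[of 1] l(2)], use H h1 ld l(3) in auto)
  moreover have "H (1, 1) = H (0, 1)"
    by (rule path_lift_unique[OF cov col[of 1] const]) (use H ends in auto)
  ultimately show ?thesis by simp
qed

section \<open>Deck transformations of a simply connected covering\<close>

locale simply_connected_covering =
  fixes p :: "'b::t2_space \<Rightarrow> 'a::topological_space"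
  assumes covering: "covering_space UNIV p UNIV"
    and simply_connected: "simply_connected (UNIV :: 'b set)"
    and locally_path_connected: "\<And>(x::'a) U. open U \<Longrightarrow> x \<in> U \<Longrightarrow> \<exists>N. open N \<and> x \<in> N \<and> N \<subseteq> U \<and> path_connected N"
begin

text \<open>\<open>simply_connected\<close> makes any two loops freely homotopic, in particular the
  constant loops at \<open>a\<close> and \<open>b\<close>; a point of the loop followed through the
  homotopy runs from \<open>a\<close> to \<open>b\<close>.\<close>

lemma connecting_path: obtains \<gamma> where "path \<gamma>" "\<gamma> 0 = (a::'b)" "\<gamma> 1 = b"
proof -
  have "homotopic_loops UNIV (\<lambda>_. a) (\<lambda>_. b)"
    using simply_connected unfolding simply_connected_def
    by (auto simp: path_def pathstart_def pathfinish_def)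
  then obtain h :: "real \<times> real \<Rightarrow> 'b" where h: "continuous_on ({0..1} \<times> {0..1}) h"
    and h01: "\<forall>t\<in>{0..1}. h (0, t) = a" "\<forall>t\<in>{0..1}. h (1, t) = b"
    unfolding homotopic_loops by auto
  show thesis
  proof (rule that[of "\<lambda>s. h (s, 0)"])
    show "path (\<lambda>s. h (s, 0))"
      unfolding path_def by (rule continuous_on_compose2[OF h]) (auto intro: continuous_intros)
  qed (use h01 in auto)
qed

lemma connected_UNIV: "connected (UNIV :: 'b set)"
proof (rule path_connected_imp_connected)
  show "path_connected (UNIV :: 'b set)"
    unfolding path_connected_def pathstart_def pathfinish_def using connecting_path by (metis subset_UNIV)
qed

text \<open>Here \<open>l\<close> is another lift of the projection of \<gamma>, starting elsewhere.
  The contraction of \<gamma> is a free homotopy, so the two side edges of the lifted square need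
  not be constant; they lift the same path and agree at the constant end, hence also at the end
  carrying \<open>l\<close>.\<close>

lemma lift_loop:
  assumes \<gamma>: "path \<gamma>" "\<gamma> 0 = \<gamma> 1" and l: "path l" "\<And>t. t \<in> {0..1} \<Longrightarrow> p (l t) = p (\<gamma> t)"
  shows "l 1 = l 0"
proof -
  have "homotopic_loops UNIV \<gamma> (\<lambda>_. \<gamma> 0)"
    using simply_connected \<gamma> unfolding simply_connected_def
    by (auto simp: path_def pathstart_def pathfinish_def)
  then obtain h :: "real \<times> real \<Rightarrow> 'b" where h: "continuous_on ({0..1} \<times> {0..1}) h"
    and h0: "\<forall>t\<in>{0..1}. h (0, t) = \<gamma> t" and h1: "\<forall>t\<in>{0..1}. h (1, t) = \<gamma> 0"
    and ends: "\<forall>s\<in>{0..1}. h (s, 1) = h (s, 0)"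
    unfolding homotopic_loops pathstart_def pathfinish_def comp_def by blast
  have "continuous_on ({0..1} \<times> {0..1}) (p \<circ> h)"
    by (intro continuous_on_compose h continuous_on_subset[OF covering_space_imp_continuous[OF covering]] subset_UNIV)
  then obtain H where H: "continuous_on ({0..1} \<times> {0..1}) H" "H (0, 0) = l 0"
    "\<And>s t. s \<in> {0..1} \<Longrightarrow> t \<in> {0..1} \<Longrightarrow> p (H (s, t)) = p (h (s, t))"
    by (rule lift_square[OF covering, of _ "l 0"]) (use l h0 in auto)
  have row: "path (\<lambda>t. H (s, t))" and col: "path (\<lambda>t. H (t, s))" if "s \<in> {0..1}" for s
    unfolding path_def using that by (auto intro!: continuous_on_compose2[OF H(1)] continuous_intros)
  have const: "path (\<lambda>t::real. x)" for x :: 'b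
    by (simp add: path_def)
  have "H (0, 1) = l 1"
    by (rule path_lift_unique[OF covering row[of 0] l(1)]) (use H h0 l in auto)
  moreover have "H (1, 1) = H (1, 0)"
    by (rule path_lift_unique[OF covering row[of 1] const]) (use H h1 in auto)
  \<comment> \<open>Both edges are run backwards because \<open>path_lift_unique\<close> compares
    lifts from parameter 0, while the agreement is known at parameter 1 of the homotopy.\<close>
  moreover have "H (1 - 1, 1) = H (1 - 1, 0)" if "H (1, 1) = H (1, 0)"
  proof (rule path_lift_unique[OF covering, of "\<lambda>s. H (1 - s, 1)" "\<lambda>s. H (1 - s, 0)"])
    show "path (\<lambda>s. H (1 - s, 1))" "path (\<lambda>s. H (1 - s, 0))"
      unfolding path_def by (auto intro!: continuous_on_compose2[OF H(1)] continuous_intros)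
  qed (use H ends that in auto)
  ultimately show ?thesis using H by simp
qed

text \<open>\<gamma> followed by the reverse of \<delta> is a loop, so by \<open>lift_loop\<close>
  the lift of its projection starting at \<open>k 0\<close> closes up. Its first half is
  \<open>k\<close> and its second half is \<open>l\<close> reversed.\<close>

lemma lift_same_end:
  assumes \<gamma>: "path \<gamma>" "path \<delta>" "\<gamma> 0 = \<delta> 0" "\<gamma> 1 = \<delta> 1" and l: "path k" "path l" "k 0 = l 0"
    and k: "\<And>t. t \<in> {0..1} \<Longrightarrow> p (k t) = p (\<gamma> t)" and l': "\<And>t. t \<in> {0..1} \<Longrightarrow> p (l t) = p (\<delta> t)"
  shows "k 1 = l 1"
proof -
  let ?\<gamma> = "\<gamma> +++ reversepath \<delta>"
  have path: "path ?\<gamma>"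
  proof (rule path_join_imp[OF \<gamma>(1)])
    show "path (reversepath \<delta>)" using \<gamma>(2) by simp
    show "pathfinish \<gamma> = pathstart (reversepath \<delta>)"
      using \<gamma>(4) by (simp add: pathfinish_def)
  qed
  then have "path (p \<circ> ?\<gamma>)"
    using covering_space_imp_continuous[OF covering] path_continuous_image continuous_on_subset by blast
  then obtain j where j: "path j" "j 0 = k 0" "\<And>t. t \<in> {0..1} \<Longrightarrow> p (j t) = p (?\<gamma> t)"
    by (rule lift_path[OF covering, of _ "k 0"]) (use k in \<open>auto simp: joinpaths_def\<close>)
  have "j 1 = j 0"
    using \<gamma> by (intro lift_loop[OF path _ j(1,3)]) (auto simp: joinpaths_def reversepath_def)
  have jp: "path (\<lambda>t. j (t / 2))" "path (\<lambda>t. j (1 - t / 2))"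
    using j(1) unfolding path_def by (auto intro!: continuous_on_compose2[of "{0..1}" j] continuous_intros)
  have "j (1 / 2) = k 1"
    by (rule path_lift_unique[OF covering jp(1) l(1)])
      (use j k in \<open>auto simp: joinpaths_def\<close>)
  moreover have "j (1 - 1 / 2) = l 1"
  proof (rule path_lift_unique[OF covering jp(2) l(2)])
    fix t :: real assume "t \<in> {0..1}"
    then show "p (j (1 - t / 2)) = p (l t)"
      using j(3)[of "1 - t / 2"] l'[of t] \<gamma>(4) by (cases "t = 1") (auto simp: joinpaths_def reversepath_def)
  qed (use \<open>j 1 = j 0\<close> j l in auto)
  ultimately show ?thesis by simp
qed

text \<open>\<open>T x\<close> is the end of the lift, starting at \<open>m'\<close>, of the
  projection of a path from \<open>m\<close> to \<open>x\<close>. It does not depend on the path by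
  \<open>lift_same_end\<close>, and local path connectedness of the base makes it
  continuous.\<close>

lemma deck_map:
  assumes "p m = p m'"
  obtains T where "continuous_on UNIV T" "p \<circ> T = p" "T m = m'"
proof -
  define R where "R x e \<longleftrightarrow> (\<exists>\<gamma> l. path \<gamma> \<and> path l \<and> \<gamma> 0 = m \<and> \<gamma> 1 = x \<and> l 0 = m' \<and> l 1 = e \<and>
      (\<forall>t\<in>{0..1}. p (l t) = p (\<gamma> t)))" for x e
  have ex: "\<exists>e. R x e" for x
  proof -
    obtain \<gamma> where \<gamma>: "path \<gamma>" "\<gamma> 0 = m" "\<gamma> 1 = x" using connecting_path by metis
    then have "path (p \<circ> \<gamma>)"
      using covering_space_imp_continuous[OF covering] path_continuous_image continuous_on_subset by blast
    then obtain l where "path l" "l 0 = m'" "\<And>t. t \<in> {0..1} \<Longrightarrow> p (l t) = p (\<gamma> t)"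
      by (rule lift_path[OF covering, of _ m']) (use \<gamma> assms in auto)
    then show ?thesis using \<gamma> unfolding R_def by blast
  qed
  have uniq: "e = e'" if "R x e" "R x e'" for x e e'
    using that lift_same_end unfolding R_def by metis
  define T where "T x = (SOME e. R x e)" for x
  have RT: "R x (T x)" for x
    unfolding T_def using ex by (rule someI_ex)
  have TI: "T x = e" if "R x e" for x e
    using RT that uniq by blast
  have pT: "p (T x) = p x" for x
    using RT[of x] unfolding R_def by (metis atLeastAtMost_iff order_refl zero_le_one)
  have "T m = m'"
  proof (rule TI)
    show "R m m'"
      unfolding R_def using assms by (intro exI[of _ "\<lambda>_. m"] exI[of _ "\<lambda>_. m'"]) (auto simp: path_def)
  qed
  have local: "\<exists>W. open W \<and> x \<in> W \<and> continuous_on W T" for x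
  proof -
    obtain V U q where V: "open V" "x \<in> V" "open U" "homeomorphism V U p q"
      using covering_slice[OF covering] by metis
    obtain V' U' q' where V': "open V'" "T x \<in> V'" "open U'" "homeomorphism V' U' p q'"
      using covering_slice[OF covering] by metis
    have "p x \<in> U \<inter> U'"
      using V V' pT[of x] by (metis IntI homeomorphism_def imageI)
    then obtain N where N: "open N" "p x \<in> N" "N \<subseteq> U \<inter> U'" "path_connected N"
      using locally_path_connected[of "U \<inter> U'" "p x"] V V' by auto
    \<comment> \<open>The path to \<open>x\<close> is prolonged by the lift of \<delta> through
      \<open>x\<close>, its partner by the lift of \<delta> through \<open>T x\<close>. The latter
      ends at \<open>q' (p x')\<close>, so \<open>T\<close> is locally
      \<open>q' \<circ> p\<close>.\<close>
    have "T x' = q' (p x')" if x': "x' \<in> V \<inter> p -` N" for x'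
    proof (rule TI)
      obtain \<delta> where \<delta>: "path \<delta>" "\<And>t. t \<in> {0..1} \<Longrightarrow> \<delta> t \<in> N" "\<delta> 0 = p x" "\<delta> 1 = p x'"
        using N(2,4) x' unfolding path_connected_def path_image_def pathstart_def pathfinish_def
        by (metis (no_types, lifting) IntD2 image_subset_iff vimageD)
      obtain \<gamma> l where \<gamma>: "path \<gamma>" "path l" "\<gamma> 0 = m" "\<gamma> 1 = x" "l 0 = m'" "l 1 = T x"
          "\<And>t. t \<in> {0..1} \<Longrightarrow> p (l t) = p (\<gamma> t)"
        using RT[of x] unfolding R_def by blast
      have cont: "path (q \<circ> \<delta>)" "path (q' \<circ> \<delta>)"
        using \<delta>(1,2) N(3) unfolding path_def
        by (intro continuous_on_compose continuous_on_subset[OF homeomorphism_cont2[OF V(4)]]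
            continuous_on_subset[OF homeomorphism_cont2[OF V'(4)]]; blast)+
      have ends: "q (\<delta> 0) = x" "q' (\<delta> 0) = T x" "q (\<delta> 1) = x'"
        using \<delta> V V' x' pT[of x] by (auto simp: homeomorphism_def)
      have qq: "p (q (\<delta> t)) = \<delta> t" "p (q' (\<delta> t)) = \<delta> t" if "t \<in> {0..1}" for t
        using \<delta>(2)[OF that] V(4) V'(4) N(3) by (auto simp: homeomorphism_def)
      have "path (\<gamma> +++ (q \<circ> \<delta>))" "path (l +++ (q' \<circ> \<delta>))"
        using \<gamma> cont ends by (auto intro!: path_join_imp simp: pathstart_def pathfinish_def)
      moreover have "p ((l +++ (q' \<circ> \<delta>)) t) = p ((\<gamma> +++ (q \<circ> \<delta>)) t)" if "t \<in> {0..1}" for t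
        using that \<gamma>(7) qq by (auto simp: joinpaths_def)
      ultimately show "R x' (q' (p x'))"
        unfolding R_def using \<gamma> \<delta> ends
        by (intro exI[of _ "\<gamma> +++ (q \<circ> \<delta>)"] exI[of _ "l +++ (q' \<circ> \<delta>)"]) (auto simp: joinpaths_def)
    qed
    moreover have "continuous_on (V \<inter> p -` N) (q' \<circ> p)"
      using V'(4) N(3) covering_space_imp_continuous[OF covering]
      by (intro continuous_on_compose) (auto simp: homeomorphism_def intro: continuous_on_subset)
    ultimately have "continuous_on (V \<inter> p -` N) T"
      using continuous_on_cong[of "V \<inter> p -` N" "V \<inter> p -` N" T "q' \<circ> p"] by simp
    moreover have "open (V \<inter> p -` N)"
      using V(1) N(1) covering_space_imp_continuous[OF covering] continuous_on_open_vimage[of UNIV p] by auto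
    ultimately show ?thesis
      using V(2) N(2) by blast
  qed
  have "continuous_on UNIV T"
    by (rule continuous_at_imp_continuous_on) (metis local continuous_on_eq_continuous_at)
  moreover have "p \<circ> T = p"
    using pT by (simp add: fun_eq_iff)
  ultimately show thesis
    using that \<open>T m = m'\<close> by blast
qed

lemma deck_unique:
  assumes "continuous_on UNIV S" "continuous_on UNIV T" "p \<circ> S = p" "p \<circ> T = p" "S m = T m"
  shows "S = T"
proof
  fix x show "S x = T x"
    by (rule lift_unique[OF covering connected_UNIV assms(1,2), of m]) (use assms in \<open>auto simp: fun_eq_iff\<close>)
qed

text \<open>Deck maps taking \<open>m\<close> to \<open>m'\<close> and back compose to maps with a
  fixed point over the identity of the base, hence to the identity. This is what gives the
  description in \<open>deck_action\<close> a meaning.\<close>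

lemma deck_transformation:
  assumes "p m = p m'"
  shows "\<exists>!T. (\<exists>T'. homeomorphism UNIV UNIV T T') \<and> p \<circ> T = p \<and> T m = m'"
proof -
  obtain T where T: "continuous_on UNIV T" "p \<circ> T = p" "T m = m'" using deck_map[OF assms] .
  obtain T' where T': "continuous_on UNIV T'" "p \<circ> T' = p" "T' m' = m" using deck_map[OF assms[symmetric]] .
  have "continuous_on UNIV (T' \<circ> T)" "continuous_on UNIV (T \<circ> T')"
    by (intro continuous_on_compose T T' continuous_on_subset[OF T(1)] continuous_on_subset[OF T'(1)] subset_UNIV)+
  then have "T' \<circ> T = id"
    by (intro deck_unique[of _ _ m]) (use T T' in \<open>auto simp: comp_assoc[symmetric]\<close>)
  moreover have "T \<circ> T' = id"
    using \<open>continuous_on UNIV (T \<circ> T')\<close>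
    by (intro deck_unique[of _ _ m']) (use T T' in \<open>auto simp: comp_assoc[symmetric]\<close>)
  ultimately have "T' (T x) = x" "T (T' x) = x" for x
    by (metis comp_apply id_apply)+
  then have hom: "homeomorphism UNIV UNIV T T'"
    using T(1) T'(1) by (intro homeomorphismI) auto
  show ?thesis
  proof (rule ex1I[of _ T])
    show "(\<exists>T'. homeomorphism UNIV UNIV T T') \<and> p \<circ> T = p \<and> T m = m'"
      using hom T by blast
  next
    fix S assume S: "(\<exists>T'. homeomorphism UNIV UNIV S T') \<and> p \<circ> S = p \<and> S m = m'"
    then have "continuous_on UNIV S"
      by (auto simp: homeomorphism_def)
    then show "S = T"
      using deck_unique[of S T m] S T by metis
  qed
qed

text \<open>\<open>lift_end\<close> chooses a representative and a lift at the same time; by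
  \<open>monodromy\<close> every such choice has the same endpoint.\<close>

lemma lift_end:
  assumes \<gamma>: "path \<gamma>" "\<gamma> 0 = m\<^sub>0" "p (\<gamma> 1) = p m\<^sub>0"
  shows "lift_end p m\<^sub>0 (loop_class (p m\<^sub>0) (p \<circ> \<gamma>)) = \<gamma> 1"
    and "loop_class (p m\<^sub>0) (p \<circ> \<gamma>) \<in> carrier (fundamental_group (p m\<^sub>0))"
proof -
  have "path (p \<circ> \<gamma>)"
    using \<gamma> covering_space_imp_continuous[OF covering] path_continuous_image continuous_on_subset by blast
  then have loop: "p \<circ> \<gamma> \<in> loops_at (p m\<^sub>0)"
    using \<gamma> by (simp add: loops_at_def pathstart_def pathfinish_def)
  then show "loop_class (p m\<^sub>0) (p \<circ> \<gamma>) \<in> carrier (fundamental_group (p m\<^sub>0))"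
    by (simp add: fundamental_group_def)
  let ?P = "\<lambda>y. \<exists>c\<in>loop_class (p m\<^sub>0) (p \<circ> \<gamma>). \<exists>l. path l \<and> pathstart l = m\<^sub>0 \<and> pathfinish l = y \<and>
     (\<forall>t\<in>{0..1}. p (l t) = c t)"
  have "p \<circ> \<gamma> \<in> loop_class (p m\<^sub>0) (p \<circ> \<gamma>)"
    using loop \<open>path (p \<circ> \<gamma>)\<close> by (simp add: loop_class_def)
  then have "?P (\<gamma> 1)"
    using \<gamma> unfolding pathstart_def pathfinish_def by (intro bexI[of _ "p \<circ> \<gamma>"] exI[of _ \<gamma>]) auto
  moreover have "y = \<gamma> 1" if y: "?P y" for y
  proof -
    obtain c l where cl: "homotopic_paths UNIV (p \<circ> \<gamma>) c" "path l" "l 0 = m\<^sub>0" "l 1 = y"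
        "\<And>t. t \<in> {0..1} \<Longrightarrow> p (l t) = c t"
      using y unfolding loop_class_def pathstart_def pathfinish_def by blast
    show ?thesis
      using monodromy[OF covering cl(1) \<gamma>(1) cl(2)] cl \<gamma> by auto
  qed
  ultimately show "lift_end p m\<^sub>0 (loop_class (p m\<^sub>0) (p \<circ> \<gamma>)) = \<gamma> 1"
    unfolding lift_end_def by (rule some_equality)
qed

lemma deck_action:
  assumes "C \<in> carrier (fundamental_group (p m\<^sub>0))"
  shows "p (deck_action p m\<^sub>0 C m) = p m"
proof -
  obtain c where c: "c \<in> loops_at (p m\<^sub>0)" "C = loop_class (p m\<^sub>0) c"
    using assms by (auto simp: fundamental_group_def)
  then have pc: "path c" "c 0 = p m\<^sub>0" "c 1 = p m\<^sub>0"
    by (auto simp: loops_at_def pathstart_def pathfinish_def)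
  obtain l where l: "path l" "l 0 = m\<^sub>0" "\<And>t. t \<in> {0..1} \<Longrightarrow> p (l t) = c t"
    using lift_path[OF covering pc(1), of m\<^sub>0] pc by metis
  have "homotopic_paths UNIV c (p \<circ> l)"
    using l pc by (intro homotopic_paths_eq) auto
  then have "loop_class (p m\<^sub>0) c = loop_class (p m\<^sub>0) (p \<circ> l)"
    using homotopic_paths_trans homotopic_paths_sym by (auto simp: loop_class_def) blast+
  moreover have end': "p (l 1) = p m\<^sub>0"
    using l(3)[of 1] pc by simp
  ultimately have "lift_end p m\<^sub>0 C = l 1"
    using lift_end(1)[OF l(1,2)] c by simp
  then have "p \<circ> deck_action p m\<^sub>0 C = p"
    unfolding deck_action_def using theI'[OF deck_transformation[OF end'[symmetric]]] by simp
  then show ?thesis by (metis comp_apply)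
qed

text \<open>The deck transformation \<open>T\<close> taking \<open>m\<close> to \<open>m'\<close> is
  the action of the loop obtained by projecting a path from \<open>m\<^sub>0\<close> to
  \<open>T m\<^sub>0\<close>. So the fibres of \<open>p\<close> are single orbits.\<close>

lemma deck_action_transitive:
  assumes "p m = p m'"
  obtains C where "C \<in> carrier (fundamental_group (p m\<^sub>0))" "deck_action p m\<^sub>0 C m = m'"
proof -
  obtain T T' where T: "homeomorphism UNIV UNIV T T'" "p \<circ> T = p" "T m = m'"
    using deck_transformation[OF assms] by blast
  obtain \<gamma> where \<gamma>: "path \<gamma>" "\<gamma> 0 = m\<^sub>0" "\<gamma> 1 = T m\<^sub>0"
    using connecting_path by metis
  have pT: "p (T m\<^sub>0) = p m\<^sub>0"
    using T(2) by (metis comp_apply)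
  let ?C = "loop_class (p m\<^sub>0) (p \<circ> \<gamma>)"
  have "deck_action p m\<^sub>0 ?C = T"
    unfolding deck_action_def
    using lift_end(1)[OF \<gamma>(1,2)] \<gamma>(3) pT T by (intro the1_equality[OF deck_transformation]) auto
  then show thesis
    using that[of ?C] lift_end(2)[OF \<gamma>(1,2)] \<gamma>(3) pT T(3) by auto
qed

end

section \<open>The divergence theorem on a closed manifold\<close>

lemma integral_support:
  fixes f :: "'a::euclidean_space \<Rightarrow> real"
  assumes "S \<subseteq> T" "\<And>x. x \<in> T \<Longrightarrow> x \<notin> S \<Longrightarrow> f x = 0"
  shows "integral T f = integral S f"
proof -
  have "(\<lambda>x. if x \<in> T then f x else 0) = (\<lambda>x. if x \<in> S then f x else 0)"
    using assms by (intro ext) auto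
  then show ?thesis
    using integral_restrict_UNIV[of T f] integral_restrict_UNIV[of S f] by simp
qed

lemma continuous_on_extend_zero:
  fixes f :: "'a::t2_space \<Rightarrow> 'b::real_normed_vector"
  assumes "open U" "continuous_on U f" "compact K" "K \<subseteq> U" "\<And>x. x \<in> U \<Longrightarrow> x \<notin> K \<Longrightarrow> f x = 0"
  shows "continuous_on UNIV (\<lambda>x. if x \<in> U then f x else 0)"
proof -
  let ?g = "\<lambda>x. if x \<in> U then f x else 0"
  have "continuous_on (U \<union> - K) ?g"
  proof (rule continuous_on_open_Un[OF assms(1)])
    show "open (- K)"
      using assms(3) by (simp add: compact_imp_closed open_Compl)
    show "continuous_on U ?g"
      using assms(2) by (simp cong: continuous_on_cong)
    have "continuous_on (- K) ?g \<longleftrightarrow> continuous_on (- K) (\<lambda>_. 0::'b)"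
      using assms(5) by (intro continuous_on_cong) auto
    then show "continuous_on (- K) ?g" by simp
  qed
  moreover have "U \<union> - K = UNIV" using assms(4) by blast
  ultimately show ?thesis by simp
qed

lemma absolutely_integrable_compact_support:
  fixes f :: "'a::euclidean_space \<Rightarrow> real"
  assumes "open U" "continuous_on U f" "compact K" "K \<subseteq> U" "\<And>x. x \<in> U \<Longrightarrow> x \<notin> K \<Longrightarrow> f x = 0"
  shows "f absolutely_integrable_on U"
proof -
  let ?g = "\<lambda>x. if x \<in> U then f x else 0"
  obtain a b where ab: "K \<subseteq> cbox a b"
    using bounded_subset_cbox_symmetric[OF compact_imp_bounded[OF assms(3)]] by blast
  have "?g absolutely_integrable_on cbox a b"
    using continuous_on_extend_zero[OF assms] continuous_on_subset
    by (intro absolutely_integrable_continuous) blast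
  moreover have "(\<lambda>x. if x \<in> cbox a b then ?g x else 0) = ?g"
    using assms(5) ab by fastforce
  ultimately have "?g absolutely_integrable_on UNIV"
    using absolutely_integrable_restrict_UNIV[of "cbox a b" ?g] by simp
  then show ?thesis
    by (simp only: absolutely_integrable_restrict_UNIV)
qed

text \<open>By translation invariance, \<open>t \<mapsto> \<integral> w (x + t e) dx\<close> is constant.\<close>

lemma integral_directional_derivative:
  fixes w :: "'a::euclidean_space \<Rightarrow> real"
  assumes diff: "\<And>x. w differentiable (at x)" and cont: "continuous_on UNIV (\<lambda>x. FD w x e)"
    and K: "compact K" "\<And>x. x \<notin> K \<Longrightarrow> w x = 0"
  shows "integral UNIV (\<lambda>x. FD w x e) = 0"
proof -
  obtain a b where ab: "K \<subseteq> cbox a b"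
    using bounded_subset_cbox_symmetric[OF compact_imp_bounded[OF K(1)]] by blast
  \<comment> \<open>\<open>?L\<close> collects the translates of \<open>K\<close> by
    \<open>- t *\<^sub>R e\<close> for \<open>t\<close> between -1 and 1. A box around it contains
    the supports of all translated functions, so the derivative in \<open>t\<close> is taken under
    an integral over one fixed box.\<close>
  let ?L = "(\<lambda>z. fst z - snd z *\<^sub>R e) ` (K \<times> {-1..1::real})"
  have "compact ?L"
    using K(1) by (intro compact_continuous_image compact_Times continuous_intros) auto
  then obtain a' b' where ab': "?L \<subseteq> cbox a' b'"
    using bounded_subset_cbox_symmetric[OF compact_imp_bounded] by blast
  have zero: "w (x + t *\<^sub>R e) = 0" if "x \<notin> cbox a' b'" "t \<in> {-1..1}" for x t
  proof (rule K(2), rule)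
    assume "x + t *\<^sub>R e \<in> K"
    then have "x \<in> ?L"
      using that(2) by (intro image_eqI[of _ _ "(x + t *\<^sub>R e, t)"]) auto
    then show False using that(1) ab' by blast
  qed
  have contw: "continuous_on UNIV w"
    using diff by (intro continuous_at_imp_continuous_on) (simp add: differentiable_imp_continuous_within)
  define I where "I t = integral (cbox a' b') (\<lambda>x. w (x + t *\<^sub>R e))" for t
  have const: "I t = integral (cbox a b) w" if "t \<in> {-1..1}" for t
  proof -
    have "(w has_integral integral (cbox a b) w) (cbox a b)"
      using contw by (intro integrable_integral integrable_continuous) (auto intro: continuous_on_subset)
    from has_integral_affinity'[OF this, of 1 "t *\<^sub>R e"]
    have "integral (cbox (a - t *\<^sub>R e) (b - t *\<^sub>R e)) (\<lambda>x. w (x + t *\<^sub>R e)) = integral (cbox a b) w"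
      by (simp add: integral_unique)
    moreover have "w (x + t *\<^sub>R e) = 0" if "x \<notin> cbox (a - t *\<^sub>R e) (b - t *\<^sub>R e)" for x
    proof (rule K(2), rule)
      assume "x + t *\<^sub>R e \<in> K"
      then have "x + t *\<^sub>R e \<in> cbox a b" using ab by blast
      then have "x \<in> cbox (a - t *\<^sub>R e) (b - t *\<^sub>R e)"
        by (simp add: mem_box inner_diff_left inner_add_left algebra_simps)
      with that show False by blast
    qed
    then have "integral UNIV (\<lambda>x. w (x + t *\<^sub>R e)) = integral (cbox (a - t *\<^sub>R e) (b - t *\<^sub>R e)) (\<lambda>x. w (x + t *\<^sub>R e))"
      by (intro integral_support) auto
    moreover have "integral UNIV (\<lambda>x. w (x + t *\<^sub>R e)) = I t"
      unfolding I_def using zero[OF _ that] by (intro integral_support) auto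
    ultimately show ?thesis by simp
  qed
  have "(I has_vector_derivative integral (cbox a' b') (\<lambda>x. FD w (x + 0 *\<^sub>R e) e)) (at 0 within {-1..1})"
    unfolding I_def
  proof (rule leibniz_rule_vector_derivative)
    fix t x assume "t \<in> {-1..1::real}"
    have "((\<lambda>t. w (x + t *\<^sub>R e)) has_derivative (\<lambda>r. FD w (x + t *\<^sub>R e) (r *\<^sub>R e))) (at t within {-1..1})"
      by (intro has_derivative_compose[of "\<lambda>t. x + t *\<^sub>R e" "\<lambda>r. r *\<^sub>R e" t "{-1..1}" w])
        (auto intro!: derivative_eq_intros FD_has_derivative diff)
    then show "((\<lambda>t. w (x + t *\<^sub>R e)) has_vector_derivative FD w (x + t *\<^sub>R e) e) (at t within {-1..1})"
      using FD_linear[OF diff] by (simp add: has_vector_derivative_def linear_cmul)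
  next
    show "(\<lambda>x. w (x + t *\<^sub>R e)) integrable_on cbox a' b'" for t
      by (intro integrable_continuous continuous_on_compose2[OF contw] continuous_intros) auto
    show "continuous_on ({-1..1} \<times> cbox a' b') (\<lambda>(t, x). FD w (x + t *\<^sub>R e) e)"
      unfolding split_beta
      by (rule continuous_on_compose2[OF cont]) (auto intro!: continuous_intros)
  qed auto
  moreover have "(I has_vector_derivative 0) (at 0 within {-1..1})"
    by (rule has_vector_derivative_transform[OF _ _ has_vector_derivative_const[of "integral (cbox a b) w"]])
      (simp_all add: const)
  ultimately have "integral (cbox a' b') (\<lambda>x. FD w (x + 0 *\<^sub>R e) e) = 0"
    by (intro vector_derivative_unique_within[of 0 "{-1..1}" I]) (auto simp: trivial_limit_within islimpt_Icc)
  moreover have "integral UNIV (\<lambda>x. FD w x e) = integral (cbox a' b') (\<lambda>x. FD w x e)"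
  proof (rule integral_support)
    fix x assume "x \<notin> cbox a' b'"
    have "FD w x = FD (\<lambda>_. 0) x"
    proof (rule FD_cong[of "- cbox a' b'"])
      show "w y = 0" if "y \<in> - cbox a' b'" for y
        using zero[of y 0] that by simp
    qed (use \<open>x \<notin> cbox a' b'\<close> in auto)
    then show "FD w x e = 0"
      using FD_eqI[OF has_derivative_const[of "0::real" "at x"]] by simp
  qed auto
  ultimately show ?thesis by simp
qed

lemma FD_axis_expand:
  fixes f :: "real^'n \<Rightarrow> 'b::real_normed_vector"
  assumes "f differentiable (at x)"
  shows "FD f x v = (\<Sum>k\<in>UNIV. v $ k *\<^sub>R FD f x (axis k 1))"
proof -
  have "FD f x v = FD f x (\<Sum>k\<in>UNIV. v $ k *\<^sub>R axis k 1)"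
    by (simp add: basis_expansion flip: scalar_mult_eq_scaleR)
  then show ?thesis
    using FD_linear[OF assms] by (simp add: linear_sum linear_cmul)
qed

text \<open>Since \<open>V\<close> has divergence 0, the integrand is the divergence of
  \<open>g V\<close>. Each component of \<open>g V\<close>, extended by 0, has compact support and
  is integrated by \<open>integral_directional_derivative\<close> in its own direction.\<close>

lemma integral_divergence_zero:
  fixes V :: "real^'n \<Rightarrow> real^'n" and g :: "real^'n \<Rightarrow> real"
  assumes U: "open U" and V: "Ck_on 1 U V" and div: "\<And>u. u \<in> U \<Longrightarrow> (\<Sum>i\<in>UNIV. FD V u (axis i 1) $ i) = 0"
    and g: "Ck_on 1 U g" and K: "compact K" "K \<subseteq> U" "\<And>u. u \<in> U \<Longrightarrow> u \<notin> K \<Longrightarrow> g u = 0"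
  shows "integral U (\<lambda>u. FD g u (V u)) = 0"
proof -
  define w where "w i u = (if u \<in> U then g u * V u $ i else 0)" for i u
  have dg: "g differentiable (at u)" and dV: "V differentiable (at u)" if "u \<in> U" for u
    using V g that by auto
  have D: "(w i has_derivative (\<lambda>v. g u * FD V u v $ i + FD g u v * V u $ i)) (at u)" if "u \<in> U" for i u
  proof -
    have "((\<lambda>u. g u * V u $ i) has_derivative (\<lambda>v. g u * FD V u v $ i + FD g u v * V u $ i)) (at u)"
      using FD_has_derivative[OF dg[OF that]] FD_has_derivative[OF dV[OF that]]
      by (intro has_derivative_mult bounded_linear.has_derivative[OF bounded_linear_vec_nth])
    then show ?thesis
      by (rule has_derivative_transform_within_open[OF _ U that]) (simp add: w_def)
  qed
  have D0: "(w i has_derivative (\<lambda>v. 0)) (at u)" if "u \<notin> K" for i u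
    by (rule has_derivative_transform_within_open[OF has_derivative_const[of 0], of "- K"])
      (use K that in \<open>auto simp: w_def open_Compl compact_imp_closed\<close>)
  have FDw: "FD (w i) u v = (if u \<in> U then g u * FD V u v $ i + FD g u v * V u $ i else 0)" for i u v
    using FD_eqI[OF D, of u i] FD_eqI[OF D0, of u i] K(2) by (cases "u \<in> U"; cases "u \<in> K") auto
  have FDK: "FD (w i) u v = 0" if "u \<notin> K" for i u v
    using FD_eqI[OF D0[OF that]] by simp
  have contU: "continuous_on U (\<lambda>u. g u * FD V u v $ i + FD g u v * V u $ i)" for i v
    using V g Ck_on_Suc[of 0 U g] Ck_on_Suc[of 0 U V] by (auto intro!: continuous_intros)
  have contw: "continuous_on UNIV (\<lambda>u. FD (w i) u v)" for i v
    unfolding FDw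
    by (rule continuous_on_extend_zero[OF U contU K(1,2)]) (metis FDK FDw)
  have int0: "integral UNIV (\<lambda>u. FD (w i) u (axis i 1)) = 0" for i
  proof (rule integral_directional_derivative[OF _ contw K(1)])
    show "w i differentiable (at u)" for u
      unfolding differentiable_def using D[of u i] D0[of u i] K(2) by blast
    show "w i u = 0" if "u \<notin> K" for u
      using K(3) that by (auto simp: w_def)
  qed
  have integrable: "(\<lambda>u. FD (w i) u (axis i 1)) integrable_on UNIV" for i
    using absolutely_integrable_compact_support[OF open_UNIV contw K(1) subset_UNIV FDK]
    by (rule set_lebesgue_integral_eq_integral(1))
  have "integral U (\<lambda>u. FD g u (V u)) = integral UNIV (\<lambda>u. if u \<in> U then FD g u (V u) else 0)"
    by (simp add: integral_restrict_UNIV)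
  also have "(\<lambda>u. if u \<in> U then FD g u (V u) else 0) = (\<lambda>u. \<Sum>i\<in>UNIV. FD (w i) u (axis i 1))"
  proof
    fix u
    show "(if u \<in> U then FD g u (V u) else 0) = (\<Sum>i\<in>UNIV. FD (w i) u (axis i 1))"
    proof (cases "u \<in> U")
      case True
      have "(\<Sum>i\<in>UNIV. FD (w i) u (axis i 1))
          = g u * (\<Sum>i\<in>UNIV. FD V u (axis i 1) $ i) + (\<Sum>i\<in>UNIV. V u $ i * FD g u (axis i 1))"
        using True by (simp add: FDw sum.distrib sum_distrib_left mult.commute)
      then show ?thesis
        using True div[OF True] FD_axis_expand[OF dg[OF True], of "V u"] by simp
    qed (simp add: FDw)
  qed
  also have "integral UNIV (\<lambda>u. \<Sum>i\<in>UNIV. FD (w i) u (axis i 1)) = (\<Sum>i\<in>UNIV. integral UNIV (\<lambda>u. FD (w i) u (axis i 1)))"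
    by (rule integral_sum) (simp_all add: integrable)
  also have "\<dots> = 0"
    by (simp add: int0)
  finally show ?thesis .
qed

lemma integral_change_chart:
  fixes \<tau> :: "real^'n::{finite,wellorder} \<Rightarrow> real^'n::_" and f :: "real^'n::_ \<Rightarrow> real"
  assumes S: "open S" and \<tau>: "\<And>u. u \<in> S \<Longrightarrow> \<tau> differentiable (at u)" "inj_on \<tau> S"
    and det: "\<And>u. u \<in> S \<Longrightarrow> det (matrix (FD \<tau> u)) > 0"
    and f: "f absolutely_integrable_on \<tau> ` S"
  shows "integral S (\<lambda>u. det (matrix (FD \<tau> u)) * f (\<tau> u)) = integral (\<tau> ` S) f"
proof -
  \<comment> \<open>The change of variables formula is applied to a vector-valued integrand, so the
    scalar \<open>f\<close> is placed on the axis of \<open>real^1\<close>. Positivity of the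
    Jacobian removes the absolute value afterwards.\<close>
  let ?f = "\<lambda>u. f u *\<^sub>R axis 1 1 :: real^1"
  have int: "?f absolutely_integrable_on \<tau> ` S"
    using absolutely_integrable_linear[OF f bounded_linear_scaleR_left] by (simp add: o_def)
  have D: "(\<tau> has_derivative FD \<tau> u) (at u within S)" if "u \<in> S" for u
    using FD_has_derivative[OF \<tau>(1)[OF that]] has_derivative_at_withinI by blast
  have *: "(\<lambda>u. \<bar>det (matrix (FD \<tau> u))\<bar> *\<^sub>R ?f (\<tau> u)) absolutely_integrable_on S"
    "integral (\<tau> ` S) ?f = integral S (\<lambda>u. \<bar>det (matrix (FD \<tau> u))\<bar> *\<^sub>R ?f (\<tau> u))"
    using has_absolute_integral_change_of_variables[OF _ D \<tau>(2), of ?f "integral (\<tau> ` S) ?f"] int S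
    by (auto simp: lebesgue_openin lmeasurable_open)
  have comp: "integral T h $ 1 = integral T (\<lambda>u. h u $ 1)" if "h integrable_on T" for T and h :: "real^'n::_ \<Rightarrow> real^1"
    using integral_linear[OF that bounded_linear_vec_nth[of 1]] by (simp add: o_def)
  have "integral (\<tau> ` S) f = integral (\<tau> ` S) ?f $ 1"
    using comp[of ?f] set_lebesgue_integral_eq_integral(1)[OF int] by simp
  also have "\<dots> = integral S (\<lambda>u. \<bar>det (matrix (FD \<tau> u))\<bar> * f (\<tau> u))"
    unfolding *(2) using comp[OF set_lebesgue_integral_eq_integral(1)[OF *(1)]] by simp
  also have "\<dots> = integral S (\<lambda>u. det (matrix (FD \<tau> u)) * f (\<tau> u))"
    using det by (intro integral_cong) (simp add: abs_of_pos)
  finally show ?thesis by simp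
qed

lemma oriented_atlas_pre: "oriented_atlas A \<Longrightarrow> pre_atlas A"
  by (simp add: oriented_atlas_def smooth_atlas_imp_pre_atlas)

lemma oriented_atlas_det:
  assumes "oriented_atlas A" "c \<in> A" "c' \<in> A" "x \<in> cdom c" "x \<in> cdom c'"
  shows "det (matrix (FD (cmap c' \<circ> cinv c) (cmap c x))) > 0"
  using assms by (simp add: oriented_atlas_def)

lemma oriented_atlas_chart:
  assumes "oriented_atlas A" "c \<in> A"
  shows "open (cdom c)" "continuous_on (cdom c) (cmap c)"
  using assms by (auto simp: oriented_atlas_def smooth_atlas_def topological_chart_def homeomorphism_def)

lemma compact_chart_image:
  fixes A :: "('a::t2_space, real^3) chart set"
  assumes "oriented_atlas A" "c \<in> A" "compact K" "K \<subseteq> cdom c"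
  shows "compact (cmap c ` K)"
  using assms oriented_atlas_chart(2) by (meson compact_continuous_image continuous_on_subset)

lemma smooth_fun_chart: "smooth_fun A f \<Longrightarrow> c \<in> A \<Longrightarrow> smooth_on (cmap c ` cdom c) (f \<circ> cinv c)"
  by (simp add: smooth_fun_def)

lemma FD_zero_off_support:
  fixes A :: "('a::t2_space, real^3) chart set" and f :: "'a \<Rightarrow> real"
  assumes A: "oriented_atlas A" and c: "c \<in> A" "x \<in> cdom c" "x \<notin> closure {x. f x \<noteq> 0}"
  shows "FD (f \<circ> cinv c) (cmap c x) v = 0"
proof -
  note pre = oriented_atlas_pre[OF A]
  let ?N = "cdom c - closure {x. f x \<noteq> 0}"
  have ch: "topological_chart c"
    using A c by (auto simp: oriented_atlas_def smooth_atlas_def)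
  have "openin (top_of_set (cmap c ` cdom c)) (cmap c ` ?N)"
    using ch unfolding topological_chart_def
    by (intro homeomorphism_imp_open_map[of _ _ _ "cinv c"]) (auto simp: Diff_eq intro!: openin_open_Int)
  then have "open (cmap c ` ?N)"
    using openin_open_trans ch topological_chart_def by blast
  moreover have "(f \<circ> cinv c) u = 0" if "u \<in> cmap c ` ?N" for u
    using that c closure_subset[of "{x. f x \<noteq> 0}"] by (auto simp: cinv_cmap[OF pre])
  ultimately have "FD (f \<circ> cinv c) (cmap c x) = FD (\<lambda>_. 0) (cmap c x)"
    using c by (intro FD_cong[of "cmap c ` ?N"]) auto
  then show ?thesis
    using FD_eqI[OF has_derivative_const[of "0::real" "at (cmap c x)"]] by simp
qed

text \<open>\<open>V\<close> is the divergence-free vector density dual to a closed 2-form \<open>\<eta>\<close>, so that the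
  coefficient of \<open>d\<phi> \<and> \<eta>\<close> is \<open>d\<phi>(V)\<close>.\<close>

locale closed_density =
  fixes A :: "('a::t2_space, real^3) chart set"
    and V :: "('a, real^3) chart \<Rightarrow> real^3 \<Rightarrow> real^3"
  assumes A: "oriented_atlas A" and compact: "compact (UNIV :: 'a set)"
    and V_C1: "\<And>c. c \<in> A \<Longrightarrow> Ck_on 1 (cmap c ` cdom c) (V c)"
    and V_div: "\<And>c u. c \<in> A \<Longrightarrow> u \<in> cmap c ` cdom c \<Longrightarrow> (\<Sum>i\<in>UNIV. FD (V c) u (axis i 1) $ i) = 0"
    and V_change: "\<And>c c' x. c \<in> A \<Longrightarrow> c' \<in> A \<Longrightarrow> x \<in> cdom c \<Longrightarrow> x \<in> cdom c' \<Longrightarrow>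
      FD (cmap c' \<circ> cinv c) (cmap c x) (V c (cmap c x)) =
      det (matrix (FD (cmap c' \<circ> cinv c) (cmap c x))) *\<^sub>R V c' (cmap c' x)"
begin

lemmas pre = oriented_atlas_pre[OF A]

text \<open>The coefficient in the chart \<open>c\<close> of the 3-form a db \<and> \<eta>, with
  \<eta> the closed 2-form dual to the density.\<close>

definition dterm :: "('a \<Rightarrow> real) \<Rightarrow> ('a \<Rightarrow> real) \<Rightarrow> ('a, real^3) chart \<Rightarrow> real^3 \<Rightarrow> real" where
  "dterm a b c u = a (cinv c u) * FD (b \<circ> cinv c) u (V c u)"

lemma continuous_dterm:
  assumes "c \<in> A" "smooth_fun A a" "smooth_fun A b"
  shows "continuous_on (cmap c ` cdom c) (dterm a b c)"
proof -
  let ?U = "cmap c ` cdom c"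
  have b: "smooth_on ?U (b \<circ> cinv c)" and a: "smooth_on ?U (a \<circ> cinv c)"
    using assms by (simp_all add: smooth_fun_chart)
  have "continuous_on ?U (\<lambda>u. \<Sum>k\<in>UNIV. V c u $ k *\<^sub>R FD (b \<circ> cinv c) u (axis k 1))"
    using V_C1[OF assms(1)] Ck_on_Suc[of 0 ?U "V c"]
    by (intro continuous_intros smooth_on_continuous[OF smooth_on_FD[OF b]]) auto
  then have "continuous_on ?U (\<lambda>u. FD (b \<circ> cinv c) u (V c u))"
    by (rule continuous_on_eq) (rule FD_axis_expand[OF smooth_on_differentiable[OF b], symmetric])
  then show ?thesis
    using smooth_on_continuous[OF a] unfolding dterm_def o_def by (intro continuous_on_mult) auto
qed

lemma dterm_change:
  assumes "c \<in> A" "c' \<in> A" "x \<in> cdom c" "x \<in> cdom c'" "smooth_fun A b"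
  shows "dterm a b c (cmap c x) = det (matrix (FD (cmap c' \<circ> cinv c) (cmap c x))) * dterm a b c' (cmap c' x)"
proof -
  have b: "(b \<circ> cinv c') differentiable (at (cmap c' x))"
    using assms by (intro smooth_on_differentiable[OF smooth_fun_chart]) auto
  then show ?thesis
    using assms change_chart(2)[OF pre assms(1,3,2,4) b] V_change[OF assms(1-4)]
      linear_cmul[OF FD_linear[OF b]]
    by (simp add: dterm_def cinv_cmap[OF pre])
qed

lemma dterm_integrable:
  assumes c: "c \<in> A" and smooth: "smooth_fun A a" "smooth_fun A b"
    and K: "closed K" "K \<subseteq> cdom c" "\<And>u. u \<in> cmap c ` cdom c \<Longrightarrow> u \<notin> cmap c ` K \<Longrightarrow> dterm a b c u = 0"
  shows "dterm a b c absolutely_integrable_on (cmap c ` cdom c)"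
proof -
  have "compact K"
    using compact_Int_closed[OF compact K(1)] by simp
  show ?thesis
    by (rule absolutely_integrable_compact_support[OF open_image[OF pre c] continuous_dterm[OF c smooth]
          compact_chart_image[OF A c \<open>compact K\<close> K(2)]]) (use K in auto)
qed

lemma dterm_zero_left: "c \<in> A \<Longrightarrow> x \<in> cdom c \<Longrightarrow> x \<notin> closure {x. a x \<noteq> 0} \<Longrightarrow> dterm a b c (cmap c x) = 0"
  using closure_subset[of "{x. a x \<noteq> 0}"] by (auto simp: dterm_def cinv_cmap[OF pre])

lemma dterm_zero_right: "c \<in> A \<Longrightarrow> x \<in> cdom c \<Longrightarrow> x \<notin> closure {x. b x \<noteq> 0} \<Longrightarrow> dterm a b c (cmap c x) = 0"
  by (simp add: dterm_def FD_zero_off_support[OF A])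

text \<open>The term is supported in both chart domains, so both integrals reduce to the overlap,
  where \<open>dterm\<close> transforms by the positive Jacobian determinant.\<close>

lemma dterm_integral_change:
  assumes c: "c \<in> A" "c' \<in> A" and smooth: "smooth_fun A a" "smooth_fun A b"
    and K: "closed K" "K \<subseteq> cdom c" "K \<subseteq> cdom c'"
    and zero: "\<And>c x. c \<in> A \<Longrightarrow> x \<in> cdom c \<Longrightarrow> x \<notin> K \<Longrightarrow> dterm a b c (cmap c x) = 0"
  shows "integral (cmap c ` cdom c) (dterm a b c) = integral (cmap c' ` cdom c') (dterm a b c')"
proof -
  let ?S = "cmap c ` (cdom c \<inter> cdom c')" and ?\<tau> = "cmap c' \<circ> cinv c"
  have \<tau>S: "?\<tau> ` ?S = cmap c' ` (cdom c \<inter> cdom c')"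
    using c by (auto simp: image_image cinv_cmap[OF pre] cong: image_cong_simp)
  have inj: "inj_on ?\<tau> ?S"
    using c pre by (auto simp: inj_on_def cinv_cmap[OF pre] pre_atlas_def)
  have int': "dterm a b c' absolutely_integrable_on (cmap c' ` cdom c')"
    using zero[OF c(2)] by (intro dterm_integrable[OF c(2) smooth K(1,3)]) auto
  have int: "dterm a b c' absolutely_integrable_on ?\<tau> ` ?S"
    unfolding \<tau>S
    by (rule set_integrable_subset[OF int'])
      (use open_overlap[OF pre c(2,1)] in \<open>auto simp: Int_commute lebesgue_openin\<close>)
  have "integral (cmap c ` cdom c) (dterm a b c) = integral ?S (dterm a b c)"
    using zero[OF c(1)] K by (intro integral_support) auto
  also have "\<dots> = integral ?S (\<lambda>u. det (matrix (FD ?\<tau> u)) * dterm a b c' (?\<tau> u))"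
  proof (rule integral_cong)
    fix u assume "u \<in> ?S"
    then obtain x where x: "u = cmap c x" "x \<in> cdom c" "x \<in> cdom c'" by auto
    show "dterm a b c u = det (matrix (FD ?\<tau> u)) * dterm a b c' (?\<tau> u)"
      using dterm_change[OF c x(2,3) smooth(2), of a] x c by (simp add: cinv_cmap[OF pre])
  qed
  also have "\<dots> = integral (?\<tau> ` ?S) (dterm a b c')"
  proof (rule integral_change_chart[OF open_overlap[OF pre c] _ inj _ int])
    fix u assume "u \<in> ?S"
    then obtain x where x: "u = cmap c x" "x \<in> cdom c" "x \<in> cdom c'" by auto
    show "?\<tau> differentiable (at u)"
      unfolding x(1) by (rule transition_differentiable[OF pre c x(2,3)])
    show "det (matrix (FD ?\<tau> u)) > 0"
      unfolding x(1) by (rule oriented_atlas_det[OF A c x(2,3)])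
  qed
  also have "\<dots> = integral (cmap c' ` cdom c') (dterm a b c')"
    unfolding \<tau>S using zero[OF c(2)] K by (intro integral_support[symmetric]) auto
  finally show ?thesis .
qed

text \<open>Integration by parts in each chart turns the sum of the integrals of f_i d\<phi> \<and>
  \<eta> into minus that of \<phi> df_i \<and> \<eta>. After inserting 1 as the sum of the f_j, the
  (i, j) term is moved from chart i to chart j. For fixed j the sum over i is then the integral of
  f_j \<phi> d(1) \<and> \<eta>, which is 0.\<close>

theorem integral_exact:
  assumes \<phi>: "smooth_fun A \<phi>" and pou: "partition_of_unity A n ch f"
  shows "(\<Sum>i<n. integral (cmap (ch i) ` cdom (ch i)) (dterm (f i) \<phi> (ch i))) = 0"
proof -
  define K where "K i = closure {x. f i x \<noteq> 0}" for i
  have ch: "ch i \<in> A" and f: "smooth_fun A (f i)" and K: "K i \<subseteq> cdom (ch i)" if "i < n" for i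
    using pou that by (auto simp: partition_of_unity_def K_def)
  have sum1: "(\<Sum>i<n. f i x) = 1" for x
    using pou by (simp add: partition_of_unity_def)
  have closed: "closed (K i)" for i by (simp add: K_def)
  have prod: "smooth_fun A (\<lambda>x. g x * h x)" if "smooth_fun A g" "smooth_fun A h" for g h :: "'a \<Rightarrow> real"
    using that unfolding smooth_fun_def o_def by (auto intro!: smooth_on_mult open_image[OF pre])
  let ?I = "\<lambda>i. integral (cmap (ch i) ` cdom (ch i))"
  have dterm_int: "dterm a b (ch i) absolutely_integrable_on (cmap (ch i) ` cdom (ch i))"
    if "i < n" "smooth_fun A a" "smooth_fun A b"
      "\<And>x. x \<notin> K i \<Longrightarrow> x \<in> cdom (ch i) \<Longrightarrow> dterm a b (ch i) (cmap (ch i) x) = 0" for a b i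
    using that by (intro dterm_integrable[OF ch _ _ closed[of i] K]) auto
  \<comment> \<open>\<phi> need not have support in a chart, but its product with \<open>f i\<close>
    does, so the divergence theorem applies to the product.\<close>
  have int\<phi>: "?I i (dterm (f i) \<phi> (ch i)) = - ?I i (dterm \<phi> (f i) (ch i))" if i: "i < n" for i
  proof -
    let ?U = "cmap (ch i) ` cdom (ch i)" and ?g = "(\<lambda>x. f i x * \<phi> x) \<circ> cinv (ch i)"
    have g: "smooth_on ?U ?g"
      using smooth_fun_chart[OF prod[OF f[OF i] \<phi>] ch[OF i]] .
    have "compact (K i)"
      using compact_Int_closed[OF compact closed, of i] by simp
    have "integral ?U (\<lambda>u. FD ?g u (V (ch i) u)) = 0"
    proof (rule integral_divergence_zero[OF open_image[OF pre ch[OF i]] V_C1[OF ch[OF i]] V_div[OF ch[OF i]]])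
      show "Ck_on 1 ?U ?g" using g by (simp add: smooth_on_def)
      show "compact (cmap (ch i) ` K i)"
        by (rule compact_chart_image[OF A ch[OF i] \<open>compact (K i)\<close> K[OF i]])
      show "cmap (ch i) ` K i \<subseteq> ?U" using K[OF i] by auto
      show "?g u = 0" if "u \<in> ?U" "u \<notin> cmap (ch i) ` K i" for u
        using that closure_subset[of "{x. f i x \<noteq> 0}"] by (auto simp: cinv_cmap[OF pre ch[OF i]] K_def)
    qed
    also have "integral ?U (\<lambda>u. FD ?g u (V (ch i) u)) =
        integral ?U (\<lambda>u. dterm (f i) \<phi> (ch i) u + dterm \<phi> (f i) (ch i) u)"
    proof (rule integral_cong)
      fix u assume u: "u \<in> ?U"
      have "(f i \<circ> cinv (ch i)) differentiable (at u)" "(\<phi> \<circ> cinv (ch i)) differentiable (at u)"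
        using u smooth_on_differentiable smooth_fun_chart f \<phi> ch i by blast+
      then have "((\<lambda>u. (f i \<circ> cinv (ch i)) u * (\<phi> \<circ> cinv (ch i)) u) has_derivative
          (\<lambda>v. (f i \<circ> cinv (ch i)) u * FD (\<phi> \<circ> cinv (ch i)) u v + FD (f i \<circ> cinv (ch i)) u v * (\<phi> \<circ> cinv (ch i)) u)) (at u)"
        by (intro has_derivative_mult FD_has_derivative)
      then have "FD ?g u = (\<lambda>v. (f i \<circ> cinv (ch i)) u * FD (\<phi> \<circ> cinv (ch i)) u v + FD (f i \<circ> cinv (ch i)) u v * (\<phi> \<circ> cinv (ch i)) u)"
        by (intro FD_eqI) (simp add: o_def)
      then show "FD ?g u (V (ch i) u) = dterm (f i) \<phi> (ch i) u + dterm \<phi> (f i) (ch i) u"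
        by (simp add: dterm_def)
    qed
    also have "\<dots> = ?I i (dterm (f i) \<phi> (ch i)) + ?I i (dterm \<phi> (f i) (ch i))"
    proof (rule integral_add)
      show "dterm (f i) \<phi> (ch i) integrable_on ?U"
        by (rule set_lebesgue_integral_eq_integral(1)[OF dterm_int[OF i f[OF i] \<phi>]])
          (simp add: K_def dterm_zero_left ch[OF i])
      show "dterm \<phi> (f i) (ch i) integrable_on ?U"
        by (rule set_lebesgue_integral_eq_integral(1)[OF dterm_int[OF i \<phi> f[OF i]]])
          (simp add: K_def dterm_zero_right ch[OF i])
    qed
    finally show ?thesis by simp
  qed
  define a where "a j x = f j x * \<phi> x" for j x
  have a: "smooth_fun A (a j)" if "j < n" for j
    unfolding a_def using prod[OF f[OF that] \<phi>] .
  have zero_a: "dterm (a j) (f i) c (cmap c x) = 0" if "c \<in> A" "x \<in> cdom c" "x \<notin> K i \<inter> K j" for i j c x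
  proof (cases "x \<in> K i")
    case True
    then have "f j x = 0"
      using that closure_subset[of "{x. f j x \<noteq> 0}"] by (auto simp: K_def)
    then show ?thesis using that by (simp add: dterm_def a_def cinv_cmap[OF pre])
  next
    case False
    then show ?thesis using that by (simp add: dterm_zero_right K_def)
  qed
  have split: "?I i (dterm \<phi> (f i) (ch i)) = (\<Sum>j<n. ?I i (dterm (a j) (f i) (ch i)))" if i: "i < n" for i
  proof -
    have "dterm \<phi> (f i) (ch i) = (\<lambda>u. \<Sum>j<n. dterm (a j) (f i) (ch i) u)"
      using sum1 by (auto simp: dterm_def a_def fun_eq_iff simp flip: sum_distrib_right)
    moreover have "?I i (\<lambda>u. \<Sum>j<n. dterm (a j) (f i) (ch i) u) = (\<Sum>j<n. ?I i (dterm (a j) (f i) (ch i)))"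
    proof (rule integral_sum)
      fix j assume "j \<in> {..<n}"
      then have "dterm (a j) (f i) (ch i) absolutely_integrable_on (cmap (ch i) ` cdom (ch i))"
        using zero_a[OF ch[OF i]] by (intro dterm_int i a f) auto
      then show "dterm (a j) (f i) (ch i) integrable_on (cmap (ch i) ` cdom (ch i))"
        by (rule set_lebesgue_integral_eq_integral(1))
    qed simp
    ultimately show ?thesis by simp
  qed
  \<comment> \<open>The term vanishes off \<open>K i \<inter> K j\<close>, which lies in both
    domains. In the chart of \<open>j\<close> the differentials of all \<open>f i\<close> can be
    added up.\<close>
  have swap: "?I i (dterm (a j) (f i) (ch i)) = ?I j (dterm (a j) (f i) (ch j))" if "i < n" "j < n" for i j
    using that K by (intro dterm_integral_change[of _ _ _ _ "K i \<inter> K j"] ch a f zero_a closed_Int closed) auto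
  have "(\<Sum>i<n. ?I j (dterm (a j) (f i) (ch j))) = 0" if j: "j < n" for j
  proof -
    have "(\<Sum>i<n. ?I j (dterm (a j) (f i) (ch j))) = ?I j (\<lambda>u. \<Sum>i<n. dterm (a j) (f i) (ch j) u)"
    proof (rule integral_sum[symmetric])
      fix i assume "i \<in> {..<n}"
      then have "dterm (a j) (f i) (ch j) absolutely_integrable_on (cmap (ch j) ` cdom (ch j))"
        using zero_a[OF ch[OF j]] j by (intro dterm_int a f) auto
      then show "dterm (a j) (f i) (ch j) integrable_on (cmap (ch j) ` cdom (ch j))"
        by (rule set_lebesgue_integral_eq_integral(1))
    qed simp
    also have "\<dots> = ?I j (\<lambda>u. 0)"
    proof (rule integral_cong)
      fix u assume u: "u \<in> cmap (ch j) ` cdom (ch j)"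
      have D: "((f i \<circ> cinv (ch j)) has_derivative FD (f i \<circ> cinv (ch j)) u) (at u)" if "i < n" for i
        using smooth_on_differentiable[OF smooth_fun_chart[OF f[OF that] ch[OF j]] u] by (rule FD_has_derivative)
      have "((\<lambda>u. \<Sum>i<n. (f i \<circ> cinv (ch j)) u) has_derivative (\<lambda>v. \<Sum>i<n. FD (f i \<circ> cinv (ch j)) u v)) (at u)"
        by (rule has_derivative_sum) (rule D, simp)
      moreover have "(\<lambda>u. \<Sum>i<n. (f i \<circ> cinv (ch j)) u) = (\<lambda>_. 1)"
        using sum1 by simp
      ultimately have 1: "((\<lambda>_. 1::real) has_derivative (\<lambda>v. \<Sum>i<n. FD (f i \<circ> cinv (ch j)) u v)) (at u)"
        by (simp only:)
      have 0: "((\<lambda>_. 1::real) has_derivative (\<lambda>v. 0)) (at u)"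
        by (rule has_derivative_const)
      have "(\<lambda>v. \<Sum>i<n. FD (f i \<circ> cinv (ch j)) u v) = (\<lambda>v. 0)"
        by (rule has_derivative_unique[OF 1 0])
      then show "(\<Sum>i<n. dterm (a j) (f i) (ch j) u) = 0"
        unfolding dterm_def by (simp add: fun_eq_iff flip: sum_distrib_left)
    qed
    finally show ?thesis by simp
  qed
  then have "(\<Sum>j<n. \<Sum>i<n. ?I j (dterm (a j) (f i) (ch j))) = 0" by simp
  moreover have "(\<Sum>i<n. ?I i (dterm (f i) \<phi> (ch i))) = - (\<Sum>i<n. \<Sum>j<n. ?I i (dterm (a j) (f i) (ch i)))"
    unfolding sum_negf[symmetric] by (intro sum.cong refl) (simp add: int\<phi> split sum_negf)
  moreover have "(\<Sum>i<n. \<Sum>j<n. ?I j (dterm (a j) (f i) (ch j))) = (\<Sum>i<n. \<Sum>j<n. ?I i (dterm (a j) (f i) (ch i)))"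
    by (intro sum.cong refl) (rule swap[symmetric]; simp)
  ultimately show ?thesis
    using sum.swap[of "\<lambda>i j. ?I j (dterm (a j) (f i) (ch j))" "{..<n}" "{..<n}"] by simp
qed

end

section \<open>Calculus on Sol\<close>

lemma has_derivative_vec:
  fixes f :: "'a::real_normed_vector \<Rightarrow> real^'n"
  assumes "\<And>i. ((\<lambda>x. f x $ i) has_derivative (\<lambda>v. f' v $ i)) (at x)"
  shows "(f has_derivative f') (at x)"
proof -
  have "((\<lambda>x. \<Sum>i\<in>UNIV. f x $ i *\<^sub>R axis i (1::real)) has_derivative (\<lambda>v. \<Sum>i\<in>UNIV. f' v $ i *\<^sub>R axis i 1)) (at x)"
    using assms by (intro has_derivative_sum has_derivative_scaleR_left)
  then show ?thesis
    by (simp add: basis_expansion flip: scalar_mult_eq_scaleR)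
qed

lemma has_derivative_nth:
  "(f has_derivative f') (at x) \<Longrightarrow> ((\<lambda>x. f x $ i) has_derivative (\<lambda>v. f' v $ i)) (at x)"
  by (rule bounded_linear.has_derivative[OF bounded_linear_vec_nth])

lemma has_derivative_vector3:
  assumes "(f has_derivative f') (at x)" "(g has_derivative g') (at x)" "(h has_derivative h') (at x)"
  shows "((\<lambda>x. vector [f x, g x, h x] :: real^3) has_derivative (\<lambda>v. vector [f' v, g' v, h' v])) (at x)"
proof (rule has_derivative_vec)
  fix i :: 3
  show "((\<lambda>x. (vector [f x, g x, h x] :: real^3) $ i) has_derivative (\<lambda>v. (vector [f' v, g' v, h' v] :: real^3) $ i)) (at x)"
    using assms exhaust_3[of i] by auto
qed

lemma FD_nth: "f differentiable (at x) \<Longrightarrow> FD (\<lambda>x. f x $ i) x v = FD f x v $ i"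
  by (rule fun_cong[OF FD_eqI[OF has_derivative_nth[OF FD_has_derivative]]])

lemma sol_mult_nth [simp]:
  "sol_mult a b $ 1 = a$1 + exp (- a$3) * b$1" "sol_mult a b $ 2 = a$2 + exp (a$3) * b$2" "sol_mult a b $ 3 = a$3 + b$3"
  by (simp_all add: sol_mult_def)

lemma sol_inv_nth [simp]:
  "sol_inv a $ 1 = - exp (a$3) * a$1" "sol_inv a $ 2 = - exp (- a$3) * a$2" "sol_inv a $ 3 = - a$3"
  by (simp_all add: sol_inv_def)

lemma maurer_cartan_nth [simp]:
  "maurer_cartan a v $ 1 = exp (a$3) * v$1" "maurer_cartan a v $ 2 = exp (- a$3) * v$2" "maurer_cartan a v $ 3 = v$3"
  by (simp_all add: maurer_cartan_eq)

lemma sol_mult_assoc: "sol_mult (sol_mult a b) c = sol_mult a (sol_mult b c)"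
  by (simp add: vec_eq_iff forall_3 exp_add exp_diff exp_minus field_simps)

lemma sol_mult_0 [simp]: "sol_mult 0 a = a" "sol_mult a 0 = a"
  by (simp_all add: vec_eq_iff forall_3)

lemma sol_inv_left [simp]: "sol_mult (sol_inv a) a = 0"
  by (simp add: vec_eq_iff forall_3)

lemma sol_inv_right [simp]: "sol_mult a (sol_inv a) = 0"
  by (simp add: vec_eq_iff forall_3 exp_minus)

lemma sol_cancel [simp]: "sol_mult (sol_inv a) (sol_mult a b) = b" "sol_mult a (sol_mult (sol_inv a) b) = b"
  by (simp_all flip: sol_mult_assoc)

lemma sol_inv_mult: "sol_inv (sol_mult a b) = sol_mult (sol_inv b) (sol_inv a)"
  by (simp add: vec_eq_iff forall_3 exp_add exp_diff exp_minus field_simps)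

lemma sol_mult_left_cancel [simp]: "sol_mult a b = sol_mult a c \<longleftrightarrow> b = c"
  by (metis sol_cancel(1))

lemma smooth_on_sol_mult:
  "open S \<Longrightarrow> smooth_on S f \<Longrightarrow> smooth_on S g \<Longrightarrow> smooth_on S (\<lambda>x. sol_mult (f x) (g x))"
  unfolding sol_mult_def by (intro smooth_intros)

lemma smooth_on_sol_inv: "open S \<Longrightarrow> smooth_on S f \<Longrightarrow> smooth_on S (\<lambda>x. sol_inv (f x))"
  unfolding sol_inv_def by (intro smooth_intros)

lemma smooth_on_maurer_cartan:
  "open S \<Longrightarrow> smooth_on S f \<Longrightarrow> smooth_on S g \<Longrightarrow> smooth_on S (\<lambda>x. maurer_cartan (f x) (g x))"
  unfolding maurer_cartan_eq by (intro smooth_intros)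

text \<open>The differential of the multiplication at \<open>(a, b)\<close> applied to
  \<open>(a', b')\<close>. Thus \<open>dmult a 0 b\<close> is the differential at \<open>b\<close>
  of left translation by \<open>a\<close>, and \<open>dmult a a' b 0\<close> is the image of
  \<open>a'\<close> under right translation by \<open>b\<close>.\<close>

definition dmult :: "real^3 \<Rightarrow> real^3 \<Rightarrow> real^3 \<Rightarrow> real^3 \<Rightarrow> real^3" where
  "dmult a a' b b' = vector [a'$1 + exp (- a$3) * b'$1 - a'$3 * exp (- a$3) * b$1,
     a'$2 + exp (a$3) * b'$2 + a'$3 * exp (a$3) * b$2, a'$3 + b'$3]"

lemma has_derivative_sol_mult:
  assumes "(f has_derivative f') (at x)" "(g has_derivative g') (at x)"
  shows "((\<lambda>x. sol_mult (f x) (g x)) has_derivative (\<lambda>v. dmult (f x) (f' v) (g x) (g' v))) (at x)"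
  unfolding sol_mult_def dmult_def
proof (rule has_derivative_vector3)
  note f = has_derivative_nth[OF assms(1)] and g = has_derivative_nth[OF assms(2)]
  have e: "((\<lambda>x. exp (f x $ 3)) has_derivative (\<lambda>v. exp (f x $ 3) * f' v $ 3)) (at x)"
    "((\<lambda>x. exp (- f x $ 3)) has_derivative (\<lambda>v. exp (- f x $ 3) * - f' v $ 3)) (at x)"
    using has_derivative_exp[OF f[of 3]] has_derivative_exp[OF has_derivative_minus[OF f[of 3]]]
    by (simp_all add: mult.commute)
  show "((\<lambda>x. f x $ 1 + exp (- f x $ 3) * g x $ 1) has_derivative
      (\<lambda>v. f' v $ 1 + exp (- f x $ 3) * g' v $ 1 - f' v $ 3 * exp (- f x $ 3) * g x $ 1)) (at x)"
    by (rule has_derivative_eq_rhs[OF has_derivative_add[OF f has_derivative_mult[OF e(2) g]]])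
      (simp add: fun_eq_iff algebra_simps)
  show "((\<lambda>x. f x $ 2 + exp (f x $ 3) * g x $ 2) has_derivative
      (\<lambda>v. f' v $ 2 + exp (f x $ 3) * g' v $ 2 + f' v $ 3 * exp (f x $ 3) * g x $ 2)) (at x)"
    by (rule has_derivative_eq_rhs[OF has_derivative_add[OF f has_derivative_mult[OF e(1) g]]])
      (simp add: fun_eq_iff algebra_simps)
  show "((\<lambda>x. f x $ 3 + g x $ 3) has_derivative (\<lambda>v. f' v $ 3 + g' v $ 3)) (at x)"
    by (intro has_derivative_add f g)
qed

lemma FD_sol_mult:
  "f differentiable (at x) \<Longrightarrow> g differentiable (at x) \<Longrightarrow>
   FD (\<lambda>x. sol_mult (f x) (g x)) x v = dmult (f x) (FD f x v) (g x) (FD g x v)"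
  by (rule fun_cong[OF FD_eqI[OF has_derivative_sol_mult[OF FD_has_derivative FD_has_derivative]]])

text \<open>Left invariance: \<open>dmult a 0 b\<close> is the differential of left translation. It
  makes the form descend to the flat bundle.\<close>

lemma maurer_cartan_left: "maurer_cartan (sol_mult a b) (dmult a 0 b b') = maurer_cartan b b'"
  by (simp add: vec_eq_iff forall_3 dmult_def exp_add exp_diff exp_minus field_simps)

lemma maurer_cartan_translation: "maurer_cartan a (dmult a 0 0 v) = v"
  by (simp add: vec_eq_iff forall_3 dmult_def exp_minus)

lemma sol_Ad_eq: "sol_Ad h \<xi> = vector [exp (- h$3) * \<xi>$1 + h$1 * \<xi>$3, exp (h$3) * \<xi>$2 - h$2 * \<xi>$3, \<xi>$3]"
proof -
  have 1: "((\<lambda>k. sol_mult h k) has_derivative (\<lambda>v. dmult h 0 0 v)) (at 0)"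
    using has_derivative_sol_mult[OF has_derivative_const[of h] has_derivative_ident, of 0] by simp
  have 2: "((\<lambda>k. sol_mult (sol_mult h k) (sol_inv h)) has_derivative
      (\<lambda>v. dmult (sol_mult h 0) (dmult h 0 0 v) (sol_inv h) 0)) (at 0)"
    by (rule has_derivative_sol_mult[OF 1 has_derivative_const])
  show ?thesis
    unfolding sol_Ad_def FD_eqI[OF 2] by (simp add: dmult_def vec_eq_iff forall_3 exp_minus)
qed

lemma sol_Ad_nth [simp]:
  "sol_Ad h \<xi> $ 1 = exp (- h$3) * \<xi>$1 + h$1 * \<xi>$3" "sol_Ad h \<xi> $ 2 = exp (h$3) * \<xi>$2 - h$2 * \<xi>$3" "sol_Ad h \<xi> $ 3 = \<xi>$3"
  by (simp_all add: sol_Ad_eq)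

lemma sol_Ad_mult: "sol_Ad (sol_mult a b) \<xi> = sol_Ad a (sol_Ad b \<xi>)"
  by (simp add: vec_eq_iff forall_3 exp_add exp_diff exp_minus field_simps)

lemma sol_Ad_0 [simp]: "sol_Ad 0 \<xi> = \<xi>"
  by (simp add: vec_eq_iff forall_3)

lemma sol_Ad_add: "sol_Ad a (\<xi> + \<eta>) = sol_Ad a \<xi> + sol_Ad a \<eta>"
  by (simp add: vec_eq_iff forall_3 algebra_simps)

text \<open>Right translation by \<open>k\<close> acts on the Maurer--Cartan form by Ad of the
  inverse of \<open>k\<close>, the equivariance demanded of a principal connection.\<close>

lemma maurer_cartan_right: "maurer_cartan (sol_mult a k) (dmult a a' k 0) = sol_Ad (sol_inv k) (maurer_cartan a a')"
  by (simp add: vec_eq_iff forall_3 dmult_def exp_add exp_diff exp_minus field_simps)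

lemma linear_maurer_cartan: "linear (maurer_cartan a)"
  by (rule linearI) (simp_all add: vec_eq_iff forall_3 algebra_simps)

text \<open>In the coframe dual to X, Y, Z the factors exp z and exp (-z) cancel, so the invariant
  volume is the coordinate volume.\<close>

lemma sol_vol_det: "sol_vol a u v w = det (vector [u, v, w] :: real^3^3)"
proof -
  have "exp (a$3) * exp (- a$3) = 1" by (simp flip: exp_add)
  then show ?thesis
    by (simp add: sol_vol_def wedge12_def wedge11_def det_3 exp_minus field_simps)
qed

lemma sol_vol_dmult:
  "sol_vol (sol_mult a b) (dmult a 0 b u) (dmult a 0 b v) (dmult a 0 b w) = sol_vol b u v w"
  unfolding sol_vol_def maurer_cartan_left ..

text \<open>The Gram matrix is the transpose of \<open>L\<close>, times a diagonal matrix with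
  entries exp (2z), exp (-2z), 1, times \<open>L\<close>; the diagonal matrix has determinant
  1.\<close>

lemma sol_metric_pullback_det:
  fixes L :: "real^3 \<Rightarrow> real^3"
  shows "det (\<chi> i j. sol_metric a (L (axis i 1)) (L (axis j 1)) :: real^3^3) = (det (matrix L))\<^sup>2"
proof -
  have e: "exp (2 * a$3) * exp (- 2 * a$3) = 1" by (simp flip: exp_add)
  define S where "S = (\<chi> i j. if i = j then (vector [exp (2 * a$3), exp (- 2 * a$3), 1] :: real^3) $ i else 0 :: real^3^3)"
  have "(\<chi> i j. sol_metric a (L (axis i 1)) (L (axis j 1))) = transpose (matrix L) ** (S ** matrix L)"
    by (simp add: vec_eq_iff matrix_matrix_mult_def transpose_def matrix_def sol_metric_def S_def sum_3 forall_3)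
  moreover have "det S = 1"
    using e by (simp add: S_def det_3)
  ultimately show ?thesis
    by (simp add: det_mul power2_eq_square)
qed

lemma inner_vol_sol_metric: "inner_vol (sol_metric a) u v w = sol_vol a u v w"
proof -
  have "(\<chi> i j. sol_metric a (axis i 1) (axis j 1)) = (\<chi> i j. sol_metric a ((\<lambda>x. x) (axis i 1)) ((\<lambda>x. x) (axis j 1)) :: real^3^3)"
    by simp
  then show ?thesis
    unfolding inner_vol_def sol_vol_det using sol_metric_pullback_det[of a "\<lambda>x. x"]
    by (simp add: matrix_id_mat_1[unfolded id_def] flip: id_def)
qed

section \<open>The flat bundle\<close>

locale sol_manifold =
  fixes A B :: "('a::t2_space, real^3) chart set"
    and p :: "'b::t2_space \<Rightarrow> 'a" and m\<^sub>0 :: 'b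
    and D :: "'b \<Rightarrow> real^3" and \<rho> :: "(real \<Rightarrow> 'a) set \<Rightarrow> real^3"
  assumes closed_manifold: "closed_oriented_3manifold A"
    and universal: "universal_covering p"
    and sol_atlas: "sol_structure A B"
    and developing: "developing_map B p D"
    and hol: "holonomy p m\<^sub>0 D \<rho>"
begin

lemma oriented_A: "oriented_atlas A" and compact_UNIV: "compact (UNIV :: 'a set)"
  using closed_manifold by (auto simp: closed_oriented_3manifold_def)

lemma oriented_AB: "oriented_atlas (A \<union> B)"
  using sol_atlas by (simp add: sol_structure_def)

lemmas pre_A = oriented_atlas_pre[OF oriented_A] and pre_AB = oriented_atlas_pre[OF oriented_AB]

lemma chart_A: obtains c where "c \<in> A" "x \<in> cdom c"
  using oriented_A unfolding oriented_atlas_def smooth_atlas_def by blast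

lemma chart_B: obtains b where "b \<in> B" "x \<in> cdom b"
  using sol_atlas unfolding sol_structure_def by blast

lemma open_chart_image:
  assumes "c \<in> A \<union> B" "open N"
  shows "open (cmap c ` (N \<inter> cdom c))"
proof -
  have ch: "topological_chart c"
    using assms oriented_AB by (auto simp: oriented_atlas_def smooth_atlas_def)
  then have "openin (top_of_set (cmap c ` cdom c)) (cmap c ` (N \<inter> cdom c))"
    using assms unfolding topological_chart_def
    using openin_open_Int[OF assms(2), of "cdom c"]
    by (intro homeomorphism_imp_open_map[of _ _ _ "cinv c"]) (simp_all add: Int_commute)
  then show ?thesis
    using openin_open_trans ch topological_chart_def by blast
qed

lemma cover_p: "covering_space UNIV p UNIV"
  using universal by (simp add: universal_covering_def)

lemma continuous_p: "continuous_on UNIV p"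
  by (rule covering_space_imp_continuous[OF cover_p])

lemma surj_p: obtains m where "p m = x"
  using covering_space_imp_surjective[OF cover_p] by (metis imageE UNIV_I)

sublocale simply_connected_covering p
proof
  show "covering_space UNIV p UNIV" by (rule cover_p)
  show "simply_connected (UNIV :: 'b set)"
    using universal by (simp add: universal_covering_def)
next
  fix x :: 'a and U assume U: "open U" "x \<in> U"
  obtain c where c: "c \<in> A" "x \<in> cdom c" by (rule chart_A)
  have "open (cmap c ` (U \<inter> cdom c))"
    using c U by (intro open_chart_image) auto
  then obtain e where e: "0 < e" "ball (cmap c x) e \<subseteq> cmap c ` (U \<inter> cdom c)"
    using c U open_contains_ball by (metis IntI imageI)
  have ch: "topological_chart c"
    using c oriented_A by (auto simp: oriented_atlas_def smooth_atlas_def)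
  let ?N = "cinv c ` ball (cmap c x) e"
  have "openin (top_of_set (cdom c)) ?N"
  proof (rule homeomorphism_imp_open_map)
    show "homeomorphism (cmap c ` cdom c) (cdom c) (cinv c) (cmap c)"
      using ch by (simp add: topological_chart_def homeomorphism_symD)
    show "openin (top_of_set (cmap c ` cdom c)) (ball (cmap c x) e)"
      using e by (intro open_subset) auto
  qed
  then have "open ?N"
    using ch openin_open_trans topological_chart_def by blast
  moreover have "x \<in> ?N"
    using e c by (intro image_eqI[of _ _ "cmap c x"]) (simp_all add: cinv_cmap[OF pre_A])
  moreover have "?N \<subseteq> U"
  proof
    fix y assume "y \<in> ?N"
    then obtain u where u: "y = cinv c u" "u \<in> ball (cmap c x) e" by blast
    then obtain y' where "u = cmap c y'" "y' \<in> U" "y' \<in> cdom c" using e by blast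
    then show "y \<in> U" using u c by (simp add: cinv_cmap[OF pre_A])
  qed
  moreover have "continuous_on (ball (cmap c x) e) (cinv c)"
    using ch e unfolding topological_chart_def homeomorphism_def
    by (meson Int_lower2 continuous_on_subset image_mono order_trans)
  then have "path_connected ?N"
    by (intro path_connected_continuous_image convex_imp_path_connected) auto
  ultimately show "\<exists>N. open N \<and> x \<in> N \<and> N \<subseteq> U \<and> path_connected N" by blast
qed

lemma open_map_p:
  assumes "open W"
  shows "open (p ` W)"
proof (subst open_subopen, intro ballI)
  fix x assume "x \<in> p ` W"
  then obtain m where m: "m \<in> W" "x = p m" by blast
  obtain V U q where V: "open V" "m \<in> V" "open U" "homeomorphism V U p q"
    using covering_slice[OF cover_p] .
  have "openin (top_of_set U) (p ` (W \<inter> V))"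
    using V(4) assms by (intro homeomorphism_imp_open_map[of V U p q]) (auto simp: Int_commute intro: openin_open_Int)
  then have "open (p ` (W \<inter> V))"
    using V(3) openin_open_trans by blast
  then show "\<exists>T. open T \<and> x \<in> T \<and> T \<subseteq> p ` W"
    using m V(2) by (intro exI[of _ "p ` (W \<inter> V)"]) auto
qed

text \<open>A sheet \<open>W\<close> of the covering over a part of the domain of the chart \<open>c\<close>; below, \<open>dev W\<close> is the
  branch of the developing map on \<open>p ` W\<close> that it defines.\<close>

definition slice :: "('a, real^3) chart \<Rightarrow> 'b set \<Rightarrow> bool" where
  "slice c W \<longleftrightarrow> c \<in> A \<and> open W \<and> inj_on p W \<and> p ` W \<subseteq> cdom c"

definition sec :: "'b set \<Rightarrow> 'a \<Rightarrow> 'b" where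
  "sec W x = inv_into W p x"

definition dev :: "'b set \<Rightarrow> 'a \<Rightarrow> real^3" where
  "dev W x = D (sec W x)"

lemma sec_p: "inj_on p W \<Longrightarrow> m \<in> W \<Longrightarrow> sec W (p m) = m"
  by (simp add: sec_def)

lemma p_sec: "x \<in> p ` W \<Longrightarrow> p (sec W x) = x"
  by (simp add: sec_def f_inv_into_f)

lemma sec_in: "x \<in> p ` W \<Longrightarrow> sec W x \<in> W"
  by (simp add: sec_def inv_into_into)

lemma slice_exists:
  assumes "c \<in> A" "p m \<in> cdom c"
  obtains W where "slice c W" "m \<in> W"
proof -
  obtain V U q where V: "open V" "m \<in> V" "open U" "homeomorphism V U p q"
    using covering_slice[OF cover_p] .
  have "open (p -` cdom c)"
    using continuous_p oriented_atlas_chart(1)[OF oriented_A assms(1)] continuous_on_open_vimage[of UNIV p] by auto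
  moreover have "inj_on p V"
    using V(4) by (metis homeomorphism_def inj_on_inverseI)
  ultimately have "slice c (V \<inter> p -` cdom c)"
    using V(1) assms by (auto simp: slice_def intro: inj_on_subset)
  then show thesis
    using that V(2) assms(2) by auto
qed

lemma slice_D:
  assumes "slice c W"
  shows "c \<in> A" "open W" "inj_on p W" "p ` W \<subseteq> cdom c" "open (p ` W)" "\<And>x. x \<in> p ` W \<Longrightarrow> x \<in> cdom c"
  using assms open_map_p by (auto simp: slice_def)

text \<open>Injectivity of \<open>p\<close> on the sheet lets the developing map be read on the
  base, where it is a Sol chart up to a left translation. Everything invariant under left
  translation can therefore be computed in Sol charts.\<close>

lemma dev_local:
  assumes W: "open W" "inj_on p W" "x \<in> p ` W" and b: "b \<in> B" "x \<in> cdom b"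
  obtains N g where "open N" "x \<in> N" "N \<subseteq> p ` W \<inter> cdom b" "\<forall>x'\<in>N. dev W x' = sol_mult g (cmap b x')"
proof -
  have "p (sec W x) \<in> cdom b"
    using W b by (simp add: p_sec)
  then obtain N g where N: "open N" "sec W x \<in> N" "p ` N \<subseteq> cdom b"
      "\<forall>m'\<in>N. D m' = sol_mult g (cmap b (p m'))"
    using developing b(1) unfolding developing_map_def by meson
  show thesis
  proof (rule that[of "p ` (N \<inter> W)" g])
    show "open (p ` (N \<inter> W))" using N W by (intro open_map_p) auto
    show "x \<in> p ` (N \<inter> W)" using N(2) W(3) p_sec sec_in by (metis IntI image_eqI)
    show "p ` (N \<inter> W) \<subseteq> p ` W \<inter> cdom b" using N by auto
    show "\<forall>x'\<in>p ` (N \<inter> W). dev W x' = sol_mult g (cmap b x')"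
      using N(4) W(2) by (auto simp: dev_def sec_p)
  qed
qed

lemma smooth_dev:
  assumes c: "c \<in> A" and W: "open W" "inj_on p W"
  shows "smooth_on (cmap c ` (p ` W \<inter> cdom c)) (dev W \<circ> cinv c)"
proof (rule smooth_on_local)
  fix u assume "u \<in> cmap c ` (p ` W \<inter> cdom c)"
  then obtain x where x: "u = cmap c x" "x \<in> p ` W" "x \<in> cdom c" by blast
  obtain b where b: "b \<in> B" "x \<in> cdom b" by (rule chart_B)
  obtain N g where N: "open N" "x \<in> N" "N \<subseteq> p ` W \<inter> cdom b" "\<forall>x'\<in>N. dev W x' = sol_mult g (cmap b x')"
    using dev_local[OF W x(2) b] .
  let ?O = "cmap c ` (N \<inter> cdom c)"
  have O: "open ?O" using c N by (intro open_chart_image) auto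
  have "smooth_on ?O (cmap b \<circ> cinv c)"
    by (rule smooth_on_subset[OF smooth_transition[OF pre_AB, of c b]]) (use c b N(3) in auto)
  then have "smooth_on ?O (\<lambda>u. sol_mult g ((cmap b \<circ> cinv c) u))"
    by (intro smooth_on_sol_mult O smooth_on_const)
  then have "smooth_on ?O (dev W \<circ> cinv c)"
    by (rule smooth_on_cong[OF O, rotated]) (use N c in \<open>auto simp: cinv_cmap[OF pre_A]\<close>)
  then show "\<exists>N. open N \<and> u \<in> N \<and> smooth_on N (dev W \<circ> cinv c)"
    using O x N(2) by blast
qed

lemma smooth_dev_slice: "slice c W \<Longrightarrow> smooth_on (cmap c ` p ` W) (dev W \<circ> cinv c)"
  using smooth_dev[of c W] slice_D[of c W] by (simp add: Int_absorb2)

abbreviation "q \<equiv> assoc_class p m\<^sub>0 \<rho>"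
abbreviation "P \<equiv> flat_bundle p m\<^sub>0 \<rho>"
abbreviation "bun \<equiv> bundle_atlas A p m\<^sub>0 \<rho>"
abbreviation "tot \<equiv> total_atlas A p"
abbreviation "base \<equiv> bundle_proj p"

text \<open>The developing map is an equivariant section of the trivial bundle, so it trivializes the
  flat bundle: the class of \<open>(m, h)\<close> is determined by \<open>p m\<close> and \<open>(D m)\<^sup>-\<^sup>1 h\<close>.\<close>

lemma q_eq: "q (m, h) = {(m', h'). p m' = p m \<and> sol_mult (sol_inv (D m')) h' = sol_mult (sol_inv (D m)) h}"
proof (intro Set.set_eqI iffI)
  fix z assume "z \<in> q (m, h)"
  then obtain C where C: "C \<in> carrier (fundamental_group (p m\<^sub>0))" "z = (deck_action p m\<^sub>0 C m, sol_mult (\<rho> C) h)"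
    by (auto simp: assoc_class_def)
  then have "D (deck_action p m\<^sub>0 C m) = sol_mult (\<rho> C) (D m)"
    using hol by (simp add: holonomy_def)
  then show "z \<in> {(m', h'). p m' = p m \<and> sol_mult (sol_inv (D m')) h' = sol_mult (sol_inv (D m)) h}"
    using C by (simp add: deck_action sol_inv_mult sol_mult_assoc)
next
  fix z assume "z \<in> {(m', h'). p m' = p m \<and> sol_mult (sol_inv (D m')) h' = sol_mult (sol_inv (D m)) h}"
  then obtain m' h' where z: "z = (m', h')" "p m = p m'" "sol_mult (sol_inv (D m')) h' = sol_mult (sol_inv (D m)) h"
    by auto
  obtain C where C: "C \<in> carrier (fundamental_group (p m\<^sub>0))" "deck_action p m\<^sub>0 C m = m'"
    using deck_action_transitive[OF z(2)] .
  then have "D m' = sol_mult (\<rho> C) (D m)"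
    using hol by (auto simp: holonomy_def)
  then have "h' = sol_mult (\<rho> C) h"
    using z(3) by (metis sol_cancel(2) sol_mult_assoc)
  then show "z \<in> q (m, h)"
    using C z by (auto simp: assoc_class_def)
qed

lemma q_eq_iff: "q (m, h) = q (m', h') \<longleftrightarrow> p m = p m' \<and> sol_mult (sol_inv (D m)) h = sol_mult (sol_inv (D m')) h'"
  (is "_ \<longleftrightarrow> ?R")
proof
  assume "q (m, h) = q (m', h')"
  moreover have "(m, h) \<in> q (m, h)" by (simp add: q_eq)
  ultimately have "(m, h) \<in> q (m', h')" by simp
  then show ?R by (simp add: q_eq)
qed (simp add: q_eq)

definition fib :: "('b \<times> (real^3)) set \<Rightarrow> real^3" where
  "fib y = (let z = SOME z. z \<in> y in sol_mult (sol_inv (D (fst z))) (snd z))"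

text \<open>Inverse of the trivialization by \<open>base\<close> and \<open>fib\<close>; the choice
  of \<open>m\<close> is immaterial by \<open>q_eq_iff\<close>. The section given by the developing
  map is \<open>mk x 0\<close>.\<close>

definition mk :: "'a \<Rightarrow> real^3 \<Rightarrow> ('b \<times> (real^3)) set" where
  "mk x k = (let m = SOME m. p m = x in q (m, sol_mult (D m) k))"

lemma base_q [simp]: "base (q (m, h)) = p m"
  and fib_q [simp]: "fib (q (m, h)) = sol_mult (sol_inv (D m)) h"
proof -
  have "(SOME z. z \<in> q (m, h)) \<in> q (m, h)"
    by (rule someI[of _ "(m, h)"]) (simp add: q_eq)
  then show "base (q (m, h)) = p m" "fib (q (m, h)) = sol_mult (sol_inv (D m)) h"
    unfolding bundle_proj_def fib_def Let_def q_eq[of m h] by (auto simp: case_prod_beta)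
qed

lemma mk_eq: "p m = x \<Longrightarrow> mk x k = q (m, sol_mult (D m) k)"
  unfolding mk_def Let_def q_eq_iff by (simp add: someI[of "\<lambda>m. p m = x"])

lemma mk_in [simp]: "mk x k \<in> P"
  by (simp add: mk_def flat_bundle_def Let_def)

lemma base_mk [simp]: "base (mk x k) = x" and fib_mk [simp]: "fib (mk x k) = k"
proof -
  obtain m where "p m = x" by (rule surj_p)
  then show "base (mk x k) = x" "fib (mk x k) = k"
    using mk_eq[of m x k] by simp_all
qed

lemma P_cases: assumes "y \<in> P" obtains m h where "y = q (m, h)"
  using assms by (auto simp: flat_bundle_def)

lemma mk_base_fib: "y \<in> P \<Longrightarrow> mk (base y) (fib y) = y"
  by (erule P_cases) (simp add: mk_eq)

lemma q_in [simp]: "q z \<in> P"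
  by (simp add: flat_bundle_def)

section \<open>Charts of the total space and of the flat bundle\<close>

definition tchart :: "('a, real^3) chart \<Rightarrow> 'b set \<Rightarrow> ('b \<times> (real^3), (real^3) \<times> (real^3)) chart" where
  "tchart c W = (W \<times> UNIV, \<lambda>(x, y). ((cmap c \<circ> p) x, id y))"

text \<open>Kept in the shape produced by unfolding \<open>quotient_atlas\<close>; the workable
  descriptions are \<open>bchart_dom\<close> and \<open>bchart_map\<close>.\<close>

definition bchart :: "('a, real^3) chart \<Rightarrow> 'b set \<Rightarrow> (('b \<times> (real^3)) set, (real^3) \<times> (real^3)) chart" where
  "bchart c W = (q ` (W \<times> UNIV), (\<lambda>(x, y). ((cmap c \<circ> p) x, id y)) \<circ> inv_into (W \<times> UNIV) q)"

lemma inj_q: "inj_on p W \<Longrightarrow> inj_on q (W \<times> UNIV)"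
  by (auto simp: inj_on_def q_eq_iff)

lemma tot_eq: "tot = {tchart c W | c W. slice c W}"
  unfolding total_atlas_def prod_atlas_def vec_atlas_def cover_atlas_def slice_def tchart_def by force

lemma bun_eq: "bun = {bchart c W | c W. slice c W}"
proof -
  have chart: "bchart c W = (q ` cdom (tchart c W), cmap (tchart c W) \<circ> inv_into (cdom (tchart c W)) q)" for c W
    by (simp add: bchart_def tchart_def)
  have inj: "inj_on q (cdom (tchart c W))" if "slice c W" for c W
    using inj_q slice_D(3)[OF that] by (simp add: tchart_def)
  show ?thesis
  proof (intro equalityI subsetI)
    fix C assume "C \<in> bun"
    then obtain T where T: "T \<in> tot" "C = (q ` cdom T, cmap T \<circ> inv_into (cdom T) q)"
      unfolding bundle_atlas_def quotient_atlas_def mem_Collect_eq by blast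
    then obtain c W where cW: "slice c W" "T = tchart c W"
      unfolding tot_eq by blast
    have "C = bchart c W"
      using T(2) unfolding cW(2) chart .
    then show "C \<in> {bchart c W | c W. slice c W}"
      using cW(1) by blast
  next
    fix C assume "C \<in> {bchart c W | c W. slice c W}"
    then obtain c W where cW: "slice c W" "C = bchart c W" by blast
    have "tchart c W \<in> tot" unfolding tot_eq using cW(1) by blast
    then show "C \<in> bun"
      unfolding bundle_atlas_def quotient_atlas_def mem_Collect_eq cW(2) chart
      using inj[OF cW(1)] by blast
  qed
qed

lemma bchart_dom: "cdom (bchart c W) = {y \<in> P. base y \<in> p ` W}"
proof (intro Set.set_eqI iffI)
  fix y assume "y \<in> {y \<in> P. base y \<in> p ` W}"
  then obtain m where "y = mk (p m) (fib y)" "m \<in> W" by (metis (mono_tags) imageE mem_Collect_eq mk_base_fib)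
  then have "y = q (m, sol_mult (D m) (fib y))" using mk_eq by metis
  then show "y \<in> cdom (bchart c W)" using \<open>m \<in> W\<close> by (auto simp: bchart_def)
qed (auto simp: bchart_def)

text \<open>Over the sheet \<open>W\<close> the class \<open>y\<close> has exactly one
  representative \<open>(m, h)\<close> with \<open>m\<close> in \<open>W\<close>. Its second entry
  \<open>h\<close> is the flat fibre coordinate, and it equals \<open>D m\<close> times
  \<open>fib y\<close>.\<close>

lemma bchart_map:
  assumes "slice c W" "y \<in> P" "base y \<in> p ` W"
  shows "cmap (bchart c W) y = (cmap c (base y), sol_mult (dev W (base y)) (fib y))"
proof -
  obtain m where m: "m \<in> W" "base y = p m" using assms by blast
  then have "y = q (m, sol_mult (D m) (fib y))"
    using mk_base_fib[OF assms(2)] mk_eq by metis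
  moreover have "inv_into (W \<times> UNIV) q (q (m, h)) = (m, h)" for h
    using m inj_q[OF slice_D(3)[OF assms(1)]] by (intro inv_into_f_f) auto
  moreover have "dev W (p m) = D m"
    using m slice_D(3)[OF assms(1)] by (simp add: dev_def sec_p)
  ultimately show ?thesis
    using m(2) unfolding bchart_def by (metis (no_types, lifting) case_prod_conv comp_apply id_apply snd_conv)
qed

lemma bchart_mk:
  "slice c W \<Longrightarrow> x \<in> p ` W \<Longrightarrow> cmap (bchart c W) (mk x k) = (cmap c x, sol_mult (dev W x) k)"
  by (simp add: bchart_map)

lemma bchart_image:
  assumes "slice c W" "X \<subseteq> p ` W"
  shows "cmap (bchart c W) ` {y \<in> P. base y \<in> X} = cmap c ` X \<times> (UNIV :: (real^3) set)"
proof (intro Set.set_eqI iffI)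
  fix z :: "(real^3) \<times> (real^3)" assume "z \<in> cmap c ` X \<times> UNIV"
  then obtain x h where z: "z = (cmap c x, h)" "x \<in> X" by auto
  then have "z = cmap (bchart c W) (mk x (sol_mult (sol_inv (dev W x)) h))"
    using assms by (subst bchart_mk) auto
  then show "z \<in> cmap (bchart c W) ` {y \<in> P. base y \<in> X}" using z by auto
qed (use assms in \<open>auto simp: bchart_map subset_iff\<close>)

lemma bchart_inj:
  assumes "slice c W"
  shows "inj_on (cmap (bchart c W)) (cdom (bchart c W))"
proof (rule inj_onI)
  fix y y' assume y: "y \<in> cdom (bchart c W)" "y' \<in> cdom (bchart c W)" "cmap (bchart c W) y = cmap (bchart c W) y'"
  then have "cmap c (base y) = cmap c (base y')" "sol_mult (dev W (base y)) (fib y) = sol_mult (dev W (base y')) (fib y')"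
    using assms by (auto simp: bchart_dom bchart_map)
  moreover have "base y \<in> cdom c" "base y' \<in> cdom c"
    using y slice_D(4)[OF assms] by (auto simp: bchart_dom)
  ultimately have "base y = base y'" "fib y = fib y'"
    using cinv_cmap[OF pre_A slice_D(1)[OF assms]] by (metis, metis sol_mult_left_cancel)
  then show "y = y'"
    using y mk_base_fib by (metis (no_types, lifting) bchart_dom mem_Collect_eq)
qed

lemma bchart_inv:
  assumes "slice c W" "x \<in> p ` W"
  shows "cinv (bchart c W) (cmap c x, h) = mk x (sol_mult (sol_inv (dev W x)) h)"
proof -
  let ?y = "mk x (sol_mult (sol_inv (dev W x)) h)"
  have "(cmap c x, h) = cmap (bchart c W) ?y" "?y \<in> cdom (bchart c W)"
    using assms by (simp_all add: bchart_mk bchart_dom)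
  then show ?thesis
    unfolding cinv_def using inv_into_f_f[OF bchart_inj[OF assms(1)]] by metis
qed

lemma bchart_transition:
  assumes "slice c W" "slice c' W'" "x \<in> p ` W" "x \<in> p ` W'"
  shows "(cmap (bchart c' W') \<circ> cinv (bchart c W)) (cmap c x, h) =
    (cmap c' x, sol_mult (dev W' x) (sol_mult (sol_inv (dev W x)) h))"
  using assms by (simp add: bchart_inv bchart_mk)

lemma bchart_overlap: "cdom (bchart c W) \<inter> cdom (bchart c' W') = {y \<in> P. base y \<in> p ` W \<inter> p ` W'}"
  by (auto simp: bchart_dom)

lemma pre_bun: "pre_atlas bun"
  unfolding pre_atlas_def
proof (intro conjI ballI)
  fix C assume "C \<in> bun"
  then obtain c W where C: "slice c W" "C = bchart c W" unfolding bun_eq by blast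
  show "inj_on (cmap C) (cdom C)" using bchart_inj C by simp
  fix C' assume "C' \<in> bun"
  then obtain c' W' where C': "slice c' W'" "C' = bchart c' W'" unfolding bun_eq by blast
  let ?X = "p ` W \<inter> p ` W'"
  have X: "?X \<subseteq> cdom c" "?X \<subseteq> cdom c'" "open ?X"
    using slice_D[OF C(1)] slice_D[OF C'(1)] by auto
  have im: "cmap C ` (cdom C \<inter> cdom C') = cmap c ` ?X \<times> UNIV"
    unfolding C C' bchart_overlap by (rule bchart_image[OF C(1)]) auto
  have oX: "open (cmap c ` ?X)"
    using open_chart_image[of c ?X] X slice_D(1)[OF C(1)] by (simp add: Int_absorb2)
  then have o: "open (cmap c ` ?X \<times> (UNIV :: (real^3) set))"
    by (intro open_Times) auto
  then show "open (cmap C ` (cdom C \<inter> cdom C'))" unfolding im .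
  have dW: "smooth_on (cmap c ` ?X) (dev W \<circ> cinv c)" "smooth_on (cmap c ` ?X) (dev W' \<circ> cinv c)"
    using smooth_dev[of c W] smooth_dev[of c W'] slice_D[OF C(1)] slice_D[OF C'(1)] X
    by (auto elim!: smooth_on_subset)
  have \<tau>: "smooth_on (cmap c ` ?X) (cmap c' \<circ> cinv c)"
    using smooth_transition[OF pre_A, of c c'] slice_D[OF C(1)] slice_D[OF C'(1)]
    by (auto elim!: smooth_on_subset)
  have fst: "smooth_on (cmap c ` ?X \<times> (UNIV :: (real^3) set)) (f \<circ> fst)" if "smooth_on (cmap c ` ?X) f" for f :: "real^3 \<Rightarrow> real^3"
    using smooth_on_compose[OF that smooth_on_fst[OF o smooth_on_id] _ o] by (auto simp: o_def)
  have "smooth_on (cmap c ` ?X \<times> UNIV) (\<lambda>z. (((cmap c' \<circ> cinv c) \<circ> fst) z,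
      sol_mult (((dev W' \<circ> cinv c) \<circ> fst) z) (sol_mult (sol_inv (((dev W \<circ> cinv c) \<circ> fst) z)) (snd z))))"
    by (intro smooth_on_Pair smooth_on_sol_mult smooth_on_sol_inv smooth_on_snd smooth_on_id o fst dW \<tau>)
  then show "smooth_on (cmap C ` (cdom C \<inter> cdom C')) (cmap C' \<circ> cinv C)"
    unfolding im
  proof (rule smooth_on_cong[OF o, rotated])
    fix z assume "z \<in> cmap c ` ?X \<times> (UNIV :: (real^3) set)"
    then obtain x h where z: "z = (cmap c x, h)" "x \<in> ?X" by auto
    then have "cinv c (cmap c x) = x"
      using X slice_D(1)[OF C(1)] by (auto simp: cinv_cmap[OF pre_A])
    then show "(((cmap c' \<circ> cinv c) \<circ> fst) z,
      sol_mult (((dev W' \<circ> cinv c) \<circ> fst) z) (sol_mult (sol_inv (((dev W \<circ> cinv c) \<circ> fst) z)) (snd z))) = (cmap C' \<circ> cinv C) z"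
      unfolding z(1) C(2) C'(2) bchart_transition[OF C(1) C'(1) IntD1[OF z(2)] IntD2[OF z(2)]] by simp
  qed
qed

lemma tchart_dom [simp]: "cdom (tchart c W) = W \<times> UNIV"
  by (simp add: tchart_def)

lemma tchart_map: "cmap (tchart c W) (m, h) = (cmap c (p m), h)"
  by (simp add: tchart_def)

lemma tchart_inj: "slice c W \<Longrightarrow> inj_on (cmap (tchart c W)) (cdom (tchart c W))"
proof (rule inj_onI)
  fix z z' assume s: "slice c W" and z: "z \<in> cdom (tchart c W)" "z' \<in> cdom (tchart c W)"
    "cmap (tchart c W) z = cmap (tchart c W) z'"
  obtain m h m' h' where mh: "z = (m, h)" "z' = (m', h')" by (metis surj_pair)
  then have "m \<in> W" "m' \<in> W" "cmap c (p m) = cmap c (p m')" "h = h'"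
    using z by (auto simp: tchart_map)
  then have "p m = p m'"
    using cinv_cmap[OF pre_A slice_D(1)[OF s]] slice_D(4)[OF s] by (metis image_subset_iff)
  then show "z = z'"
    using slice_D(3)[OF s] mh \<open>m \<in> W\<close> \<open>m' \<in> W\<close> \<open>h = h'\<close> by (auto simp: inj_on_def)
qed

lemma tchart_inv:
  assumes "slice c W" "m \<in> W"
  shows "cinv (tchart c W) (cmap c (p m), h) = (m, h)"
proof -
  have "(m, h) \<in> cdom (tchart c W)" using assms by simp
  from inv_into_f_f[OF tchart_inj[OF assms(1)] this] show ?thesis
    unfolding cinv_def tchart_map .
qed

lemma tchart_image: "X \<subseteq> W \<Longrightarrow> cmap (tchart c W) ` (X \<times> UNIV) = cmap c ` p ` X \<times> UNIV"
  by (force simp: tchart_map)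

lemma pre_tot: "pre_atlas tot"
  unfolding pre_atlas_def
proof (intro conjI ballI)
  fix C assume "C \<in> tot"
  then obtain c W where C: "slice c W" "C = tchart c W" unfolding tot_eq by blast
  show "inj_on (cmap C) (cdom C)" using tchart_inj C by simp
  fix C' assume "C' \<in> tot"
  then obtain c' W' where C': "slice c' W'" "C' = tchart c' W'" unfolding tot_eq by blast
  let ?X = "W \<inter> W'"
  have X: "p ` ?X \<subseteq> cdom c" "p ` ?X \<subseteq> cdom c'" "open (p ` ?X)"
    using slice_D[OF C(1)] slice_D[OF C'(1)] open_map_p[of ?X] by auto
  have "cdom C \<inter> cdom C' = ?X \<times> UNIV"
    using C C' by auto
  then have im: "cmap C ` (cdom C \<inter> cdom C') = cmap c ` p ` ?X \<times> UNIV"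
    unfolding C(2) by (simp add: tchart_image)
  have oX: "open (cmap c ` p ` ?X)"
    using open_chart_image[of c "p ` ?X"] X slice_D(1)[OF C(1)] by (simp add: Int_absorb2)
  then have o: "open (cmap c ` p ` ?X \<times> (UNIV :: (real^3) set))"
    by (intro open_Times) auto
  then show "open (cmap C ` (cdom C \<inter> cdom C'))" unfolding im .
  have \<tau>: "smooth_on (cmap c ` p ` ?X) (cmap c' \<circ> cinv c)"
    using smooth_transition[OF pre_A, of c c'] slice_D[OF C(1)] slice_D[OF C'(1)] X
    by (auto elim!: smooth_on_subset)
  have "smooth_on (cmap c ` p ` ?X \<times> (UNIV :: (real^3) set)) ((cmap c' \<circ> cinv c) \<circ> fst)"
    using smooth_on_compose[OF \<tau> smooth_on_fst[OF o smooth_on_id] _ o] by (auto simp: o_def)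
  then have "smooth_on (cmap c ` p ` ?X \<times> (UNIV :: (real^3) set)) (\<lambda>z. (((cmap c' \<circ> cinv c) \<circ> fst) z, snd z))"
    by (intro smooth_on_Pair smooth_on_snd smooth_on_id o)
  then show "smooth_on (cmap C ` (cdom C \<inter> cdom C')) (cmap C' \<circ> cinv C)"
    unfolding im
  proof (rule smooth_on_cong[OF o, rotated])
    fix z assume "z \<in> cmap c ` p ` ?X \<times> (UNIV :: (real^3) set)"
    then obtain m h where z: "z = (cmap c (p m), h)" "m \<in> W" "m \<in> W'" by auto
    then have "cinv c (cmap c (p m)) = p m"
      using X slice_D(1)[OF C(1)] by (auto simp: cinv_cmap[OF pre_A])
    then show "(((cmap c' \<circ> cinv c) \<circ> fst) z, snd z) = (cmap C' \<circ> cinv C) z"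
      unfolding z(1) C(2) C'(2) using z by (simp add: tchart_inv[OF C(1)] tchart_map)
  qed
qed

end

section \<open>Forms on the flat bundle\<close>

lemma dmult_maurer_cartan: "dmult h 0 0 (maurer_cartan h r) = r"
  by (simp add: vec_eq_iff forall_3 dmult_def exp_minus)

lemma dmult_nth3 [simp]: "dmult a a' b b' $ 3 = a' $ 3 + b' $ 3"
  by (simp add: dmult_def)

lemma maurer_cartan_0 [simp]: "maurer_cartan a 0 = 0"
  by (simp add: vec_eq_iff forall_3)

lemma sol_Ad_zero [simp]: "sol_Ad a 0 = 0"
  by (simp add: vec_eq_iff forall_3)

lemma smooth_on_sol_Ad:
  "open S \<Longrightarrow> smooth_on S f \<Longrightarrow> smooth_on S g \<Longrightarrow> smooth_on S (\<lambda>x. sol_Ad (f x) (g x))"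
  unfolding sol_Ad_eq by (intro smooth_intros)

lemma linear_sol_Ad: "linear (sol_Ad h)"
  by (rule linearI) (simp_all add: vec_eq_iff forall_3 algebra_simps)

context sol_manifold
begin

lemma bchart_in: "slice c W \<Longrightarrow> bchart c W \<in> bun"
  unfolding bun_eq by blast

lemma tchart_in: "slice c W \<Longrightarrow> tchart c W \<in> tot"
  unfolding tot_eq by blast

lemma bchart_mem: "y \<in> P \<Longrightarrow> base y \<in> p ` W \<Longrightarrow> y \<in> cdom (bchart c W)"
  by (simp add: bchart_dom)

lemma bchart_q: "slice c W \<Longrightarrow> m \<in> W \<Longrightarrow> cmap (bchart c W) (q (m, h)) = (cmap c (p m), h)"
  by (simp add: bchart_map dev_def sec_p slice_D(3))

lemma slice_at:
  obtains c W where "slice c W" "x \<in> p ` W"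
proof -
  obtain m where m: "p m = x" by (rule surj_p)
  obtain c where "c \<in> A" "x \<in> cdom c" by (rule chart_A)
  with m obtain W where "slice c W" "m \<in> W" using slice_exists by metis
  then show thesis using that m by blast
qed

text \<open>In the charts \<open>tchart c W\<close> and \<open>bchart c W\<close> the quotient map
  is the identity, so lifting a tangent vector keeps its coordinates.\<close>

lemma lift_vec_eq:
  assumes W: "slice c W" "m \<in> W" and v: "v \<in> tangent_space bun (q (m, h))"
  shows "lift_vec tot bun q (m, h) v = coord_vec tot (tchart c W) (m, h) (v (bchart c W))"
proof -
  let ?T = "tchart c W" and ?C = "bchart c W" and ?z = "(m, h)"
  let ?U = "cmap ?T ` cdom ?T"
  have T: "?T \<in> tot" "?z \<in> cdom ?T" and C: "?C \<in> bun" "q ?z \<in> cdom ?C"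
    using W by (auto simp: tchart_in bchart_in bchart_dom)
  have U: "open ?U" "cmap ?T ?z \<in> ?U"
    using open_image[OF pre_tot T(1)] T(2) by auto
  have U': "q (cinv ?T u) \<in> cdom ?C \<and> (cmap ?C \<circ> q \<circ> cinv ?T) u = u" if u: "u \<in> ?U" for u
  proof -
    obtain m' h' where "m' \<in> W" "u = cmap ?T (m', h')" using u by auto
    then show ?thesis
      using W by (simp add: tchart_map tchart_inv bchart_q bchart_dom)
  qed
  have D: "((cmap ?C \<circ> q \<circ> cinv ?T) has_derivative (\<lambda>x. x)) (at (cmap ?T ?z))"
    by (rule has_derivative_transform_within_open[OF has_derivative_ident U]) (use U' in auto)
  have diff: "diff_map tot bun q ?z u = coord_vec bun ?C (q ?z) (u ?T)" if "u \<in> tangent_space tot ?z" for u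
    using diff_map_eq[OF pre_tot pre_bun T C(1) U _ _ that, of q] U' D FD_eqI[OF D]
    by (auto simp: differentiable_def)
  show ?thesis
    unfolding lift_vec_def
  proof (rule the_equality)
    show "coord_vec tot ?T ?z (v ?C) \<in> tangent_space tot ?z \<and> diff_map tot bun q ?z (coord_vec tot ?T ?z (v ?C)) = v"
      using diff[OF coord_vec_tangent[OF pre_tot T]]
      by (simp add: coord_vec_tangent[OF pre_tot T] coord_vec_same[OF pre_tot T] tangent_coord[OF pre_bun v C])
  next
    fix u assume u: "u \<in> tangent_space tot ?z \<and> diff_map tot bun q ?z u = v"
    then have "v = coord_vec bun ?C (q ?z) (u ?T)"
      using diff[of u] by metis
    then have "v ?C = u ?T"
      by (simp add: coord_vec_same[OF pre_bun C])
    then show "u = coord_vec tot ?T ?z (v ?C)"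
      using tangent_coord[OF pre_tot _ T, of u] u by simp
  qed
qed

lemma snd_lift_vec:
  assumes W: "slice c W" "m \<in> W" and v: "v \<in> tangent_space bun (q (m, h))"
  shows "diff_fun tot snd (m, h) (lift_vec tot bun q (m, h) v) = snd (v (bchart c W))"
proof -
  let ?T = "tchart c W" and ?C = "bchart c W" and ?z = "(m, h)"
  let ?U = "cmap ?T ` cdom ?T"
  have T: "?T \<in> tot" "?z \<in> cdom ?T"
    using W by (auto simp: tchart_in)
  have U: "open ?U" "cmap ?T ?z \<in> ?U"
    using open_image[OF pre_tot T(1)] T(2) by auto
  have eq: "snd u = (snd \<circ> cinv ?T) u" if u: "u \<in> ?U" for u
  proof -
    obtain m' h' where "m' \<in> W" "u = cmap ?T (m', h')" using u by auto
    then show ?thesis using W by (simp add: tchart_map tchart_inv)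
  qed
  have D: "((snd \<circ> cinv ?T) has_derivative snd) (at (cmap ?T ?z))"
    by (rule has_derivative_transform_within_open[OF _ U eq])
      (auto intro: bounded_linear_imp_has_derivative bounded_linear_snd)
  have "(snd \<circ> cinv ?T) differentiable (at (cmap ?T ?z))"
    using D by (auto simp: differentiable_def)
  from diff_fun_eq[OF pre_tot T this coord_vec_tangent[OF pre_tot T]]
  show ?thesis
    by (simp add: lift_vec_eq[OF assms] FD_eqI[OF D] coord_vec_same[OF pre_tot T])
qed

text \<open>Flatness of the bundle: near the point both branches of the developing map are left
  translates \<open>k b\<close> and \<open>k' b\<close> of the same Sol chart, so the fibre
  coordinates differ by left multiplication with the constant \<open>k'\<close> times the inverse of
  \<open>k\<close>.\<close>

lemma bchart_change:
  assumes W: "slice c W" "slice c' W'" and y: "y \<in> P" "base y \<in> p ` W" "base y \<in> p ` W'"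
  obtains g where "snd (cmap (bchart c' W') y) = sol_mult g (snd (cmap (bchart c W) y))"
    "\<forall>v\<in>tangent_space bun y.
      snd (v (bchart c' W')) = dmult g 0 (snd (cmap (bchart c W) y)) (snd (v (bchart c W)))"
proof -
  let ?C = "bchart c W" and ?C' = "bchart c' W'"
  let ?x = "base y"
  obtain b where b: "b \<in> B" "?x \<in> cdom b" by (rule chart_B)
  obtain N k where N: "open N" "?x \<in> N" "N \<subseteq> p ` W \<inter> cdom b" "\<forall>x'\<in>N. dev W x' = sol_mult k (cmap b x')"
    by (rule dev_local[OF slice_D(2,3)[OF W(1)] y(2) b])
  obtain N' k' where N': "open N'" "?x \<in> N'" "N' \<subseteq> p ` W' \<inter> cdom b" "\<forall>x'\<in>N'. dev W' x' = sol_mult k' (cmap b x')"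
    by (rule dev_local[OF slice_D(2,3)[OF W(2)] y(3) b])
  define g where "g = sol_mult k' (sol_inv k)"
  have g: "sol_mult (dev W' x) (sol_mult (sol_inv (dev W x)) h) = sol_mult g h" if "x \<in> N \<inter> N'" for x h
    using that N(4) N'(4) by (simp add: g_def sol_inv_mult sol_mult_assoc)
  have C: "?C \<in> bun" "y \<in> cdom ?C" and C': "?C' \<in> bun" "y \<in> cdom ?C'"
    using assms by (simp_all add: bchart_in bchart_mem)
  let ?z = "cmap ?C y"
  have z: "?z = (cmap c ?x, sol_mult (dev W ?x) (fib y))"
    using bchart_map[OF W(1) y(1,2)] .
  have 1: "snd (cmap ?C' y) = sol_mult g (snd ?z)"
    using g[of ?x "sol_mult (dev W ?x) (fib y)"] N(2) N'(2) by (simp add: bchart_map W y)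
  let ?O = "cmap c ` (N \<inter> N' \<inter> cdom c) \<times> (UNIV :: (real^3) set)"
  have O: "open ?O"
    using open_chart_image[of c "N \<inter> N'"] slice_D(1)[OF W(1)] N N' by (intro open_Times) auto
  have zO: "?z \<in> ?O"
    using z N(2) N'(2) slice_D(6)[OF W(1) y(2)] by auto
  have eq: "(snd \<circ> (cmap ?C' \<circ> cinv ?C)) t = sol_mult g (snd t)" if tO: "t \<in> ?O" for t
  proof -
    obtain x h where t: "t = (cmap c x, h)" "x \<in> N \<inter> N'" using tO by auto
    then have "x \<in> p ` W" "x \<in> p ` W'" using N(3) N'(3) by auto
    then show ?thesis
      using bchart_transition[OF W, of x h] t g[OF t(2), of h] by simp
  qed
  have d: "(cmap ?C' \<circ> cinv ?C) differentiable (at ?z)"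
    by (rule transition_differentiable[OF pre_bun C(1) C'(1) C(2) C'(2)])
  have D1: "((snd \<circ> (cmap ?C' \<circ> cinv ?C)) has_derivative (\<lambda>w. snd (FD (cmap ?C' \<circ> cinv ?C) ?z w))) (at ?z)"
    unfolding o_def[of snd] by (rule bounded_linear.has_derivative[OF bounded_linear_snd FD_has_derivative[OF d]])
  have "((\<lambda>t. sol_mult g (snd t)) has_derivative (\<lambda>w. dmult g 0 (snd ?z) (snd w))) (at ?z)"
    by (intro has_derivative_sol_mult has_derivative_const bounded_linear_imp_has_derivative bounded_linear_snd)
  then have D2: "((snd \<circ> (cmap ?C' \<circ> cinv ?C)) has_derivative (\<lambda>w. dmult g 0 (snd ?z) (snd w))) (at ?z)"
    by (rule has_derivative_transform_within_open[OF _ O zO]) (rule eq[symmetric])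
  have 2: "snd (FD (cmap ?C' \<circ> cinv ?C) ?z w) = dmult g 0 (snd ?z) (snd w)" for w
    by (rule fun_cong[OF has_derivative_unique[OF D1 D2]])
  show thesis
  proof (rule that[OF 1], rule ballI)
    fix v assume "v \<in> tangent_space bun y"
    then show "snd (v ?C') = dmult g 0 (snd ?z) (snd (v ?C))"
      using tangent_apply[OF pre_bun _ C C', of v] 2 by simp
  qed
qed

text \<open>The descended forms are evaluated at whatever representative \<open>SOME\<close> picks;
  a slice through that representative makes the value visible in a bundle chart.\<close>

lemma descend_chart:
  assumes "y \<in> P"
  obtains z c W where "(SOME z. q z = y) = z" "q z = y" "slice c W" "base y \<in> p ` W"
    "snd (cmap (bchart c W) y) = snd z"
    "\<forall>v\<in>tangent_space bun y. diff_fun tot snd z (lift_vec tot bun q z v) = snd (v (bchart c W))"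
proof -
  obtain m h where mh: "(SOME z. q z = y) = (m, h)" by (metis surj_pair)
  have "\<exists>z. q z = y" using assms by (auto simp: flat_bundle_def)
  then have qz: "q (m, h) = y" using mh someI_ex[of "\<lambda>z. q z = y"] by simp
  obtain c where "c \<in> A" "p m \<in> cdom c" by (rule chart_A)
  then obtain W where W: "slice c W" "m \<in> W" using slice_exists by metis
  show thesis
  proof (rule that[OF mh qz W(1)])
    show "base y \<in> p ` W" using qz W(2) by auto
    show "snd (cmap (bchart c W) y) = snd (m, h)" using bchart_q[OF W, of h] qz by simp
    show "\<forall>v\<in>tangent_space bun y. diff_fun tot snd (m, h) (lift_vec tot bun q (m, h) v) = snd (v (bchart c W))"
      using snd_lift_vec[OF W, of _ h] qz by simp
  qed
qed

abbreviation "flat \<equiv> flat_connection A p m\<^sub>0 \<rho>"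
abbreviation "vol \<equiv> bundle_vol A p m\<^sub>0 \<rho>"

text \<open>By \<open>bchart_change\<close> the given chart and the chart of the chosen
  representative differ by a left translation, under which the Maurer--Cartan form is
  invariant.\<close>

lemma flat_eq:
  assumes W: "slice c W" and y: "y \<in> P" "base y \<in> p ` W" and v: "v \<in> tangent_space bun y"
  shows "flat y v = maurer_cartan (snd (cmap (bchart c W) y)) (snd (v (bchart c W)))"
proof -
  obtain z c' W' where z: "(SOME z. q z = y) = z" "q z = y" "slice c' W'" "base y \<in> p ` W'"
    "snd (cmap (bchart c' W') y) = snd z"
    "\<forall>v\<in>tangent_space bun y. diff_fun tot snd z (lift_vec tot bun q z v) = snd (v (bchart c' W'))"
    by (rule descend_chart[OF y(1)])
  obtain g where g: "snd (cmap (bchart c' W') y) = sol_mult g (snd (cmap (bchart c W) y))"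
    "\<forall>v\<in>tangent_space bun y.
      snd (v (bchart c' W')) = dmult g 0 (snd (cmap (bchart c W) y)) (snd (v (bchart c W)))"
    by (rule bchart_change[OF W z(3) y z(4)])
  have "flat y v = maurer_cartan (snd z) (snd (v (bchart c' W')))"
    unfolding flat_connection_def descend1_def Let_def z(1) using bspec[OF z(6) v] by simp
  then show ?thesis
    unfolding z(5)[symmetric] g(1) bspec[OF g(2) v] maurer_cartan_left .
qed

lemma vol_eq:
  assumes W: "slice c W" and y: "y \<in> P" "base y \<in> p ` W"
    and u: "u \<in> tangent_space bun y" and v: "v \<in> tangent_space bun y" and w: "w \<in> tangent_space bun y"
  shows "vol y u v w = det (vector [snd (u (bchart c W)), snd (v (bchart c W)), snd (w (bchart c W))] :: real^3^3)"
proof -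
  obtain z c' W' where z: "(SOME z. q z = y) = z" "q z = y" "slice c' W'" "base y \<in> p ` W'"
    "snd (cmap (bchart c' W') y) = snd z"
    "\<forall>v\<in>tangent_space bun y. diff_fun tot snd z (lift_vec tot bun q z v) = snd (v (bchart c' W'))"
    by (rule descend_chart[OF y(1)])
  obtain g where g: "snd (cmap (bchart c' W') y) = sol_mult g (snd (cmap (bchart c W) y))"
    "\<forall>v\<in>tangent_space bun y.
      snd (v (bchart c' W')) = dmult g 0 (snd (cmap (bchart c W) y)) (snd (v (bchart c W)))"
    by (rule bchart_change[OF W z(3) y z(4)])
  have "vol y u v w = sol_vol (snd z) (snd (u (bchart c' W'))) (snd (v (bchart c' W'))) (snd (w (bchart c' W')))"
    unfolding bundle_vol_def descend3_def Let_def z(1) using bspec[OF z(6) u] bspec[OF z(6) v] bspec[OF z(6) w] by simp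
  then show ?thesis
    unfolding z(5)[symmetric] g(1) bspec[OF g(2) u] bspec[OF g(2) v] bspec[OF g(2) w] sol_vol_dmult
    unfolding sol_vol_det .
qed

lemma smooth_flat: "smooth_form1 bun flat"
  unfolding smooth_form1_def
proof (intro ballI conjI allI)
  fix C assume "C \<in> bun"
  then obtain c W where C: "slice c W" "C = bchart c W" unfolding bun_eq by blast
  note Cb = bchart_in[OF C(1)]
  have eq: "flat y (coord_vec bun C y e) = maurer_cartan (snd (cmap C y)) (snd e)" if "y \<in> cdom C" for y and e :: "(real^3) \<times> (real^3)"
    using that flat_eq[OF C(1), of y "coord_vec bun C y e"] coord_vec_tangent[OF pre_bun Cb, of y e]
      coord_vec_same[OF pre_bun Cb, of y e]
    unfolding C(2) by (simp add: bchart_dom)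
  {
    fix y assume "y \<in> cdom C"
    then show "linear (\<lambda>e. flat y (coord_vec bun C y e))"
      by (simp add: eq linear_iff vec_eq_iff forall_3 algebra_simps)
  next
    fix e :: "(real^3) \<times> (real^3)"
    have o: "open (cmap C ` cdom C)" using open_image[OF pre_bun] Cb C(2) by simp
    have "smooth_on (cmap C ` cdom C) (\<lambda>z. maurer_cartan (snd z) (snd e))"
      by (intro smooth_on_maurer_cartan smooth_on_snd smooth_on_id smooth_on_const o)
    then show "smooth_on (cmap C ` cdom C) (\<lambda>z. flat (cinv C z) (coord_vec bun C (cinv C z) e))"
      by (rule smooth_on_cong[OF o, rotated]) (simp add: eq cinv_in[OF pre_bun] cmap_cinv[OF pre_bun])
  }
qed

section \<open>Sections\<close>

lemma section_D:
  assumes "smooth_section A p m\<^sub>0 \<rho> s"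
  shows "s x \<in> P" "base (s x) = x"
  using assms by (auto simp: smooth_section_def)

text \<open>\<open>smooth_map\<close> provides only one pair of charts around each point. There
  \<open>fib\<close> is the inverse of the smooth \<open>dev W\<close> times the second bundle
  coordinate, and the result is then carried over to an arbitrary chart.\<close>

lemma section_fib_smooth:
  assumes s: "smooth_section A p m\<^sub>0 \<rho> s"
  shows "smooth_fun A (\<lambda>x. fib (s x))"
  unfolding smooth_fun_def
proof (intro ballI smooth_on_local)
  fix c u assume c: "c \<in> A" and "u \<in> cmap c ` cdom c"
  then obtain x where x: "u = cmap c x" "x \<in> cdom c" by blast
  obtain c1 C N where c1: "c1 \<in> A" and "C \<in> bun" and N: "x \<in> N" "N \<subseteq> cdom c1" "open (cmap c1 ` N)" "s ` N \<subseteq> cdom C"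
    and sm: "smooth_on (cmap c1 ` N) (cmap C \<circ> s \<circ> cinv c1)"
    using s unfolding smooth_section_def smooth_map_def by blast
  then obtain c' W where C: "slice c' W" "C = bchart c' W" unfolding bun_eq by blast
  have NW: "N \<subseteq> p ` W"
    using N(4) section_D[OF s] unfolding C(2) bchart_dom by auto
  let ?V = "cmap c1 ` N"
  have "smooth_on ?V (dev W \<circ> cinv c1)"
    by (rule smooth_on_subset[OF smooth_dev[OF c1 slice_D(2,3)[OF C(1)]]]) (use N(2) NW in auto)
  then have "smooth_on ?V (\<lambda>u. sol_mult (sol_inv ((dev W \<circ> cinv c1) u)) (snd ((cmap C \<circ> s \<circ> cinv c1) u)))"
    by (intro smooth_on_sol_mult smooth_on_sol_inv smooth_on_snd sm N(3))
  then have sm1: "smooth_on ?V ((\<lambda>x. fib (s x)) \<circ> cinv c1)"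
  proof (rule smooth_on_cong[OF N(3), rotated])
    fix v assume "v \<in> ?V"
    then obtain x' where "v = cmap c1 x'" "x' \<in> N" by blast
    then show "sol_mult (sol_inv ((dev W \<circ> cinv c1) v)) (snd ((cmap C \<circ> s \<circ> cinv c1) v)) = ((\<lambda>x. fib (s x)) \<circ> cinv c1) v"
      using N(2) NW c1 section_D[OF s] C by (auto simp: cinv_cmap[OF pre_A] bchart_map subset_iff)
  qed
  \<comment> \<open>\<open>smooth_map\<close> only says that the coordinate image of
    \<open>N\<close> is open; openness of \<open>N\<close> in the manifold follows because
    \<open>N\<close> is the preimage of that image.\<close>
  have "N = cdom c1 \<inter> cmap c1 -` ?V"
    using N(2) cinv_cmap[OF pre_A c1] by (auto simp: subset_iff) metis
  then have "open N"
    using continuous_open_preimage[OF oriented_atlas_chart(2)[OF oriented_A c1] oriented_atlas_chart(1)[OF oriented_A c1] N(3)]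
    by simp
  let ?O = "cmap c ` (N \<inter> cdom c)"
  have O: "open ?O" using c \<open>open N\<close> by (intro open_chart_image) auto
  have "smooth_on ?O (cmap c1 \<circ> cinv c)"
    by (rule smooth_on_subset[OF smooth_transition[OF pre_A c c1]]) (use N(2) in auto)
  moreover have "(cmap c1 \<circ> cinv c) ` ?O \<subseteq> ?V"
    using c by (auto simp: cinv_cmap[OF pre_A])
  ultimately have "smooth_on ?O (((\<lambda>x. fib (s x)) \<circ> cinv c1) \<circ> (cmap c1 \<circ> cinv c))"
    by (intro smooth_on_compose[OF sm1] O)
  then have "smooth_on ?O ((\<lambda>x. fib (s x)) \<circ> cinv c)"
    by (rule smooth_on_cong[OF O, rotated]) (use N(2) c c1 in \<open>auto simp: cinv_cmap[OF pre_A]\<close>)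
  then show "\<exists>N. open N \<and> u \<in> N \<and> smooth_on N ((\<lambda>x. fib (s x)) \<circ> cinv c)"
    using O x N(1) by blast
qed

text \<open>The value over \<open>p m\<close> is the class of \<open>(m, D m)\<close>. In bundle
  charts the section is the graph of a branch of the developing map.\<close>

lemma developing_section: "smooth_section A p m\<^sub>0 \<rho> (\<lambda>x. mk x 0)"
  unfolding smooth_section_def smooth_map_def
proof (intro conjI allI)
  fix x
  show "mk x 0 \<in> P" "base (mk x 0) = x" by simp_all
  obtain c W where W: "slice c W" "x \<in> p ` W" by (rule slice_at)
  note sl = slice_D[OF W(1)]
  have o: "open (cmap c ` p ` W)"
    using open_chart_image[of c "p ` W"] sl by (simp add: Int_absorb2)
  have "smooth_on (cmap c ` p ` W) (\<lambda>u. (u, (dev W \<circ> cinv c) u))"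
    by (intro smooth_on_Pair smooth_on_id smooth_dev_slice W o)
  then have "smooth_on (cmap c ` p ` W) (cmap (bchart c W) \<circ> (\<lambda>x. mk x 0) \<circ> cinv c)"
    by (rule smooth_on_cong[OF o, rotated]) (use sl in \<open>auto simp: cinv_cmap[OF pre_A] bchart_mk[OF W(1)]\<close>)
  then show "\<exists>c\<in>A. \<exists>C\<in>bun. \<exists>N. x \<in> N \<and> N \<subseteq> cdom c \<and> open (cmap c ` N) \<and> (\<lambda>x. mk x 0) ` N \<subseteq> cdom C \<and>
     smooth_on (cmap c ` N) (cmap C \<circ> (\<lambda>x. mk x 0) \<circ> cinv c)"
    using W sl(1,4) o bchart_in[OF W(1)]
    by (intro bexI[of _ c] bexI[of _ "bchart c W"] exI[of _ "p ` W"]) (auto simp: bchart_dom)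
qed

text \<open>The fibre coordinate of the section over the sheet \<open>W\<close>: a local map into
  Sol, which another sheet changes by a locally constant left factor.\<close>

definition secF :: "('a \<Rightarrow> ('b \<times> (real^3)) set) \<Rightarrow> ('a, real^3) chart \<Rightarrow> 'b set \<Rightarrow> real^3 \<Rightarrow> real^3" where
  "secF s c W u = sol_mult (dev W (cinv c u)) (fib (s (cinv c u)))"

end

locale sol_section = sol_manifold +
  fixes s
  assumes s: "smooth_section A p m\<^sub>0 \<rho> s"
begin

lemma open_slice: "slice c W \<Longrightarrow> open (cmap c ` p ` W)"
  using open_chart_image[of c "p ` W"] slice_D[of c W] by (simp add: Int_absorb2)

lemma smooth_secF:
  assumes W: "slice c W"
  shows "smooth_on (cmap c ` p ` W) (secF s c W)"
proof -
  have "smooth_on (cmap c ` p ` W) ((\<lambda>x. fib (s x)) \<circ> cinv c)"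
    by (rule smooth_on_subset[OF smooth_fun_chart[OF section_fib_smooth[OF s] slice_D(1)[OF W]]])
      (use slice_D(4)[OF W] in auto)
  then show ?thesis
    using smooth_on_sol_mult[OF open_slice[OF W] smooth_dev_slice[OF W]]
    by (simp add: secF_def[abs_def] o_def)
qed

lemma secF_chart:
  assumes W: "slice c W" and x: "x \<in> p ` W"
  shows "cmap (bchart c W) (s x) = (cmap c x, secF s c W (cmap c x))"
  using x section_D[OF s] slice_D[OF W] by (simp add: bchart_map[OF W] secF_def cinv_cmap[OF pre_A])

lemma section_push:
  assumes W: "slice c W" and x: "x \<in> p ` W" and v: "v \<in> tangent_space A x"
  shows "diff_map A bun s x v = coord_vec bun (bchart c W) (s x) (v c, FD (secF s c W) (cmap c x) (v c))"
proof -
  let ?C = "bchart c W"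
  let ?U = "cmap c ` p ` W"
  note sl = slice_D[OF W]
  have xc: "x \<in> cdom c" and U: "open ?U" "cmap c x \<in> ?U"
    using x sl open_slice[OF W] by auto
  have inC: "s (cinv c u) \<in> cdom ?C" and eq: "(u, secF s c W u) = (cmap ?C \<circ> s \<circ> cinv c) u" if u: "u \<in> ?U" for u
  proof -
    obtain x' where "u = cmap c x'" "x' \<in> p ` W" using u by blast
    then show "s (cinv c u) \<in> cdom ?C" "(u, secF s c W u) = (cmap ?C \<circ> s \<circ> cinv c) u"
      using sl section_D[OF s] by (simp_all add: cinv_cmap[OF pre_A] bchart_dom secF_chart[OF W])
  qed
  have "secF s c W differentiable (at (cmap c x))"
    using smooth_on_differentiable[OF smooth_secF[OF W] U(2)] .
  then have "((\<lambda>u. (u, secF s c W u)) has_derivative (\<lambda>e. (e, FD (secF s c W) (cmap c x) e))) (at (cmap c x))"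
    by (intro has_derivative_Pair has_derivative_ident FD_has_derivative)
  then have D: "((cmap ?C \<circ> s \<circ> cinv c) has_derivative (\<lambda>e. (e, FD (secF s c W) (cmap c x) e))) (at (cmap c x))"
    by (rule has_derivative_transform_within_open[OF _ U]) (rule eq)
  have d: "(cmap ?C \<circ> s \<circ> cinv c) differentiable (at (cmap c x))"
    using D by (auto simp: differentiable_def)
  show ?thesis
    using diff_map_eq[OF pre_A pre_bun sl(1) xc bchart_in[OF W] U inC d v] by (simp add: FD_eqI[OF D])
qed

lemma section_push_tangent:
  assumes W: "slice c W" and x: "x \<in> p ` W" and v: "v \<in> tangent_space A x"
  shows "diff_map A bun s x v \<in> tangent_space bun (s x)"
    and "diff_map A bun s x v (bchart c W) = (v c, FD (secF s c W) (cmap c x) (v c))"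
  unfolding section_push[OF assms] using W x section_D[OF s]
  by (simp_all add: bchart_in bchart_mem coord_vec_tangent[OF pre_bun] coord_vec_same[OF pre_bun])

text \<open>The triple (\<alpha>, \<beta>, \<gamma>) of the section, evaluated at the coordinate
  vector \<open>e\<close>.\<close>

definition mcF :: "('a, real^3) chart \<Rightarrow> 'b set \<Rightarrow> real^3 \<Rightarrow> real^3 \<Rightarrow> real^3" where
  "mcF c W u e = maurer_cartan (secF s c W u) (FD (secF s c W) u e)"

lemma pullback_flat:
  assumes W: "slice c W" and x: "x \<in> p ` W" and v: "v \<in> tangent_space A x"
  shows "pullback1 A bun s flat x v = mcF c W (cmap c x) (v c)"
  unfolding pullback1_def mcF_def
  using flat_eq[OF W _ _ section_push_tangent(1)[OF assms]] section_push_tangent(2)[OF assms] section_D[OF s] x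
  by (simp add: secF_chart[OF W x])

lemma pullback_vol:
  assumes W: "slice c W" and x: "x \<in> p ` W"
    and t: "u \<in> tangent_space A x" "v \<in> tangent_space A x" "w \<in> tangent_space A x"
  shows "pullback3 A bun s vol x u v w =
    det (vector [FD (secF s c W) (cmap c x) (u c), FD (secF s c W) (cmap c x) (v c), FD (secF s c W) (cmap c x) (w c)] :: real^3^3)"
  unfolding pullback3_def
  using vol_eq[OF W _ _ section_push_tangent(1)[OF W x t(1)] section_push_tangent(1)[OF W x t(2)] section_push_tangent(1)[OF W x t(3)]]
    section_push_tangent(2)[OF W x t(1)] section_push_tangent(2)[OF W x t(2)] section_push_tangent(2)[OF W x t(3)]
    section_D[OF s] x
  by simp

end

section \<open>The connection of a section and the Chern--Simons form\<close>

lemma FD_FD_symmetric: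
  fixes F :: "real^'m \<Rightarrow> real^'n"
  assumes U: "open U" "u \<in> U" and F: "smooth_on U F"
  shows "FD (\<lambda>u. FD F u e) u d = FD (\<lambda>u. FD F u d) u e"
proof -
  have dF: "F differentiable (at y)" if "y \<in> U" for y
    using smooth_on_differentiable[OF F that] .
  have comp: "FD (\<lambda>u. FD F u e) u d $ i = FD (\<lambda>u. FD (\<lambda>y. F y $ i) u e) u d" for e d i
  proof -
    have "(\<lambda>u. FD F u e) differentiable (at u)"
      by (rule smooth_on_differentiable[OF smooth_on_FD[OF F] U(2)])
    then have "FD (\<lambda>u. FD F u e) u d $ i = FD (\<lambda>u. FD F u e $ i) u d"
      by (rule FD_nth[symmetric])
    also have "FD (\<lambda>u. FD F u e $ i) u = FD (\<lambda>u. FD (\<lambda>y. F y $ i) u e) u"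
      by (rule FD_cong[OF U]) (simp add: FD_nth dF)
    finally show ?thesis .
  qed
  have "Ck_on (Suc (Suc 0)) U (\<lambda>y. F y $ i)" for i
    using smooth_on_nth[OF U(1) F, of i] by (simp add: smooth_on_def del: Ck_on.simps)
  then show ?thesis
    by (simp add: vec_eq_iff comp FD_symmetric[OF U])
qed

text \<open>\<open>\<alpha> + \<beta> - \<gamma>\<close> for the pullback \<open>\<alpha> X + \<beta> Y + \<gamma> Z\<close> of the Maurer--Cartan form by \<open>F\<close>: the only
  component of \<open>\<omega>\<^sup>s - \<omega>\<^sub>\<rho>\<close> seen by the bilinear form.\<close>

definition kap :: "(real^3 \<Rightarrow> real^3) \<Rightarrow> real^3 \<Rightarrow> real^3 \<Rightarrow> real" where
  "kap F e u = exp (F u $ 3) * FD F u e $ 1 + exp (- F u $ 3) * FD F u e $ 2 - FD F u e $ 3"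

lemma smooth_kap: "open U \<Longrightarrow> smooth_on U F \<Longrightarrow> smooth_on U (kap F e)"
  unfolding kap_def[abs_def] by (intro smooth_intros)

text \<open>By the structure equations, \<open>d(\<alpha> + \<beta> - \<gamma>) = \<gamma> \<and> (\<alpha> - \<beta>)\<close>.\<close>

lemma kap_exterior_derivative:
  assumes U: "open U" "u \<in> U" and F: "smooth_on U F"
  shows "FD (kap F e) u d - FD (kap F d) u e =
    exp (F u $ 3) * (FD F u d $ 3 * FD F u e $ 1 - FD F u e $ 3 * FD F u d $ 1)
    - exp (- F u $ 3) * (FD F u d $ 3 * FD F u e $ 2 - FD F u e $ 3 * FD F u d $ 2)"
proof -
  have D: "FD (kap F e) u d =
      exp (F u $ 3) * FD (\<lambda>u. FD F u e) u d $ 1 + exp (F u $ 3) * FD F u d $ 3 * FD F u e $ 1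
      + (exp (- F u $ 3) * FD (\<lambda>u. FD F u e) u d $ 2 - exp (- F u $ 3) * FD F u d $ 3 * FD F u e $ 2)
      - FD (\<lambda>u. FD F u e) u d $ 3" for e d
  proof -
    have dF: "(F has_derivative FD F u) (at u)"
      using smooth_on_differentiable[OF F U(2)] by (rule FD_has_derivative)
    have dG: "((\<lambda>u. FD F u e) has_derivative FD (\<lambda>u. FD F u e) u) (at u)"
      using smooth_on_differentiable[OF smooth_on_FD[OF F] U(2)] by (rule FD_has_derivative)
    note f = has_derivative_nth[OF dF] and g = has_derivative_nth[OF dG]
    have "(kap F e has_derivative (\<lambda>d.
        exp (F u $ 3) * FD (\<lambda>u. FD F u e) u d $ 1 + exp (F u $ 3) * FD F u d $ 3 * FD F u e $ 1
      + (exp (- F u $ 3) * FD (\<lambda>u. FD F u e) u d $ 2 - exp (- F u $ 3) * FD F u d $ 3 * FD F u e $ 2)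
      - FD (\<lambda>u. FD F u e) u d $ 3)) (at u)"
      unfolding kap_def[abs_def]
      by (rule has_derivative_eq_rhs[OF has_derivative_diff[OF has_derivative_add[OF
          has_derivative_mult[OF has_derivative_exp[OF f] g]
          has_derivative_mult[OF has_derivative_exp[OF has_derivative_minus[OF f]] g]] g]])
        (simp add: fun_eq_iff algebra_simps)
    then show ?thesis by (simp add: FD_eqI)
  qed
  show ?thesis
    unfolding D FD_FD_symmetric[OF U F, of e d] by (simp add: algebra_simps)
qed

text \<open>This is \<kappa> \<and> d\<kappa> = 2 \<alpha> \<and> \<beta> \<and> \<gamma> for
  \<kappa> = \<alpha> + \<beta> - \<gamma>, evaluated on three vectors. \<open>a\<close>,
  \<open>b\<close>, \<open>c\<close> are the derivatives of the local map in these directions, and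
  \<open>E\<close>, \<open>E'\<close> are the exponentials of its third coordinate and of the
  negative.\<close>

lemma wedge_identity:
  fixes a b c :: "real^3"
  assumes "E * E' = 1"
  shows "((E * a$1 + E' * a$2 - a$3) * (E * (b$3 * c$1 - c$3 * b$1) - E' * (b$3 * c$2 - c$3 * b$2))
    - (E * b$1 + E' * b$2 - b$3) * (E * (a$3 * c$1 - c$3 * a$1) - E' * (a$3 * c$2 - c$3 * a$2))
    + (E * c$1 + E' * c$2 - c$3) * (E * (a$3 * b$1 - b$3 * a$1) - E' * (a$3 * b$2 - b$3 * a$2))) / 2
    = det (vector [a, b, c] :: real^3^3)"
proof -
  have "((E * a$1 + E' * a$2 - a$3) * (E * (b$3 * c$1 - c$3 * b$1) - E' * (b$3 * c$2 - c$3 * b$2))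
    - (E * b$1 + E' * b$2 - b$3) * (E * (a$3 * c$1 - c$3 * a$1) - E' * (a$3 * c$2 - c$3 * a$2))
    + (E * c$1 + E' * c$2 - c$3) * (E * (a$3 * b$1 - b$3 * a$1) - E' * (a$3 * b$2 - b$3 * a$2)))
    = 2 * (E * E') * det (vector [a, b, c] :: real^3^3)"
    by (simp add: det_3 algebra_simps)
  then show ?thesis using assms by simp
qed

lemma smooth_form1_D:
  "smooth_form1 A \<omega> \<Longrightarrow> c \<in> A \<Longrightarrow>
   smooth_on (cmap c ` cdom c) (\<lambda>u. \<omega> (cinv c u) (coord_vec A c (cinv c u) e))"
  unfolding smooth_form1_def by blast

context sol_section
begin

section \<open>Existence of the connection attached to a section\<close>

lemma linear_mcF:
  assumes "slice c W" "u \<in> cmap c ` p ` W"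
  shows "linear (mcF c W u)"
  unfolding mcF_def[abs_def]
  using linear_compose[OF FD_linear[OF smooth_on_differentiable[OF smooth_secF[OF assms(1)] assms(2)]] linear_maurer_cartan]
  by (simp add: o_def)

lemma base_push:
  assumes W: "slice c W" and y: "y \<in> P" "base y \<in> p ` W" and v: "v \<in> tangent_space bun y"
  shows "diff_map bun A base y v = coord_vec A c (base y) (fst (v (bchart c W)))"
proof -
  let ?C = "bchart c W"
  have C: "?C \<in> bun" "y \<in> cdom ?C" using W y by (simp_all add: bchart_in bchart_mem)
  let ?U = "cmap ?C ` cdom ?C"
  have U: "open ?U" "cmap ?C y \<in> ?U" using open_image[OF pre_bun C(1)] C(2) by auto
  have mem: "base (cinv ?C t) \<in> cdom c" and eq: "fst t = (cmap c \<circ> base \<circ> cinv ?C) t" if t: "t \<in> ?U" for t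
  proof -
    obtain y' where y': "t = cmap ?C y'" "y' \<in> P" "base y' \<in> p ` W"
      using t by (auto simp: bchart_dom)
    then have "cinv ?C t = y'"
      using cinv_cmap[OF pre_bun C(1) bchart_mem] by simp
    then show "base (cinv ?C t) \<in> cdom c" "fst t = (cmap c \<circ> base \<circ> cinv ?C) t"
      using slice_D(6)[OF W] y' by (simp_all add: bchart_map[OF W])
  qed
  have D: "((cmap c \<circ> base \<circ> cinv ?C) has_derivative fst) (at (cmap ?C y))"
    by (rule has_derivative_transform_within_open[OF bounded_linear_imp_has_derivative[OF bounded_linear_fst] U])
      (rule eq)
  then have d: "(cmap c \<circ> base \<circ> cinv ?C) differentiable (at (cmap ?C y))"
    by (auto simp: differentiable_def)
  show ?thesis
    using diff_map_eq[OF pre_bun pre_A C slice_D(1)[OF W] U mem d v] by (simp add: FD_eqI[OF D])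
qed

definition twist :: "real^3 \<Rightarrow> real^3" where
  "twist t = (t $ 1 + t $ 2) *\<^sub>R axis 3 1 - t"

lemma twist_nth [simp]: "twist t $ 1 = - t $ 1" "twist t $ 2 = - t $ 2" "twist t $ 3 = t $ 1 + t $ 2 - t $ 3"
  by (simp_all add: twist_def axis_def)

lemma linear_twist: "linear twist"
  by (rule linearI) (simp_all add: vec_eq_iff forall_3 algebra_simps)

lemma smooth_twist: "open S \<Longrightarrow> smooth_on S f \<Longrightarrow> smooth_on S (\<lambda>x. twist (f x))"
  unfolding twist_def by (intro smooth_intros)

text \<open>\<open>y = s x \<cdot> k\<close> with \<open>k\<^sup>-\<^sup>1 = (fib y)\<^sup>-\<^sup>1 fib (s x)\<close>, and \<open>twist\<close> is the value of \<open>\<omega>\<^sup>s - \<omega>\<^sub>\<rho>\<close> along \<open>s\<close>.\<close>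

definition conn :: "(('b \<times> (real^3)) set, (real^3) \<times> (real^3), real^3) form1" where
  "conn y v = flat y v + sol_Ad (sol_mult (sol_inv (fib y)) (fib (s (base y))))
     (twist (pullback1 A bun s flat (base y) (diff_map bun A base y v)))"

lemma conn_eq:
  assumes W: "slice c W" and y: "y \<in> P" "base y \<in> p ` W" and v: "v \<in> tangent_space bun y"
    and C: "cmap (bchart c W) y = (u, h)" "v (bchart c W) = (e, e')"
  shows "conn y v = maurer_cartan h e' + sol_Ad (sol_mult (sol_inv h) (secF s c W u)) (twist (mcF c W u e))"
proof -
  have uh: "u = cmap c (base y)" "h = sol_mult (dev W (base y)) (fib y)"
    using C(1) bchart_map[OF W y] by auto
  have c: "c \<in> A" "base y \<in> cdom c" using slice_D[OF W] y by auto
  have "pullback1 A bun s flat (base y) (diff_map bun A base y v) = mcF c W u e"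
    using pullback_flat[OF W y(2), of "coord_vec A c (base y) e"] base_push[OF W y v] C(2) uh(1)
    by (simp add: coord_vec_tangent[OF pre_A c] coord_vec_same[OF pre_A c])
  moreover have "sol_mult (sol_inv (fib y)) (fib (s (base y))) = sol_mult (sol_inv h) (secF s c W u)"
    using c uh by (simp add: secF_def cinv_cmap[OF pre_A] sol_inv_mult sol_mult_assoc)
  ultimately show ?thesis
    using flat_eq[OF W y v] C by (simp add: conn_def)
qed

lemma right_act_mk: "y \<in> P \<Longrightarrow> right_act y k = mk (base y) (sol_mult (fib y) k)"
proof (erule P_cases)
  fix m h assume y: "y = q (m, h)"
  have "right_act (q (m, h)) k = q (m, sol_mult h k)"
  proof (intro equalityI subsetI)
    fix z assume "z \<in> right_act (q (m, h)) k"
    then show "z \<in> q (m, sol_mult h k)"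
      by (auto simp: right_act_def q_eq simp flip: sol_mult_assoc)
  next
    fix z assume "z \<in> q (m, sol_mult h k)"
    then obtain m' h' where z: "z = (m', h')" "p m' = p m"
      "sol_mult (sol_inv (D m')) h' = sol_mult (sol_inv (D m)) (sol_mult h k)"
      by (auto simp: q_eq)
    have "sol_mult (sol_inv (D m')) (sol_mult h' (sol_inv k)) = sol_mult (sol_inv (D m)) h"
      using z(3) by (metis sol_inv_right sol_mult_0(2) sol_mult_assoc)
    then have "(m', sol_mult h' (sol_inv k)) \<in> q (m, h)"
      using z(2) by (simp add: q_eq)
    moreover have "z = (m', sol_mult (sol_mult h' (sol_inv k)) k)"
      using z(1) by (simp add: sol_mult_assoc)
    ultimately show "z \<in> right_act (q (m, h)) k"
      unfolding right_act_def by force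
  qed
  then show ?thesis
    unfolding y by (simp add: mk_eq sol_mult_assoc)
qed

lemma right_act_in: "y \<in> P \<Longrightarrow> right_act y k \<in> P"
  and base_right_act: "y \<in> P \<Longrightarrow> base (right_act y k) = base y"
  by (simp_all add: right_act_mk)

lemma right_act_0: "y \<in> P \<Longrightarrow> right_act y 0 = y"
  by (simp add: right_act_mk mk_base_fib)

lemma right_act_chart:
  assumes "slice c W" "y \<in> P" "base y \<in> p ` W"
  shows "cmap (bchart c W) (right_act y k) = (fst (cmap (bchart c W) y), sol_mult (snd (cmap (bchart c W) y)) k)"
  using assms by (simp add: right_act_mk bchart_map sol_mult_assoc)

lemma vertical_vector:
  assumes W: "slice c W" and y: "y \<in> P" "base y \<in> p ` W"
  shows "diff_from bun (right_act y) 0 \<xi> = coord_vec bun (bchart c W) y (0, dmult (snd (cmap (bchart c W) y)) 0 0 \<xi>)"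
proof -
  let ?C = "bchart c W"
  let ?h = "snd (cmap ?C y)"
  have mem: "right_act y k \<in> cdom ?C" for k
    using y by (simp add: bchart_dom right_act_in base_right_act)
  have "((\<lambda>k. (fst (cmap ?C y), sol_mult ?h k)) has_derivative (\<lambda>k. (0, dmult ?h 0 0 k))) (at 0)"
    by (intro has_derivative_Pair has_derivative_const has_derivative_sol_mult has_derivative_ident)
  then have D: "((cmap ?C \<circ> right_act y) has_derivative (\<lambda>k. (0, dmult ?h 0 0 k))) (at 0)"
    by (simp add: o_def right_act_chart[OF W y])
  then have d: "(cmap ?C \<circ> right_act y) differentiable (at 0)"
    by (auto simp: differentiable_def)
  show ?thesis
    using diff_from_eq[OF pre_bun bchart_in[OF W] open_UNIV UNIV_I mem d] y
    by (simp add: FD_eqI[OF D] right_act_0)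
qed

lemma right_push:
  assumes W: "slice c W" and y: "y \<in> P" "base y \<in> p ` W" and v: "v \<in> tangent_space bun y"
  shows "diff_map bun bun (\<lambda>y. right_act y k) y v = coord_vec bun (bchart c W) (right_act y k)
    (fst (v (bchart c W)), dmult (snd (cmap (bchart c W) y)) (snd (v (bchart c W))) k 0)"
proof -
  let ?C = "bchart c W"
  let ?h = "snd (cmap ?C y)" and ?R = "\<lambda>y. right_act y k"
  have C: "?C \<in> bun" "y \<in> cdom ?C" using W y by (simp_all add: bchart_in bchart_mem)
  let ?U = "cmap ?C ` cdom ?C"
  have U: "open ?U" "cmap ?C y \<in> ?U" using open_image[OF pre_bun C(1)] C(2) by auto
  have mem: "?R (cinv ?C t) \<in> cdom ?C" and eq: "(fst t, sol_mult (snd t) k) = (cmap ?C \<circ> ?R \<circ> cinv ?C) t" if t: "t \<in> ?U" for t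
  proof -
    obtain y' where y': "t = cmap ?C y'" "y' \<in> P" "base y' \<in> p ` W"
      using t by (auto simp: bchart_dom)
    then have "cinv ?C t = y'"
      using cinv_cmap[OF pre_bun C(1) bchart_mem] by simp
    then show "?R (cinv ?C t) \<in> cdom ?C" "(fst t, sol_mult (snd t) k) = (cmap ?C \<circ> ?R \<circ> cinv ?C) t"
      using y' by (simp_all add: bchart_mem right_act_in base_right_act right_act_chart[OF W])
  qed
  have "((\<lambda>t. (fst t, sol_mult (snd t) k)) has_derivative (\<lambda>w. (fst w, dmult ?h (snd w) k 0))) (at (cmap ?C y))"
    by (intro has_derivative_Pair has_derivative_const has_derivative_sol_mult bounded_linear_imp_has_derivative
        bounded_linear_fst bounded_linear_snd)
  then have D: "((cmap ?C \<circ> ?R \<circ> cinv ?C) has_derivative (\<lambda>w. (fst w, dmult ?h (snd w) k 0))) (at (cmap ?C y))"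
    by (rule has_derivative_transform_within_open[OF _ U]) (rule eq)
  then have d: "(cmap ?C \<circ> ?R \<circ> cinv ?C) differentiable (at (cmap ?C y))"
    by (auto simp: differentiable_def)
  show ?thesis
    using diff_map_eq[OF pre_bun pre_bun C C(1) U mem d v] by (simp add: FD_eqI[OF D])
qed

lemma conn_coord:
  assumes W: "slice c W" and y: "y \<in> cdom (bchart c W)"
  shows "conn y (coord_vec bun (bchart c W) y e) = maurer_cartan (snd (cmap (bchart c W) y)) (snd e)
     + sol_Ad (sol_mult (sol_inv (snd (cmap (bchart c W) y))) (secF s c W (fst (cmap (bchart c W) y))))
        (twist (mcF c W (fst (cmap (bchart c W) y)) (fst e)))"
proof -
  have y': "y \<in> P" "base y \<in> p ` W" using y by (auto simp: bchart_dom)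
  show ?thesis
    by (rule conn_eq[OF W y']) (simp_all add: coord_vec_tangent[OF pre_bun bchart_in[OF W] y]
      coord_vec_same[OF pre_bun bchart_in[OF W] y])
qed

lemma fst_chart_in: "slice c W \<Longrightarrow> y \<in> cdom (bchart c W) \<Longrightarrow> fst (cmap (bchart c W) y) \<in> cmap c ` p ` W"
  by (auto simp: bchart_dom bchart_map)

lemma bchart_range: "slice c W \<Longrightarrow> cmap (bchart c W) ` cdom (bchart c W) = cmap c ` p ` W \<times> UNIV"
  unfolding bchart_dom by (rule bchart_image) auto

lemma smooth_conn: "smooth_form1 bun conn"
  unfolding smooth_form1_def
proof (intro ballI conjI allI)
  fix C assume "C \<in> bun"
  then obtain c W where C: "slice c W" "C = bchart c W" unfolding bun_eq by blast
  {
    fix y assume y: "y \<in> cdom C"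
    let ?u = "fst (cmap C y)" and ?h = "snd (cmap C y)"
    note mc = linear_mcF[OF C(1) fst_chart_in[OF C(1) y[unfolded C(2)]], folded C(2)]
    have "linear (\<lambda>e::(real^3) \<times> (real^3). maurer_cartan ?h (snd e) + sol_Ad (sol_mult (sol_inv ?h) (secF s c W ?u)) (twist (mcF c W ?u (fst e))))"
      using linear_compose_add[OF linear_compose[OF linear_snd linear_maurer_cartan[of ?h]]
        linear_compose[OF linear_compose[OF linear_compose[OF linear_fst mc] linear_twist] linear_sol_Ad]]
      by (simp add: o_def)
    then show "linear (\<lambda>e. conn y (coord_vec bun C y e))"
      using conn_coord[OF C(1) y[unfolded C(2)]] C(2) by simp
  next
    fix e :: "(real^3) \<times> (real^3)"
    let ?S = "cmap C ` cdom C" and ?V = "cmap c ` p ` W"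
    have o: "open ?S" using open_image[OF pre_bun \<open>C \<in> bun\<close>] .
    have fst: "smooth_on ?S (f \<circ> fst)" if "smooth_on ?V f" for f :: "real^3 \<Rightarrow> real^3"
      by (rule smooth_on_compose[OF that smooth_on_fst[OF o smooth_on_id, unfolded o_def] _ o, unfolded eta_contract_eq])
        (use bchart_range[OF C(1)] C(2) in auto)
    have mc: "smooth_on ?V (\<lambda>u. mcF c W u (fst e))"
      unfolding mcF_def
      by (intro smooth_on_maurer_cartan open_slice smooth_secF C(1) smooth_on_FD)
    have "smooth_on ?S (\<lambda>z. maurer_cartan (snd z) (snd e)
        + sol_Ad (sol_mult (sol_inv (snd z)) ((secF s c W \<circ> fst) z)) (twist (((\<lambda>u. mcF c W u (fst e)) \<circ> fst) z)))"
      by (intro smooth_on_add smooth_on_maurer_cartan smooth_on_snd smooth_on_id smooth_on_const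
        smooth_on_sol_Ad smooth_on_sol_mult smooth_on_sol_inv smooth_twist fst smooth_secF C(1) mc o)
    then show "smooth_on ?S (\<lambda>z. conn (cinv C z) (coord_vec bun C (cinv C z) e))"
      by (rule smooth_on_cong[OF o, rotated])
        (simp add: conn_coord[OF C(1)] cinv_in[OF pre_bun] cmap_cinv[OF pre_bun] C(2))
  }
qed

text \<open>Vertical vectors project to 0, which kills the second summand of \<open>conn\<close>.
  Under right translation by \<open>k\<close> both summands acquire Ad of the inverse of
  \<open>k\<close>: the first by \<open>maurer_cartan_right\<close>, the second because the inverse
  of \<open>fib y\<close> stands on the left inside Ad.\<close>

lemma conn_principal: "principal_connection A p m\<^sub>0 \<rho> conn"
  unfolding principal_connection_def Let_def
proof (intro conjI ballI allI smooth_conn)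
  fix y \<xi> assume y: "y \<in> P"
  obtain c W where W: "slice c W" "base y \<in> p ` W" by (rule slice_at)
  note m = bchart_mem[OF y W(2)]
  have "linear (mcF c W (fst (cmap (bchart c W) y)))"
    by (rule linear_mcF[OF W(1) fst_chart_in[OF W(1) m]])
  then show "conn y (diff_from bun (right_act y) 0 \<xi>) = \<xi>"
    unfolding vertical_vector[OF W(1) y W(2)] conn_coord[OF W(1) m]
    by (simp add: maurer_cartan_translation linear_0 linear_0[OF linear_twist])
next
  fix y k v assume y: "y \<in> P" and v: "v \<in> tangent_space bun y"
  obtain c W where W: "slice c W" "base y \<in> p ` W" by (rule slice_at)
  let ?C = "bchart c W"
  obtain u h where uh: "cmap ?C y = (u, h)" by (metis surj_pair)
  obtain e e' where e: "v ?C = (e, e')" by (metis surj_pair)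
  have m: "right_act y k \<in> cdom ?C"
    using y W(2) by (simp add: bchart_dom right_act_in base_right_act)
  have "conn (right_act y k) (diff_map bun bun (\<lambda>y. right_act y k) y v) =
      maurer_cartan (sol_mult h k) (dmult h e' k 0) +
      sol_Ad (sol_mult (sol_inv (sol_mult h k)) (secF s c W u)) (twist (mcF c W u e))"
    unfolding right_push[OF W(1) y W(2) v] conn_coord[OF W(1) m] right_act_chart[OF W(1) y W(2)]
    by (simp add: uh e)
  also have "\<dots> = sol_Ad (sol_inv k) (conn y v)"
    unfolding conn_eq[OF W(1) y W(2) v uh e] maurer_cartan_right sol_inv_mult sol_mult_assoc
    by (simp only: sol_Ad_add sol_Ad_mult)
  finally show "pullback1 bun bun (\<lambda>y. right_act y k) conn y v = sol_Ad (sol_inv k) (conn y v)"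
    by (simp add: pullback1_def)
qed

text \<open>Along \<open>s\<close> the group element inside Ad is neutral, and
  \<open>t + twist t\<close> is the prescribed multiple of Z.\<close>

lemma conn_section:
  assumes v: "v \<in> tangent_space A x"
  shows "pullback1 A bun s conn x v = (pullback1 A bun s flat x v $ 1 + pullback1 A bun s flat x v $ 2) *\<^sub>R axis 3 1"
proof -
  obtain c W where W: "slice c W" "x \<in> p ` W" by (rule slice_at)
  have bx: "base (s x) \<in> p ` W" using section_D[OF s] W(2) by simp
  have "conn (s x) (diff_map A bun s x v) = maurer_cartan (secF s c W (cmap c x)) (FD (secF s c W) (cmap c x) (v c)) +
      sol_Ad (sol_mult (sol_inv (secF s c W (cmap c x))) (secF s c W (cmap c x))) (twist (mcF c W (cmap c x) (v c)))"
    by (rule conn_eq[OF W(1) section_D(1)[OF s] bx section_push_tangent(1)[OF W v] secF_chart[OF W] section_push_tangent(2)[OF W v]])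
  then have "conn (s x) (diff_map A bun s x v) = mcF c W (cmap c x) (v c) + twist (mcF c W (cmap c x) (v c))"
    unfolding mcF_def[of c W "cmap c x" "v c", symmetric] by simp
  then show ?thesis
    unfolding pullback1_def[of A bun s conn] pullback_flat[OF W v] by (simp add: twist_def)
qed

abbreviation "scon \<equiv> section_connection A p m\<^sub>0 \<rho> s"

text \<open>\<open>conn\<close> witnesses that the choice is not empty; from here on only these two
  properties of the chosen connection enter.\<close>

lemma section_connection:
  shows scon_principal: "principal_connection A p m\<^sub>0 \<rho> scon"
    and scon_section: "v \<in> tangent_space A x \<Longrightarrow> pullback1 A bun s scon x v =
      (pullback1 A bun s flat x v $ 1 + pullback1 A bun s flat x v $ 2) *\<^sub>R axis 3 1"
proof -
  let ?Q = "\<lambda>\<omega>. principal_connection A p m\<^sub>0 \<rho> \<omega> \<and>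
        (\<forall>x. \<forall>u\<in>tangent_space A x.
           let P = bun; \<theta> = pullback1 A P s flat
           in pullback1 A P s \<omega> x u = (\<theta> x u $ 1 + \<theta> x u $ 2) *\<^sub>R axis 3 1)"
  have conn: "?Q conn"
    using conn_principal conn_section by (simp add: Let_def)
  have scon: "scon = (SOME \<omega>. ?Q \<omega>)"
    by (simp only: section_connection_def)
  have "?Q scon"
    unfolding scon by (rule someI[of ?Q, OF conn])
  then show "principal_connection A p m\<^sub>0 \<rho> scon"
    "v \<in> tangent_space A x \<Longrightarrow> pullback1 A bun s scon x v =
      (pullback1 A bun s flat x v $ 1 + pullback1 A bun s flat x v $ 2) *\<^sub>R axis 3 1"
    by (auto simp: Let_def)
qed

text \<open>The third component of a principal connection is invariant under the right action, so for
  \<open>\<omega>\<^sup>s\<close> it is determined by the values along \<open>s\<close> and on vertical vectors.\<close>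

lemma scon_nth3:
  assumes W: "slice c W" and y: "y \<in> cdom (bchart c W)"
  shows "scon y (coord_vec bun (bchart c W) y e) $ 3 = kap (secF s c W) (fst e) (fst (cmap (bchart c W) y)) + snd e $ 3"
proof -
  let ?C = "bchart c W" and ?F = "secF s c W"
  have yP: "y \<in> P" "base y \<in> p ` W" using y by (auto simp: bchart_dom)
  define x where "x = base y"
  have x: "x \<in> p ` W" "x \<in> cdom c" using yP slice_D[OF W] by (auto simp: x_def)
  obtain u h where uh: "cmap ?C y = (u, h)" by (metis surj_pair)
  have u: "u = cmap c x" using bchart_map[OF W yP] uh by (simp add: x_def)
  \<comment> \<open>The group element carrying the section to \<open>y\<close>, that is
    \<open>s x \<cdot> k = y\<close>.\<close>
  define k where "k = sol_mult (sol_inv (?F u)) h"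
  have sx: "s x \<in> P" "base (s x) = x" using section_D[OF s] by auto
  have mx: "s x \<in> cdom ?C" by (rule bchart_mem) (simp_all add: sx x(1))
  have y_eq: "right_act (s x) k = y"
  proof (rule inj_onD[OF bchart_inj[OF W]])
    show "cmap ?C (right_act (s x) k) = cmap ?C y"
      using right_act_chart[OF W sx(1), of k] x(1) sx(2) secF_chart[OF W x(1)] uh u by (simp add: k_def)
    show "right_act (s x) k \<in> cdom ?C" "y \<in> cdom ?C"
      using y x(1) sx by (simp_all add: bchart_dom right_act_in base_right_act)
  qed
  let ?w = "coord_vec A c x (fst e)"
  have c: "c \<in> A" using slice_D[OF W] by simp
  have w: "?w \<in> tangent_space A x" "?w c = fst e"
    using coord_vec_tangent[OF pre_A c x(2)] coord_vec_same[OF pre_A c x(2)] by auto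
  let ?v = "diff_map A bun s x ?w"
  have v: "?v \<in> tangent_space bun (s x)" "?v ?C = (fst e, FD ?F u (fst e))"
    using section_push_tangent[OF W x(1) w(1)] w(2) u by auto
  have pc: "smooth_form1 bun scon"
      "\<And>y \<xi>. y \<in> P \<Longrightarrow> scon y (diff_from bun (right_act y) 0 \<xi>) = \<xi>"
      "\<And>y h u. y \<in> P \<Longrightarrow> u \<in> tangent_space bun y \<Longrightarrow>
        scon (right_act y h) (diff_map bun bun (\<lambda>y. right_act y h) y u) = sol_Ad (sol_inv h) (scon y u)"
    using scon_principal by (auto simp: principal_connection_def Let_def pullback1_def)
  have lin: "linear (\<lambda>e. scon y (coord_vec bun ?C y e))"
    using pc(1) bchart_in[OF W] y unfolding smooth_form1_def by blast
  \<comment> \<open>\<open>?a\<close> is the image under right translation by \<open>k\<close> of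
    the tangent vector to the section over \<open>fst e\<close>; the remainder
    \<open>(0, ?r)\<close> is vertical. Ad does not change the third component on the former, and a
    connection reproduces the Lie algebra element on the latter.\<close>
  let ?a = "(fst e, dmult (?F u) (FD ?F u (fst e)) k 0)"
  let ?r = "snd e - snd ?a"
  have "scon y (coord_vec bun ?C y ?a) = sol_Ad (sol_inv k) (scon (s x) ?v)"
    using pc(3)[OF sx(1) v(1), of k] right_push[OF W sx(1) _ v(1), of k] sx(2) x(1) v(2)
      secF_chart[OF W x(1)] u by (simp add: y_eq)
  then have 1: "scon y (coord_vec bun ?C y ?a) $ 3 = mcF c W u (fst e) $ 1 + mcF c W u (fst e) $ 2"
    using scon_section[OF w(1)] pullback_flat[OF W x(1) w(1)] w(2) u by (simp add: pullback1_def axis_def)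
  have "scon y (coord_vec bun ?C y (0, ?r)) = maurer_cartan h ?r"
    using pc(2)[OF yP(1), of "maurer_cartan h ?r"] vertical_vector[OF W yP, of "maurer_cartan h ?r"] uh
    by (simp add: dmult_maurer_cartan)
  then have 2: "scon y (coord_vec bun ?C y (0, ?r)) $ 3 = snd e $ 3 - FD ?F u (fst e) $ 3"
    by simp
  have "e = ?a + (0, ?r)" by (simp add: prod_eq_iff)
  then have "scon y (coord_vec bun ?C y e) = scon y (coord_vec bun ?C y ?a) + scon y (coord_vec bun ?C y (0, ?r))"
    using linear_add[OF lin, of ?a "(0, ?r)"] by simp
  then have "scon y (coord_vec bun ?C y e) $ 3 = mcF c W u (fst e) $ 1 + mcF c W u (fst e) $ 2 + (snd e $ 3 - FD ?F u (fst e) $ 3)"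
    by (simp only: vector_add_component 1 2)
  then show ?thesis
    by (simp add: kap_def mcF_def uh)
qed

text \<open>Brackets have no Z-component, so only \<kappa> \<and> d\<kappa> / 2 remains of the
  integrand, with \<kappa> the Z-component of the difference of the connections.
  \<open>kap_exterior_derivative\<close> and \<open>wedge_identity\<close> turn it into the volume
  determinant.\<close>

lemma cs_pullback:
  assumes t: "a \<in> tangent_space A x" "b \<in> tangent_space A x" "d \<in> tangent_space A x"
  shows "pullback3 A bun s (cs_form bun scon flat) x a b d = pullback3 A bun s vol x a b d"
proof -
  define y where "y = s x"
  have y: "y \<in> P" "base y = x" using section_D[OF s] by (auto simp: y_def)
  have "\<exists>C. C \<in> bun \<and> y \<in> cdom C"
    using slice_at[of x] bchart_in bchart_mem[OF y(1)] y(2) by metis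
  \<comment> \<open>\<open>ext_deriv\<close> differentiates in the chart picked by
    \<open>chart_at\<close>, so the slice is taken from that chart and not from an arbitrary
    one.\<close>
  then have "chart_at bun y \<in> bun" "y \<in> cdom (chart_at bun y)"
    using chart_at[OF pre_bun] by blast+
  then obtain c W where W: "slice c W" "chart_at bun y = bchart c W" and yC: "y \<in> cdom (bchart c W)"
    unfolding bun_eq by auto
  let ?C = "bchart c W" and ?F = "secF s c W"
  have x: "x \<in> p ` W" using yC y(2) by (auto simp: bchart_dom)
  define u where "u = cmap c x"
  have u: "u \<in> cmap c ` p ` W" using x by (simp add: u_def)
  have Cy: "cmap ?C y = (u, ?F u)" using secF_chart[OF W(1) x] by (simp add: y_def u_def)
  note C = bchart_in[OF W(1)]
  note smF = smooth_secF[OF W(1)] and oV = open_slice[OF W(1)]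
  let ?S = "cmap ?C ` cdom ?C"
  have S: "open ?S" "cmap ?C y \<in> ?S" using open_image[OF pre_bun C] yC by auto
  let ?\<alpha> = "\<lambda>y u. scon y u - flat y u"
  define w where "w = (\<lambda>e t. ?\<alpha> (cinv ?C t) (coord_vec bun ?C (cinv ?C t) e))"
  \<comment> \<open>The vertical contribution \<open>snd e $ 3\<close> is common to both connections
    and cancels. What remains depends on base coordinates only, so its exterior derivative reduces
    to derivatives of \<open>kap\<close> on the base.\<close>
  have \<alpha>3: "?\<alpha> y' (coord_vec bun ?C y' e) $ 3 = kap ?F (fst e) (fst (cmap ?C y'))" if y': "y' \<in> cdom ?C" for y' e
  proof -
    have "flat y' (coord_vec bun ?C y' e) $ 3 = snd e $ 3"
      using flat_eq[OF W(1), of y' "coord_vec bun ?C y' e"] y' coord_vec_tangent[OF pre_bun C y'] coord_vec_same[OF pre_bun C y']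
      by (simp add: bchart_dom)
    then show ?thesis using scon_nth3[OF W(1) y', of e] by simp
  qed
  have sw: "smooth_on ?S (w e)" for e
    unfolding w_def using scon_principal
    by (intro smooth_on_diff S(1) smooth_form1_D[OF _ C] smooth_flat) (simp add: principal_connection_def Let_def)
  have FDw: "FD (w e) (cmap ?C y) e' $ 3 = FD (kap ?F (fst e)) u (fst e')" for e e'
  proof -
    have "FD (w e) (cmap ?C y) e' $ 3 = FD (\<lambda>t. w e t $ 3) (cmap ?C y) e'"
      by (rule FD_nth[symmetric, OF smooth_on_differentiable[OF sw S(2)]])
    also have "FD (\<lambda>t. w e t $ 3) (cmap ?C y) = FD (kap ?F (fst e) \<circ> fst) (cmap ?C y)"
    proof (rule FD_cong[OF S])
      fix t assume t: "t \<in> ?S"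
      then show "w e t $ 3 = (kap ?F (fst e) \<circ> fst) t"
        unfolding w_def using \<alpha>3[OF cinv_in[OF pre_bun t], of e] by (simp add: cmap_cinv[OF pre_bun t])
    qed
    also have "FD (kap ?F (fst e) \<circ> fst) (cmap ?C y) e' = FD (kap ?F (fst e)) (fst (cmap ?C y)) (FD fst (cmap ?C y) e')"
      using smooth_on_differentiable[OF smooth_kap[OF oV smF] u] Cy
      by (intro FD_compose) (auto intro: bounded_linear_imp_differentiable bounded_linear_fst)
    also have "FD fst (cmap ?C y) = fst"
      by (rule FD_eqI[OF bounded_linear_imp_has_derivative[OF bounded_linear_fst]])
    finally show ?thesis by (simp add: Cy)
  qed
  let ?s = "diff_map A bun s x"
  have push: "?s v \<in> tangent_space bun y" "?s v ?C = (v c, FD ?F u (v c))" if "v \<in> tangent_space A x" for v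
    using section_push_tangent[OF W(1) x that] by (auto simp: y_def u_def)
  have A3: "?\<alpha> y (?s v) $ 3 = kap ?F (v c) u" if v: "v \<in> tangent_space A x" for v
    using \<alpha>3[OF yC, of "?s v ?C"] tangent_coord[OF pre_bun push(1)[OF v] C yC] push(2)[OF v] Cy by simp
  have E3: "ext_deriv bun ?\<alpha> y (?s v) (?s v') $ 3 = FD (kap ?F (v' c)) u (v c) - FD (kap ?F (v c)) u (v' c)"
    if v: "v \<in> tangent_space A x" "v' \<in> tangent_space A x" for v v'
  proof -
    have "ext_deriv bun ?\<alpha> y (?s v) (?s v') = FD (w (?s v' ?C)) (cmap ?C y) (?s v ?C) - FD (w (?s v ?C)) (cmap ?C y) (?s v' ?C)"
      unfolding ext_deriv_def Let_def W(2) w_def ..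
    then show ?thesis
      by (simp add: FDw push(2)[OF v(1)] push(2)[OF v(2)])
  qed
  have B3: "sol_bracket \<xi> \<eta> $ 3 = 0" for \<xi> \<eta>
    by (simp add: sol_bracket_def axis_def)
  note K = kap_exterior_derivative[OF oV u smF]
  have "cs_form bun scon flat y (?s a) (?s b) (?s d) =
      (kap ?F (a c) u * (FD (kap ?F (d c)) u (b c) - FD (kap ?F (b c)) u (d c))
      - kap ?F (b c) u * (FD (kap ?F (d c)) u (a c) - FD (kap ?F (a c)) u (d c))
      + kap ?F (d c) u * (FD (kap ?F (b c)) u (a c) - FD (kap ?F (a c)) u (b c))) / 2"
    unfolding cs_form_def Let_def wedge12_def sol_form_def wedge11_def vector_add_component vector_minus_component B3
      A3[OF t(1), simplified] A3[OF t(2), simplified] A3[OF t(3), simplified]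
      E3[OF t(2,3), simplified] E3[OF t(1,3), simplified] E3[OF t(1,2), simplified]
    using A3[OF t(1)] A3[OF t(2)] A3[OF t(3)] by (simp add: algebra_simps add_divide_distrib diff_divide_distrib)
  also have "\<dots> = det (vector [FD ?F u (a c), FD ?F u (b c), FD ?F u (d c)] :: real^3^3)"
    unfolding K unfolding kap_def
    by (rule wedge_identity) (simp flip: exp_add)
  also have "\<dots> = pullback3 A bun s vol x a b d"
    using pullback_vol[OF W(1) x t] by (simp add: u_def)
  finally show ?thesis
    by (simp add: pullback3_def y_def)
qed

end

section \<open>Independence of the section\<close>

definition grad :: "(real^3 \<Rightarrow> real) \<Rightarrow> real^3 \<Rightarrow> real^3" where
  "grad h u = (\<chi> i. FD h u (axis i 1))"

lemma FD_grad: "h differentiable (at u) \<Longrightarrow> FD h u v = grad h u \<bullet> v"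
  by (subst FD_axis_expand) (simp_all add: grad_def inner_vec_def mult.commute)

lemma grad_compose:
  fixes \<tau> :: "real^3 \<Rightarrow> real^3"
  assumes "\<tau> differentiable (at u)" "h differentiable (at (\<tau> u))"
  shows "grad (h \<circ> \<tau>) u = transpose (matrix (FD \<tau> u)) *v grad h (\<tau> u)"
proof -
  have "FD (h \<circ> \<tau>) u (axis i 1) = grad h (\<tau> u) \<bullet> FD \<tau> u (axis i 1)" for i
    unfolding FD_compose[OF assms] by (rule FD_grad[OF assms(2)])
  then have "grad (h \<circ> \<tau>) u = (\<chi> i. grad h (\<tau> u) \<bullet> FD \<tau> u (axis i 1))"
    by (simp add: grad_def)
  then show ?thesis
    by (simp add: vec_eq_iff inner_vec_def matrix_vector_mult_def transpose_def matrix_def mult.commute)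
qed

lemma smooth_on_grad: "open S \<Longrightarrow> smooth_on S h \<Longrightarrow> smooth_on S (grad h)"
  by (rule smooth_on_vec) (simp_all add: grad_def smooth_on_FD)

lemma smooth_on_cross3: "open S \<Longrightarrow> smooth_on S f \<Longrightarrow> smooth_on S g \<Longrightarrow> smooth_on S (\<lambda>u. cross3 (f u) (g u))"
  unfolding cross3_def by (intro smooth_intros)

text \<open>The cross product of the gradients is the density dual to dg1 \<and> dg2, so this is
  d(dg1 \<and> dg2) = 0; the terms cancel in pairs by symmetry of second derivatives.\<close>

lemma divergence_cross_grad:
  assumes S: "open S" "u \<in> S" and g: "smooth_on S g1" "smooth_on S g2"
  shows "(\<Sum>i\<in>UNIV. FD (\<lambda>u. cross3 (grad g1 u) (grad g2 u)) u (axis i 1) $ i) = 0"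
proof -
  let ?V = "\<lambda>u. cross3 (grad g1 u) (grad g2 u)"
  have D: "(grad g has_derivative (\<lambda>v. \<chi> i. FD (\<lambda>u. FD g u (axis i 1)) u v)) (at u)" if "smooth_on S g" for g
    by (rule has_derivative_vec)
      (simp add: grad_def FD_has_derivative smooth_on_differentiable[OF smooth_on_FD[OF that] S(2)])
  have sym: "FD (\<lambda>u. FD g u (axis i 1)) u (axis j 1) = FD (\<lambda>u. FD g u (axis j 1)) u (axis i 1)" if "smooth_on S g" for g :: "real^3 \<Rightarrow> real" and i j
  proof -
    have "Ck_on (Suc (Suc 0)) S g" using that by (simp add: smooth_on_def del: Ck_on.simps)
    from FD_symmetric[OF S this] show ?thesis .
  qed
  have n1: "((\<lambda>u. grad g1 u $ i) has_derivative FD (\<lambda>u. FD g1 u (axis i 1)) u) (at u)"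
    and n2: "((\<lambda>u. grad g2 u $ i) has_derivative FD (\<lambda>u. FD g2 u (axis i 1)) u) (at u)" for i
    using has_derivative_nth[OF D[OF g(1)], of i] has_derivative_nth[OF D[OF g(2)], of i] by simp_all
  let ?d = "\<lambda>g i v. FD (\<lambda>u. FD g u (axis i 1)) u v"
  have DV: "(?V has_derivative (\<lambda>v. vector [
      (grad g1 u $ 2 * ?d g2 3 v + ?d g1 2 v * grad g2 u $ 3) - (grad g1 u $ 3 * ?d g2 2 v + ?d g1 3 v * grad g2 u $ 2),
      (grad g1 u $ 3 * ?d g2 1 v + ?d g1 3 v * grad g2 u $ 1) - (grad g1 u $ 1 * ?d g2 3 v + ?d g1 1 v * grad g2 u $ 3),
      (grad g1 u $ 1 * ?d g2 2 v + ?d g1 1 v * grad g2 u $ 2) - (grad g1 u $ 2 * ?d g2 1 v + ?d g1 2 v * grad g2 u $ 1)])) (at u)"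
    unfolding cross3_def
    by (intro has_derivative_vector3 has_derivative_diff has_derivative_mult n1 n2)
  show ?thesis
    unfolding FD_eqI[OF DV]
    by (simp add: sum_3 sym[OF g(1), of 2 1] sym[OF g(1), of 3 1] sym[OF g(1), of 3 2]
        sym[OF g(2), of 2 1] sym[OF g(2), of 3 1] sym[OF g(2), of 3 2])
qed

text \<open>The coordinates \<open>x\<close>, \<open>y\<close>, \<open>z\<close> of \<open>\<psi>\<close> are switched on one after the other: for \<open>F = b \<cdot> \<psi>\<close>,
  \<open>dF\<^sub>1 \<and> dF\<^sub>2 \<and> dF\<^sub>3 - db\<^sub>1 \<and> db\<^sub>2 \<and> db\<^sub>3\<close> is the sum of \<open>dx \<and> db\<^sub>2 \<and> d(- exp (- b\<^sub>3))\<close>,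
  \<open>dy \<and> d(exp b\<^sub>3) \<and> dF\<^sub>1\<close> and \<open>dz \<and> dF\<^sub>1 \<and> dF\<^sub>2\<close>.\<close>

lemma determinant_expansion:
  fixes p q :: "3 \<Rightarrow> real^3" and E E' x y :: real
  defines "r \<equiv> \<lambda>k. vector [p k$1 + E' * q k$1 - p k$3 * E' * x, p k$2 + E * q k$2 + p k$3 * E * y, p k$3 + q k$3] :: real^3"
  shows "det (vector [r 1, r 2, r 3] :: real^3^3) = det (vector [p 1, p 2, p 3] :: real^3^3)
    + (\<Sum>k\<in>UNIV. cross3 (\<chi> i. p i$2) (\<chi> i. E' * p i$3) $ k * q k$1)
    + (\<Sum>k\<in>UNIV. cross3 (\<chi> i. E * p i$3) (\<chi> i. r i$1) $ k * q k$2)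
    + (\<Sum>k\<in>UNIV. cross3 (\<chi> i. r i$1) (\<chi> i. r i$2) $ k * q k$3)"
  unfolding r_def by (simp add: sum_3 det_3 cross3_def algebra_simps)

lemma manifold_integral_cong:
  assumes "\<And>n c f. partition_of_unity A n c f \<Longrightarrow>
     (\<Sum>i<n. integral (cmap (c i) ` cdom (c i)) (\<lambda>u. f i (cinv (c i) u) * coeff3 A (c i) \<omega> (cinv (c i) u))) =
     (\<Sum>i<n. integral (cmap (c i) ` cdom (c i)) (\<lambda>u. f i (cinv (c i) u) * coeff3 A (c i) \<omega>' (cinv (c i) u)))"
  shows "manifold_integral A \<omega> = manifold_integral A \<omega>'"
  unfolding manifold_integral_def using assms by (intro arg_cong[where f = The] ext) (metis (no_types, lifting))

lemma manifold_integral_coeff_cong: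
  assumes "\<And>c x. c \<in> A \<Longrightarrow> x \<in> cdom c \<Longrightarrow> coeff3 A c \<omega> x = coeff3 A c \<omega>' x"
  shows "manifold_integral A \<omega> = manifold_integral A \<omega>'"
proof (rule manifold_integral_cong)
  fix n c f assume "partition_of_unity A n c f"
  then have "c i \<in> A" if "i < n" for i
    using that by (simp add: partition_of_unity_def)
  then show "(\<Sum>i<n. integral (cmap (c i) ` cdom (c i)) (\<lambda>u. f i (cinv (c i) u) * coeff3 A (c i) \<omega> (cinv (c i) u))) =
     (\<Sum>i<n. integral (cmap (c i) ` cdom (c i)) (\<lambda>u. f i (cinv (c i) u) * coeff3 A (c i) \<omega>' (cinv (c i) u)))"
    by (intro sum.cong integral_cong) (simp_all add: assms cinv_def inv_into_into)
qed

lemma linear_matrix_mult: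
  fixes L :: "real^'n \<Rightarrow> real^'m"
  assumes "linear L"
  shows "matrix L *v x = L x"
  using assms by (metis linear_matrix_vector_mul_eq matrix_works)

lemma det_vector_linear:
  fixes L :: "real^3 \<Rightarrow> real^3"
  assumes "linear L"
  shows "det (vector [L u, L v, L w] :: real^3^3) = det (matrix L) * det (vector [u, v, w] :: real^3^3)"
proof -
  have L: "L x = matrix L *v x" for x
    using linear_matrix_mult[OF assms] by simp
  have "(vector [L u, L v, L w] :: real^3^3) = vector [u, v, w] ** transpose (matrix L)"
    unfolding L[of u] L[of v] L[of w]
    by (simp add: vec_eq_iff forall_3 matrix_matrix_mult_def matrix_vector_mult_def transpose_def mult.commute)
  then show ?thesis
    by (simp add: det_mul)
qed

section \<open>Closed 2-forms from pairs of functions in Sol charts\<close>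

context sol_manifold
begin

text \<open>Two functions defined near each point, in the domain of a Sol chart, such that the 2-form
  \<open>dG1 \<and> dG2\<close> does not depend on the Sol chart.\<close>

definition pair :: "(('a, real^3) chart \<Rightarrow> 'a \<Rightarrow> real) \<Rightarrow> (('a, real^3) chart \<Rightarrow> 'a \<Rightarrow> real) \<Rightarrow> bool" where
  "pair G1 G2 \<longleftrightarrow>
     (\<forall>c\<in>A. \<forall>b\<in>B. smooth_on (cmap c ` (cdom c \<inter> cdom b)) (G1 b \<circ> cinv c) \<and>
        smooth_on (cmap c ` (cdom c \<inter> cdom b)) (G2 b \<circ> cinv c)) \<and>
     (\<forall>b\<in>B. \<forall>b'\<in>B. \<forall>x\<in>cdom b \<inter> cdom b'. \<exists>N k1 k2 l. open N \<and> x \<in> N \<and> l \<noteq> 0 \<and>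
        (\<forall>y\<in>N. G1 b' y = k1 + l * G1 b y \<and> G2 b' y = k2 + G2 b y / l))"

text \<open>The components of the cross product are the coefficients of dG1 \<and> dG2. The Sol
  chart \<open>b\<close> is an arbitrary one around the point, which \<open>pair_density_eq\<close>
  justifies.\<close>

definition pair_density :: "(('a, real^3) chart \<Rightarrow> 'a \<Rightarrow> real) \<Rightarrow> (('a, real^3) chart \<Rightarrow> 'a \<Rightarrow> real) \<Rightarrow>
    ('a, real^3) chart \<Rightarrow> real^3 \<Rightarrow> real^3" where
  "pair_density G1 G2 c u = (let b = SOME b. b \<in> B \<and> cinv c u \<in> cdom b
     in cross3 (grad (G1 b \<circ> cinv c) u) (grad (G2 b \<circ> cinv c) u))"

lemma grad_affine:
  assumes c: "c \<in> A" "x \<in> cdom c" and N: "open N" "x \<in> N" "\<forall>y\<in>N. H y = k + l * G y"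
    and d: "(G \<circ> cinv c) differentiable (at (cmap c x))"
  shows "grad (H \<circ> cinv c) (cmap c x) = l *\<^sub>R grad (G \<circ> cinv c) (cmap c x)"
proof -
  let ?Z = "cmap c ` (N \<inter> cdom c)"
  have Z: "open ?Z" "cmap c x \<in> ?Z" using c N by (auto intro: open_chart_image)
  have "((\<lambda>u. k + l * (G \<circ> cinv c) u) has_derivative (\<lambda>v. 0 + l * FD (G \<circ> cinv c) (cmap c x) v)) (at (cmap c x))"
    by (intro has_derivative_add has_derivative_const has_derivative_mult_right FD_has_derivative d)
  then have "((H \<circ> cinv c) has_derivative (\<lambda>v. 0 + l * FD (G \<circ> cinv c) (cmap c x) v)) (at (cmap c x))"
    by (rule has_derivative_transform_within_open[OF _ Z]) (use c N in \<open>auto simp: cinv_cmap[OF pre_A]\<close>)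
  then show ?thesis
    by (simp add: vec_eq_iff grad_def FD_eqI)
qed

text \<open>Another Sol chart multiplies one gradient by \<open>l\<close> and the other by
  \<open>1 / l\<close>; the additive constants disappear.\<close>

lemma pair_density_eq:
  assumes G: "pair G1 G2" and c: "c \<in> A" "x \<in> cdom c" and b: "b \<in> B" "x \<in> cdom b"
  shows "pair_density G1 G2 c (cmap c x) = cross3 (grad (G1 b \<circ> cinv c) (cmap c x)) (grad (G2 b \<circ> cinv c) (cmap c x))"
proof -
  define b' where "b' = (SOME b. b \<in> B \<and> cinv c (cmap c x) \<in> cdom b)"
  have "b' \<in> B \<and> cinv c (cmap c x) \<in> cdom b'"
    unfolding b'_def by (rule someI[of _ b]) (use b c in \<open>simp add: cinv_cmap[OF pre_A]\<close>)
  then have b': "b' \<in> B" "x \<in> cdom b'" using c by (simp_all add: cinv_cmap[OF pre_A])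
  have "\<exists>N k1 k2 l. open N \<and> x \<in> N \<and> l \<noteq> 0 \<and> (\<forall>y\<in>N. G1 b' y = k1 + l * G1 b y \<and> G2 b' y = k2 + G2 b y / l)"
    using G b b' unfolding pair_def by blast
  then obtain N k1 k2 l where N': "open N" "x \<in> N" "l \<noteq> 0"
      "\<forall>y\<in>N. G1 b' y = k1 + l * G1 b y \<and> G2 b' y = k2 + G2 b y / l"
    by blast
  then have N: "open N" "x \<in> N" "l \<noteq> 0"
      "\<forall>y\<in>N. G1 b' y = k1 + l * G1 b y" "\<forall>y\<in>N. G2 b' y = k2 + (1 / l) * G2 b y"
    by simp_all
  have "smooth_on (cmap c ` (cdom c \<inter> cdom b)) (G1 b \<circ> cinv c)" "smooth_on (cmap c ` (cdom c \<inter> cdom b)) (G2 b \<circ> cinv c)"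
    using G b c by (simp_all add: pair_def)
  then have "(G1 b \<circ> cinv c) differentiable (at (cmap c x))" "(G2 b \<circ> cinv c) differentiable (at (cmap c x))"
    using b c by (auto intro: smooth_on_differentiable)
  then have "grad (G1 b' \<circ> cinv c) (cmap c x) = l *\<^sub>R grad (G1 b \<circ> cinv c) (cmap c x)"
    "grad (G2 b' \<circ> cinv c) (cmap c x) = (1 / l) *\<^sub>R grad (G2 b \<circ> cinv c) (cmap c x)"
    using grad_affine[OF c N(1,2,4)] grad_affine[OF c N(1,2,5)] by blast+
  then show ?thesis
    unfolding pair_density_def Let_def b'_def[symmetric] using N(3) by (simp add: cross_mult_left cross_mult_right)
qed

lemma closed_density_pair:
  assumes G: "pair G1 G2"
  shows "closed_density A (pair_density G1 G2)"
proof
  show "oriented_atlas A" "compact (UNIV :: 'a set)" by (rule oriented_A, rule compact_UNIV)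
next
  have local: "\<exists>Z g1 g2. open Z \<and> cmap c x \<in> Z \<and> smooth_on Z g1 \<and> smooth_on Z g2 \<and>
      (\<forall>u\<in>Z. pair_density G1 G2 c u = cross3 (grad g1 u) (grad g2 u))" if c: "c \<in> A" "x \<in> cdom c" for c x
  proof -
    obtain b where b: "b \<in> B" "x \<in> cdom b" by (rule chart_B)
    let ?Z = "cmap c ` (cdom c \<inter> cdom b)"
    have "open ?Z" using open_overlap[OF pre_AB, of c b] c b by auto
    moreover have "smooth_on ?Z (G1 b \<circ> cinv c)" "smooth_on ?Z (G2 b \<circ> cinv c)"
      using G b c by (simp_all add: pair_def)
    moreover have "pair_density G1 G2 c u = cross3 (grad (G1 b \<circ> cinv c) u) (grad (G2 b \<circ> cinv c) u)" if "u \<in> ?Z" for u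
      using that pair_density_eq[OF G c(1) _ b(1)] by blast
    ultimately show ?thesis using c b by blast
  qed
  fix c assume c: "c \<in> A"
  have "smooth_on (cmap c ` cdom c) (pair_density G1 G2 c)"
  proof (rule smooth_on_local)
    fix u assume "u \<in> cmap c ` cdom c"
    then obtain Z g1 g2 where Z: "open Z" "u \<in> Z" "smooth_on Z g1" "smooth_on Z g2"
        "\<forall>u\<in>Z. pair_density G1 G2 c u = cross3 (grad g1 u) (grad g2 u)"
      using local[OF c] by blast
    have "smooth_on Z (\<lambda>u. cross3 (grad g1 u) (grad g2 u))"
      by (intro smooth_on_cross3 smooth_on_grad Z)
    then have "smooth_on Z (pair_density G1 G2 c)"
      by (rule smooth_on_cong[OF Z(1), rotated]) (simp add: Z(5))
    then show "\<exists>N. open N \<and> u \<in> N \<and> smooth_on N (pair_density G1 G2 c)"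
      using Z by blast
  qed
  then show "Ck_on 1 (cmap c ` cdom c) (pair_density G1 G2 c)"
    by (simp add: smooth_on_def)
  show "(\<Sum>i\<in>UNIV. FD (pair_density G1 G2 c) u (axis i 1) $ i) = 0" if u: "u \<in> cmap c ` cdom c" for u
  proof -
    obtain Z g1 g2 where Z: "open Z" "u \<in> Z" "smooth_on Z g1" "smooth_on Z g2"
        "\<forall>u\<in>Z. pair_density G1 G2 c u = cross3 (grad g1 u) (grad g2 u)"
      using local[OF c] u by blast
    have "FD (pair_density G1 G2 c) u = FD (\<lambda>u. cross3 (grad g1 u) (grad g2 u)) u"
      by (rule FD_cong[OF Z(1,2)]) (simp add: Z(5))
    then show ?thesis
      using divergence_cross_grad[OF Z(1-4)] by simp
  qed
  fix c' x assume c': "c' \<in> A" and x: "x \<in> cdom c" "x \<in> cdom c'"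
  obtain b where b: "b \<in> B" "x \<in> cdom b" by (rule chart_B)
  let ?\<tau> = "cmap c' \<circ> cinv c" and ?u = "cmap c x"
  have \<tau>: "?\<tau> differentiable (at ?u)" "?\<tau> ?u = cmap c' x"
    using transition_differentiable[OF pre_A c c' x] x c by (simp_all add: cinv_cmap[OF pre_A])
  have gr: "grad (H \<circ> cinv c) ?u = transpose (matrix (FD ?\<tau> ?u)) *v grad (H \<circ> cinv c') (cmap c' x)"
    if "smooth_on (cmap c' ` (cdom c' \<inter> cdom b)) (H \<circ> cinv c')" for H :: "'a \<Rightarrow> real"
  proof -
    have d: "(H \<circ> cinv c') differentiable (at (cmap c' x))"
      using that x b by (auto intro: smooth_on_differentiable)
    then have "FD (H \<circ> cinv c) ?u v = FD ((H \<circ> cinv c') \<circ> ?\<tau>) ?u v" for v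
      using change_chart(2)[OF pre_A c x(1) c' x(2) d] FD_compose[OF \<tau>(1), of "H \<circ> cinv c'"] \<tau>(2) by simp
    then have "grad (H \<circ> cinv c) ?u = grad ((H \<circ> cinv c') \<circ> ?\<tau>) ?u"
      by (simp only: grad_def)
    then show ?thesis
      using grad_compose[OF \<tau>(1), of "H \<circ> cinv c'"] d \<tau>(2) by simp
  qed
  have sm: "smooth_on (cmap c' ` (cdom c' \<inter> cdom b)) (G1 b \<circ> cinv c')" "smooth_on (cmap c' ` (cdom c' \<inter> cdom b)) (G2 b \<circ> cinv c')"
    using G b c' by (simp_all add: pair_def)
  have lin: "FD ?\<tau> ?u v = matrix (FD ?\<tau> ?u) *v v" for v
    using linear_matrix_mult[OF FD_linear[OF \<tau>(1)]] by simp
  \<comment> \<open>With M the Jacobian matrix, gradients are pulled back by the transpose N of M,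
    and M applied to the cross product of N a and N b is det M times the cross product of a and
    b.\<close>
  show "FD ?\<tau> ?u (pair_density G1 G2 c ?u) = det (matrix (FD ?\<tau> ?u)) *\<^sub>R pair_density G1 G2 c' (cmap c' x)"
    unfolding pair_density_eq[OF G c x(1) b] pair_density_eq[OF G c' x(2) b] gr[OF sm(1)] gr[OF sm(2)] lin[of "cross3 _ _"]
    using cross_matrix_mult[of "transpose (matrix (FD ?\<tau> ?u))"] by simp
qed

lemma sol_coordinate_change:
  assumes "b \<in> B" "b' \<in> B" "x \<in> cdom b \<inter> cdom b'"
  obtains N g where "open N" "x \<in> N" "\<forall>y\<in>N. cmap b' y = sol_mult g (cmap b y)"
  using sol_atlas assms unfolding sol_structure_def by meson

end

section \<open>Comparison of a section with the developing section\<close>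

context sol_section
begin

definition psi :: "'a \<Rightarrow> real^3" where
  "psi x = fib (s x)"

lemma smooth_psi: "smooth_fun A psi"
  using section_fib_smooth[OF s] unfolding psi_def .

lemma smooth_psi_nth: "smooth_fun A (\<lambda>x. psi x $ i)"
  using smooth_psi open_image[OF pre_A] unfolding smooth_fun_def o_def by (auto intro: smooth_on_nth)

text \<open>The local representative \<open>F = b \<cdot> \<psi>\<close> of the section, determined up to left translation.\<close>

definition loc :: "('a, real^3) chart \<Rightarrow> 'a \<Rightarrow> real^3" where
  "loc b x = sol_mult (cmap b x) (psi x)"

lemma smooth_loc:
  assumes "c \<in> A" "b \<in> B"
  shows "smooth_on (cmap c ` (cdom c \<inter> cdom b)) (cmap b \<circ> cinv c)"
    and "smooth_on (cmap c ` (cdom c \<inter> cdom b)) (psi \<circ> cinv c)"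
    and "smooth_on (cmap c ` (cdom c \<inter> cdom b)) (loc b \<circ> cinv c)"
    and "open (cmap c ` (cdom c \<inter> cdom b))"
proof -
  show o: "open (cmap c ` (cdom c \<inter> cdom b))"
    using open_overlap[OF pre_AB, of c b] assms by auto
  show 1: "smooth_on (cmap c ` (cdom c \<inter> cdom b)) (cmap b \<circ> cinv c)"
    using smooth_transition[OF pre_AB, of c b] assms by auto
  show 2: "smooth_on (cmap c ` (cdom c \<inter> cdom b)) (psi \<circ> cinv c)"
    by (rule smooth_on_subset[OF smooth_fun_chart[OF smooth_psi assms(1)]]) auto
  show "smooth_on (cmap c ` (cdom c \<inter> cdom b)) (loc b \<circ> cinv c)"
    using smooth_on_sol_mult[OF o 1 2] by (simp add: loc_def o_def)
qed

text \<open>Left translation by \<open>g\<close> scales the second coordinate and exp z by exp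
  (g$3), and the first coordinate and exp (-z) by its inverse. Each pair combines one function of
  either kind, so the factors are reciprocal.\<close>

lemma
  shows pair1: "pair (\<lambda>b x. cmap b x $ 2) (\<lambda>b x. - exp (- cmap b x $ 3))"
    and pair2: "pair (\<lambda>b x. exp (cmap b x $ 3)) (\<lambda>b x. loc b x $ 1)"
    and pair3: "pair (\<lambda>b x. loc b x $ 1) (\<lambda>b x. loc b x $ 2)"
proof -
  have sm: "smooth_on (cmap c ` (cdom c \<inter> cdom b)) ((\<lambda>x. cmap b x $ 2) \<circ> cinv c)"
    "smooth_on (cmap c ` (cdom c \<inter> cdom b)) ((\<lambda>x. - exp (- cmap b x $ 3)) \<circ> cinv c)"
    "smooth_on (cmap c ` (cdom c \<inter> cdom b)) ((\<lambda>x. exp (cmap b x $ 3)) \<circ> cinv c)"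
    "smooth_on (cmap c ` (cdom c \<inter> cdom b)) ((\<lambda>x. loc b x $ i) \<circ> cinv c)" if cb: "c \<in> A" "b \<in> B" for c b i
    using smooth_loc[OF cb] unfolding o_def by (auto intro!: smooth_intros)
  have ch: "\<exists>N k1 k2 l. open N \<and> x \<in> N \<and> l \<noteq> 0 \<and> (\<forall>y\<in>N. cmap b' y $ 2 = k1 + l * cmap b y $ 2 \<and>
        - exp (- cmap b' y $ 3) = k2 + - exp (- cmap b y $ 3) / l)" 
    "\<exists>N k1 k2 l. open N \<and> x \<in> N \<and> l \<noteq> 0 \<and> (\<forall>y\<in>N. exp (cmap b' y $ 3) = k1 + l * exp (cmap b y $ 3) \<and>
        loc b' y $ 1 = k2 + loc b y $ 1 / l)"
    "\<exists>N k1 k2 l. open N \<and> x \<in> N \<and> l \<noteq> 0 \<and> (\<forall>y\<in>N. loc b' y $ 1 = k1 + l * loc b y $ 1 \<and>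
        loc b' y $ 2 = k2 + loc b y $ 2 / l)"
    if b: "b \<in> B" "b' \<in> B" "x \<in> cdom b \<inter> cdom b'" for b b' x
  proof -
    obtain N g where N: "open N" "x \<in> N" "\<forall>y\<in>N. cmap b' y = sol_mult g (cmap b y)"
      by (rule sol_coordinate_change[OF b])
    then have l: "\<forall>y\<in>N. loc b' y = sol_mult g (loc b y)"
      by (simp add: loc_def sol_mult_assoc)
    have "\<forall>y\<in>N. cmap b' y $ 2 = g$2 + exp (g$3) * cmap b y $ 2 \<and>
        - exp (- cmap b' y $ 3) = 0 + - exp (- cmap b y $ 3) / exp (g$3)"
      using N(3) by (auto simp: exp_diff exp_minus field_simps)
    then show "\<exists>N k1 k2 l. open N \<and> x \<in> N \<and> l \<noteq> 0 \<and> (\<forall>y\<in>N. cmap b' y $ 2 = k1 + l * cmap b y $ 2 \<and>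
        - exp (- cmap b' y $ 3) = k2 + - exp (- cmap b y $ 3) / l)"
      using N(1,2) by (metis exp_not_eq_zero)
    have "\<forall>y\<in>N. exp (cmap b' y $ 3) = 0 + exp (g$3) * exp (cmap b y $ 3) \<and>
        loc b' y $ 1 = g$1 + loc b y $ 1 / exp (g$3)"
      using N(3) l by (auto simp: exp_add exp_minus field_simps)
    then show "\<exists>N k1 k2 l. open N \<and> x \<in> N \<and> l \<noteq> 0 \<and> (\<forall>y\<in>N. exp (cmap b' y $ 3) = k1 + l * exp (cmap b y $ 3) \<and>
        loc b' y $ 1 = k2 + loc b y $ 1 / l)"
      using N(1,2) by (metis exp_not_eq_zero)
    have "\<forall>y\<in>N. loc b' y $ 1 = g$1 + exp (- g$3) * loc b y $ 1 \<and>
        loc b' y $ 2 = g$2 + loc b y $ 2 / exp (- g$3)"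
      using l by (auto simp: exp_minus field_simps)
    then show "\<exists>N k1 k2 l. open N \<and> x \<in> N \<and> l \<noteq> 0 \<and> (\<forall>y\<in>N. loc b' y $ 1 = k1 + l * loc b y $ 1 \<and>
        loc b' y $ 2 = k2 + loc b y $ 2 / l)"
      using N(1,2) by (metis exp_not_eq_zero)
  qed
  show "pair (\<lambda>b x. cmap b x $ 2) (\<lambda>b x. - exp (- cmap b x $ 3))"
    unfolding pair_def by (intro conjI ballI sm ch)
  show "pair (\<lambda>b x. exp (cmap b x $ 3)) (\<lambda>b x. loc b x $ 1)"
    unfolding pair_def by (intro conjI ballI sm ch)
  show "pair (\<lambda>b x. loc b x $ 1) (\<lambda>b x. loc b x $ 2)"
    unfolding pair_def by (intro conjI ballI sm ch)
qed

lemma slice_for: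
  assumes "c \<in> A" "x \<in> cdom c"
  obtains W where "slice c W" "x \<in> p ` W"
proof -
  obtain m where m: "p m = x" by (rule surj_p)
  with assms obtain W where "slice c W" "m \<in> W" using slice_exists by metis
  then show thesis using that m by blast
qed

lemma coeff_vol_slice:
  assumes W: "slice c W" "x \<in> p ` W"
  shows "coeff3 A c (pullback3 A bun s vol) x = det (vector [FD (secF s c W) (cmap c x) (axis 1 1),
    FD (secF s c W) (cmap c x) (axis 2 1), FD (secF s c W) (cmap c x) (axis 3 1)] :: real^3^3)"
proof -
  have c: "c \<in> A" "x \<in> cdom c" using slice_D[OF W(1)] W(2) by auto
  show ?thesis
    unfolding coeff3_def by (subst pullback_vol[OF W]) (simp_all add: coord_vec_tangent[OF pre_A c] coord_vec_same[OF pre_A c])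
qed

lemma smooth_coeff_vol:
  assumes c: "c \<in> A"
  shows "smooth_on (cmap c ` cdom c) (\<lambda>u. coeff3 A c (pullback3 A bun s vol) (cinv c u))"
proof (rule smooth_on_local)
  fix u assume "u \<in> cmap c ` cdom c"
  then obtain x where x: "x \<in> cdom c" "u = cmap c x" by blast
  obtain W where W: "slice c W" "x \<in> p ` W" by (rule slice_for[OF c x(1)])
  let ?V = "cmap c ` p ` W"
  note o = open_slice[OF W(1)] and sm = smooth_on_FD[OF smooth_secF[OF W(1)]]
  have "smooth_on ?V (\<lambda>u. det (vector [FD (secF s c W) u (axis 1 1), FD (secF s c W) u (axis 2 1), FD (secF s c W) u (axis 3 1)] :: real^3^3))"
    unfolding det_3 vector_3 by (intro smooth_on_add smooth_on_diff smooth_on_mult smooth_on_nth sm o)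
  then have "smooth_on ?V (\<lambda>u. coeff3 A c (pullback3 A bun s vol) (cinv c u))"
  proof (rule smooth_on_cong[OF o, rotated])
    fix v assume "v \<in> ?V"
    then obtain x' where x': "v = cmap c x'" "x' \<in> p ` W" by blast
    then have "cinv c v = x'" using slice_D(6)[OF W(1)] by (simp add: cinv_cmap[OF pre_A c])
    then show "det (vector [FD (secF s c W) v (axis 1 1), FD (secF s c W) v (axis 2 1), FD (secF s c W) v (axis 3 1)] :: real^3^3)
      = coeff3 A c (pullback3 A bun s vol) (cinv c v)"
      using coeff_vol_slice[OF W(1) x'(2)] x'(1) by simp
  qed
  then show "\<exists>N. open N \<and> u \<in> N \<and> smooth_on N (\<lambda>u. coeff3 A c (pullback3 A bun s vol) (cinv c u))"
    using o W(2) x(2) by blast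
qed

text \<open>Near \<open>x\<close> the maps \<open>secF s c W\<close> and \<open>loc b\<close> differ
  by a constant left translation, which preserves the invariant volume.\<close>

lemma coeff_vol_loc:
  assumes c: "c \<in> A" "x \<in> cdom c" and b: "b \<in> B" "x \<in> cdom b"
  shows "coeff3 A c (pullback3 A bun s vol) x = det (vector [FD (loc b \<circ> cinv c) (cmap c x) (axis 1 1),
    FD (loc b \<circ> cinv c) (cmap c x) (axis 2 1), FD (loc b \<circ> cinv c) (cmap c x) (axis 3 1)] :: real^3^3)"
proof -
  let ?u = "cmap c x" and ?F = "loc b \<circ> cinv c"
  obtain W where W: "slice c W" "x \<in> p ` W" by (rule slice_for[OF c])
  obtain N g where N: "open N" "x \<in> N" "N \<subseteq> p ` W \<inter> cdom b" "\<forall>x'\<in>N. dev W x' = sol_mult g (cmap b x')"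
    by (rule dev_local[OF slice_D(2,3)[OF W(1)] W(2) b])
  let ?Z = "cmap c ` (N \<inter> cdom c)"
  have Z: "open ?Z" "?u \<in> ?Z" using c N by (auto intro: open_chart_image)
  have "FD (secF s c W) ?u = FD (\<lambda>u. sol_mult g (?F u)) ?u"
    by (rule FD_cong[OF Z]) (use c N(4) in \<open>auto simp: secF_def loc_def psi_def cinv_cmap[OF pre_A] sol_mult_assoc\<close>)
  moreover have d: "?F differentiable (at ?u)"
    using smooth_on_differentiable[OF smooth_loc(3)[OF c(1) b(1)]] c b by blast
  have "FD (\<lambda>u. sol_mult g (?F u)) ?u v = dmult g 0 (?F ?u) (FD ?F ?u v)" for v
    using FD_sol_mult[OF differentiable_const d, of g v] FD_eqI[OF has_derivative_const[of g "at ?u"]] by simp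
  ultimately have "FD (secF s c W) ?u v = dmult g 0 (?F ?u) (FD ?F ?u v)" for v
    by simp
  then show ?thesis
    unfolding coeff_vol_slice[OF W]
    using sol_vol_dmult[of g "?F ?u" "FD ?F ?u (axis 1 1)" "FD ?F ?u (axis 2 1)" "FD ?F ?u (axis 3 1)"]
    unfolding sol_vol_det by simp
qed

end

context sol_section
begin

text \<open>The reference section: its \<open>psi\<close> is 0 and its \<open>loc b\<close> is the
  Sol chart \<open>b\<close> itself.\<close>

sublocale dev: sol_section A B p m\<^sub>0 D \<rho> "\<lambda>x. mk x 0"
  by unfold_locales (rule developing_section)

abbreviation "V1 \<equiv> pair_density (\<lambda>b x. cmap b x $ 2) (\<lambda>b x. - exp (- cmap b x $ 3))"
abbreviation "V2 \<equiv> pair_density (\<lambda>b x. exp (cmap b x $ 3)) (\<lambda>b x. loc b x $ 1)"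
abbreviation "V3 \<equiv> pair_density (\<lambda>b x. loc b x $ 1) (\<lambda>b x. loc b x $ 2)"

text \<open>An application of \<open>determinant_expansion\<close> in which \<open>pp\<close>,
  \<open>qq\<close> and \<open>r\<close> are the partial derivatives of the Sol chart, of
  \<open>psi\<close> and of their product in Sol, while \<open>E\<close> and \<open>E'\<close> are
  the exponentials of the third chart coordinate and of its negative.\<close>

lemma coeff_vol_expand:
  assumes c: "c \<in> A" and u: "u \<in> cmap c ` cdom c"
  shows "coeff3 A c (pullback3 A bun s vol) (cinv c u) = coeff3 A c (pullback3 A bun (\<lambda>x. mk x 0) vol) (cinv c u)
    + FD ((\<lambda>x. psi x $ 1) \<circ> cinv c) u (V1 c u) + FD ((\<lambda>x. psi x $ 2) \<circ> cinv c) u (V2 c u)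
    + FD ((\<lambda>x. psi x $ 3) \<circ> cinv c) u (V3 c u)"
proof -
  define x where "x = cinv c u"
  have x: "x \<in> cdom c" "cmap c x = u" using u by (auto simp: x_def cinv_in[OF pre_A] cmap_cinv[OF pre_A])
  obtain b where b: "b \<in> B" "x \<in> cdom b" by (rule chart_B)
  have uo: "u \<in> cmap c ` (cdom c \<inter> cdom b)" using x b by auto
  let ?\<beta> = "cmap b \<circ> cinv c" and ?\<Psi> = "psi \<circ> cinv c"
  have d: "?\<beta> differentiable (at u)" "?\<Psi> differentiable (at u)"
    using smooth_on_differentiable[OF smooth_loc(1)[OF c b(1)] uo] smooth_on_differentiable[OF smooth_loc(2)[OF c b(1)] uo] .
  define pp where "pp k = FD ?\<beta> u (axis k 1)" for k
  define qq where "qq k = FD ?\<Psi> u (axis k 1)" for k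
  define E where "E = exp (?\<beta> u $ 3)"
  define E' where "E' = exp (- ?\<beta> u $ 3)"
  define r where "r k = (vector [pp k$1 + E' * qq k$1 - pp k$3 * E' * ?\<Psi> u $ 1, pp k$2 + E * qq k$2 + pp k$3 * E * ?\<Psi> u $ 2, pp k$3 + qq k$3] :: real^3)" for k
  have dF: "(loc b \<circ> cinv c) differentiable (at u)"
    using smooth_on_differentiable[OF smooth_loc(3)[OF c b(1)] uo] .
  have "loc b \<circ> cinv c = (\<lambda>u. sol_mult (?\<beta> u) (?\<Psi> u))"
    by (simp add: loc_def fun_eq_iff)
  then have F: "FD (loc b \<circ> cinv c) u (axis k 1) = r k" for k
    using FD_sol_mult[OF d, of "axis k 1"] by (simp add: r_def dmult_def pp_def qq_def E_def E'_def)
  have "dev.loc b \<circ> cinv c = ?\<beta>"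
    by (simp add: dev.loc_def dev.psi_def fun_eq_iff)
  then have F0: "FD (dev.loc b \<circ> cinv c) u (axis k 1) = pp k" for k
    by (simp add: pp_def)
  have nth: "FD ((\<lambda>x. h x $ i) \<circ> cinv c) u v = FD (h \<circ> cinv c) u v $ i" if "(h \<circ> cinv c) differentiable (at u)"
    for h :: "'a \<Rightarrow> real^3" and i v
    using FD_nth[OF that, of i v] by (simp add: o_def)
  have g2: "grad ((\<lambda>x. cmap b x $ 2) \<circ> cinv c) u = (\<chi> i. pp i $ 2)"
    by (simp add: grad_def nth[OF d(1)] pp_def)
  have e: "((\<lambda>u. exp (?\<beta> u $ 3)) has_derivative (\<lambda>v. E * FD ?\<beta> u v $ 3)) (at u)"
    "((\<lambda>u. - exp (- ?\<beta> u $ 3)) has_derivative (\<lambda>v. E' * FD ?\<beta> u v $ 3)) (at u)"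
    using has_derivative_exp[OF has_derivative_nth[OF FD_has_derivative[OF d(1)], of 3]]
      has_derivative_minus[OF has_derivative_exp[OF has_derivative_minus[OF has_derivative_nth[OF FD_has_derivative[OF d(1)], of 3]]]]
    by (simp_all add: E_def E'_def mult.commute)
  have ge: "grad ((\<lambda>x. exp (cmap b x $ 3)) \<circ> cinv c) u = (\<chi> i. E * pp i $ 3)"
    "grad ((\<lambda>x. - exp (- cmap b x $ 3)) \<circ> cinv c) u = (\<chi> i. E' * pp i $ 3)"
    using FD_eqI[OF e(1)] FD_eqI[OF e(2)] by (simp_all add: grad_def o_def pp_def)
  have gl: "grad ((\<lambda>x. loc b x $ j) \<circ> cinv c) u = (\<chi> i. r i $ j)" for j
    by (simp add: grad_def nth[OF dF] F)
  have V: "V1 c u = cross3 (\<chi> i. pp i $ 2) (\<chi> i. E' * pp i $ 3)"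
    "V2 c u = cross3 (\<chi> i. E * pp i $ 3) (\<chi> i. r i $ 1)"
    "V3 c u = cross3 (\<chi> i. r i $ 1) (\<chi> i. r i $ 2)"
    using pair_density_eq[OF pair1 c x(1) b] pair_density_eq[OF pair2 c x(1) b] pair_density_eq[OF pair3 c x(1) b]
    by (simp_all add: x(2) g2 ge gl)
  have ps: "FD ((\<lambda>x. psi x $ j) \<circ> cinv c) u v = (\<Sum>k\<in>UNIV. v $ k * qq k $ j)" for j v
    unfolding nth[OF d(2)] FD_axis_expand[OF d(2), of v] by (simp add: qq_def)
  show ?thesis
    unfolding x_def[symmetric] coeff_vol_loc[OF c x(1) b] dev.coeff_vol_loc[OF c x(1) b] x(2) F F0 V ps
    using determinant_expansion[of pp E' qq "?\<Psi> u $ 1" E "?\<Psi> u $ 2"]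
    unfolding r_def[symmetric] .
qed

text \<open>\<open>psi\<close> is the quotient of the two sections and so a globally defined map
  into Sol. Its three coordinates are the functions to which \<open>integral_exact\<close> applies,
  each paired with a closed density.\<close>

lemma vol_integral: "manifold_integral A (pullback3 A bun s vol) = manifold_integral A (pullback3 A bun (\<lambda>x. mk x 0) vol)"
proof (rule manifold_integral_cong)
  fix n c f assume pou: "partition_of_unity A n c f"
  interpret d1: closed_density A V1 by (rule closed_density_pair[OF pair1])
  interpret d2: closed_density A V2 by (rule closed_density_pair[OF pair2])
  interpret d3: closed_density A V3 by (rule closed_density_pair[OF pair3])
  let ?I = "\<lambda>i. integral (cmap (c i) ` cdom (c i))"
  let ?J = "\<lambda>i u. f i (cinv (c i) u) * coeff3 A (c i) (pullback3 A bun (\<lambda>x. mk x 0) vol) (cinv (c i) u)"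
  let ?t1 = "\<lambda>i. d1.dterm (f i) (\<lambda>x. psi x $ 1) (c i)" and ?t2 = "\<lambda>i. d2.dterm (f i) (\<lambda>x. psi x $ 2) (c i)"
    and ?t3 = "\<lambda>i. d3.dterm (f i) (\<lambda>x. psi x $ 3) (c i)"
  have split: "?I i (\<lambda>u. f i (cinv (c i) u) * coeff3 A (c i) (pullback3 A bun s vol) (cinv (c i) u)) =
      ?I i (?J i) + ?I i (?t1 i) + ?I i (?t2 i) + ?I i (?t3 i)" if i: "i < n" for i
  proof -
    let ?K = "closure {x. f i x \<noteq> 0}" and ?U = "cmap (c i) ` cdom (c i)"
    have ci: "c i \<in> A" and fi: "smooth_fun A (f i)" and K: "?K \<subseteq> cdom (c i)"
      using pou i by (auto simp: partition_of_unity_def)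
    have cK: "compact ?K"
      using compact_Int_closed[OF compact_UNIV closed_closure] by simp
    have zero: "f i (cinv (c i) u) = 0" if "u \<in> ?U" "u \<notin> cmap (c i) ` ?K" for u
      using that closure_subset[of "{x. f i x \<noteq> 0}"] by (auto simp: cinv_cmap[OF pre_A ci])
    have "continuous_on ?U (?J i)"
      using smooth_on_continuous[OF smooth_fun_chart[OF fi ci]] smooth_on_continuous[OF dev.smooth_coeff_vol[OF ci]]
      by (intro continuous_on_mult) (auto simp: o_def)
    then have 0: "?J i integrable_on ?U"
      by (intro set_lebesgue_integral_eq_integral(1)
        absolutely_integrable_compact_support[OF open_image[OF pre_A ci] _ compact_chart_image[OF oriented_A ci cK K]])
        (use K zero in auto)
    have t: "?t1 i integrable_on ?U" "?t2 i integrable_on ?U" "?t3 i integrable_on ?U"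
      by (intro set_lebesgue_integral_eq_integral(1) d1.dterm_integrable[OF ci fi smooth_psi_nth closed_closure K]
          d2.dterm_integrable[OF ci fi smooth_psi_nth closed_closure K] d3.dterm_integrable[OF ci fi smooth_psi_nth closed_closure K];
        simp add: d1.dterm_def d2.dterm_def d3.dterm_def zero)+
    have "?I i (\<lambda>u. f i (cinv (c i) u) * coeff3 A (c i) (pullback3 A bun s vol) (cinv (c i) u)) =
        ?I i (\<lambda>u. ((?J i u + ?t1 i u) + ?t2 i u) + ?t3 i u)"
      by (intro integral_cong) (simp add: coeff_vol_expand[OF ci] d1.dterm_def d2.dterm_def d3.dterm_def algebra_simps)
    also have "\<dots> = ?I i (?J i) + ?I i (?t1 i) + ?I i (?t2 i) + ?I i (?t3 i)"
      using 0 t by (simp add: integral_add integrable_add)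
    finally show ?thesis .
  qed
  show "(\<Sum>i<n. ?I i (\<lambda>u. f i (cinv (c i) u) * coeff3 A (c i) (pullback3 A bun s vol) (cinv (c i) u))) = (\<Sum>i<n. ?I i (?J i))"
    using d1.integral_exact[OF smooth_psi_nth pou, of 1] d2.integral_exact[OF smooth_psi_nth pou, of 2]
      d3.integral_exact[OF smooth_psi_nth pou, of 3]
    by (simp add: split sum.distrib)
qed

lemma cs_integral:
  "manifold_integral A (pullback3 A bun s (cs_form bun scon flat)) = manifold_integral A (pullback3 A bun s vol)"
  by (rule manifold_integral_coeff_cong)
    (simp add: coeff3_def cs_pullback coord_vec_tangent[OF pre_A])

end

context sol_manifold
begin

lemma sol_section: "smooth_section A p m\<^sub>0 \<rho> s \<Longrightarrow> sol_section A B p m\<^sub>0 D \<rho> s"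
  by unfold_locales

text \<open>\<open>developing_section\<close> provides a section, so the description has at most one
  value; \<open>vol_integral\<close> shows that this value serves all sections.\<close>

lemma Vol_G_eq: "Vol_G A p m\<^sub>0 \<rho> = manifold_integral A (pullback3 A bun (\<lambda>x. mk x 0) vol)"
  unfolding Vol_G_def
proof (rule the_equality)
  show "\<forall>s. smooth_section A p m\<^sub>0 \<rho> s \<longrightarrow>
      manifold_integral A (pullback3 A bun (\<lambda>x. mk x 0) vol) = manifold_integral A (pullback3 A bun s vol)"
    using sol_section.vol_integral[OF sol_section] by simp
qed (use developing_section in blast)

text \<open>For every smooth section the two integrals agree, so both definite descriptions have the
  same defining predicate.\<close>

lemma CS_vol_eq: "CS_vol A p m\<^sub>0 \<rho> = Vol_G A p m\<^sub>0 \<rho>"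
proof -
  have "manifold_integral A (pullback3 A bun s (cs_form bun (section_connection A p m\<^sub>0 \<rho> s) flat)) =
      manifold_integral A (pullback3 A bun s vol)" if "smooth_section A p m\<^sub>0 \<rho> s" for s
    using sol_section.cs_integral[OF sol_section[OF that]] .
  then show ?thesis
    unfolding CS_vol_def Vol_G_def by (intro arg_cong[where f = The] ext) metis
qed

end

section \<open>The Riemannian volume\<close>

context sol_manifold
begin

abbreviation "cov \<equiv> cover_atlas p A"

definition cchart :: "('a, real^3) chart \<Rightarrow> 'b set \<Rightarrow> ('b, real^3) chart" where
  "cchart c W = (W, cmap c \<circ> p)"

lemma cov_eq: "cov = {cchart c W | c W. slice c W}"
  unfolding cover_atlas_def slice_def cchart_def by blast

lemma cchart_in: "slice c W \<Longrightarrow> cchart c W \<in> cov"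
  unfolding cov_eq by blast

lemma cchart_dom [simp]: "cdom (cchart c W) = W" and cchart_map [simp]: "cmap (cchart c W) m = cmap c (p m)"
  by (simp_all add: cchart_def)

lemma cchart_inj: "slice c W \<Longrightarrow> inj_on (cmap (cchart c W)) (cdom (cchart c W))"
  using cinv_cmap[OF pre_A slice_D(1)] slice_D(3,4) by (simp add: inj_on_def) (metis image_subset_iff)

lemma cchart_inv: "slice c W \<Longrightarrow> m \<in> W \<Longrightarrow> cinv (cchart c W) (cmap c (p m)) = m"
  unfolding cinv_def using inv_into_f_f[OF cchart_inj, of c W m] by simp

lemma pre_cov: "pre_atlas cov"
  unfolding pre_atlas_def
proof (intro conjI ballI)
  fix C assume "C \<in> cov"
  then obtain c W where C: "slice c W" "C = cchart c W" unfolding cov_eq by blast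
  show "inj_on (cmap C) (cdom C)" using cchart_inj C by simp
  fix C' assume "C' \<in> cov"
  then obtain c' W' where C': "slice c' W'" "C' = cchart c' W'" unfolding cov_eq by blast
  let ?X = "p ` (W \<inter> W')"
  have X: "?X \<subseteq> cdom c" "?X \<subseteq> cdom c'" "open ?X"
    using slice_D[OF C(1)] slice_D[OF C'(1)] open_map_p[of "W \<inter> W'"] by auto
  have im: "cmap C ` (cdom C \<inter> cdom C') = cmap c ` ?X"
    unfolding C(2) C'(2) by (simp add: image_image)
  have oX: "open (cmap c ` ?X)"
    using open_chart_image[of c ?X] X slice_D(1)[OF C(1)] by (simp add: Int_absorb2)
  then show "open (cmap C ` (cdom C \<inter> cdom C'))" unfolding im .
  have "smooth_on (cmap c ` ?X) (cmap c' \<circ> cinv c)"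
    using smooth_transition[OF pre_A, of c c'] slice_D[OF C(1)] slice_D[OF C'(1)] X
    by (auto elim!: smooth_on_subset)
  then show "smooth_on (cmap C ` (cdom C \<inter> cdom C')) (cmap C' \<circ> cinv C)"
    unfolding im
  proof (rule smooth_on_cong[OF oX, rotated])
    fix u assume "u \<in> cmap c ` ?X"
    then obtain m where m: "u = cmap c (p m)" "m \<in> W" "m \<in> W'" by auto
    then have "cinv c (cmap c (p m)) = p m"
      using X slice_D(1)[OF C(1)] by (auto simp: cinv_cmap[OF pre_A])
    then show "(cmap c' \<circ> cinv c) u = (cmap C' \<circ> cinv C) u"
      unfolding m(1) C(2) C'(2) using m by (simp add: cchart_inv[OF C(1)])
  qed
qed

lemma metric_in_chart:
  assumes g: "induced_metric A p D g" and W: "slice c W" "x \<in> p ` W"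
  shows "g x (coord_vec A c x d) (coord_vec A c x e) =
    sol_metric (dev W x) (FD (dev W \<circ> cinv c) (cmap c x) d) (FD (dev W \<circ> cinv c) (cmap c x) e)"
proof -
  define m where "m = sec W x"
  have m: "m \<in> W" "p m = x" using W(2) by (simp_all add: m_def sec_in p_sec)
  note sl = slice_D[OF W(1)]
  let ?C = "cchart c W" and ?F = "dev W \<circ> cinv c"
  let ?U = "cmap ?C ` cdom ?C"
  note C = cchart_in[OF W(1)]
  have mC: "m \<in> cdom ?C" using m by simp
  have U: "open ?U" "cmap ?C m \<in> ?U" using open_image[OF pre_cov C] mC by auto
  have inU: "p (cinv ?C u) \<in> cdom c" "u = (cmap c \<circ> p \<circ> cinv ?C) u" "?F u = (D \<circ> cinv ?C) u" if u: "u \<in> ?U" for u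
  proof -
    obtain m' where m': "m' \<in> W" "u = cmap c (p m')" using u by auto
    then have "p m' \<in> cdom c" using sl by auto
    then show "p (cinv ?C u) \<in> cdom c" "u = (cmap c \<circ> p \<circ> cinv ?C) u" "?F u = (D \<circ> cinv ?C) u"
      using m' sl by (simp_all add: cchart_inv[OF W(1)] cinv_cmap[OF pre_A] dev_def sec_p)
  qed
  have D1: "((cmap c \<circ> p \<circ> cinv ?C) has_derivative (\<lambda>v. v)) (at (cmap ?C m))"
    by (rule has_derivative_transform_within_open[OF has_derivative_ident U inU(2)])
  have "?F differentiable (at (cmap c x))"
    using smooth_on_differentiable[OF smooth_dev_slice[OF W(1)]] W(2) by blast
  then have "(?F has_derivative FD ?F (cmap c x)) (at (cmap ?C m))"
    using m by (simp add: FD_has_derivative)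
  then have D2: "((D \<circ> cinv ?C) has_derivative FD ?F (cmap c x)) (at (cmap ?C m))"
    by (rule has_derivative_transform_within_open[OF _ U]) (rule inU(3))
  let ?v = "\<lambda>e. coord_vec cov ?C m e"
  have t: "?v e \<in> tangent_space cov m" "?v e ?C = e" for e
    using coord_vec_tangent[OF pre_cov C mC] coord_vec_same[OF pre_cov C mC] by auto
  have d: "(cmap c \<circ> p \<circ> cinv ?C) differentiable (at (cmap ?C m))" "(D \<circ> cinv ?C) differentiable (at (cmap ?C m))"
    using D1 D2 unfolding differentiable_def by blast+
  have push: "diff_map cov A p m (?v e) = coord_vec A c x e" for e
    using diff_map_eq[OF pre_cov pre_A C mC sl(1) U inU(1) d(1) t(1), of e] t(2)
    unfolding FD_eqI[OF D1] by (simp add: m)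
  have "diff_fun cov D m (?v e) = FD ?F (cmap c x) e" for e
    using diff_fun_eq[OF pre_cov C mC d(2) t(1), of e] t(2) unfolding FD_eqI[OF D2] by simp
  moreover have "g (p m) (diff_map cov A p m (?v d)) (diff_map cov A p m (?v e)) =
      sol_metric (D m) (diff_fun cov D m (?v d)) (diff_fun cov D m (?v e))"
    using g t(1) by (simp add: induced_metric_def Let_def)
  ultimately show ?thesis
    by (simp add: push m dev_def m_def[symmetric])
qed

text \<open>Left translations preserve the coordinate determinant, so the Jacobian of a branch of
  the developing map has the same determinant as that of a Sol chart, which is positive because
  \<open>A \<union> B\<close> is oriented.\<close>

lemma dev_orientation:
  assumes W: "slice c W" "x \<in> p ` W"
  shows "det (matrix (FD (dev W \<circ> cinv c) (cmap c x))) > 0"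
proof -
  let ?u = "cmap c x" and ?F = "dev W \<circ> cinv c"
  have c: "c \<in> A" "x \<in> cdom c" using slice_D[OF W(1)] W(2) by auto
  obtain b where b: "b \<in> B" "x \<in> cdom b" by (rule chart_B)
  let ?G = "cmap b \<circ> cinv c"
  obtain N k where N: "open N" "x \<in> N" "N \<subseteq> p ` W \<inter> cdom b" "\<forall>x'\<in>N. dev W x' = sol_mult k (cmap b x')"
    by (rule dev_local[OF slice_D(2,3)[OF W(1)] W(2) b])
  let ?Z = "cmap c ` (N \<inter> cdom c)"
  have Z: "open ?Z" "?u \<in> ?Z" using c N by (auto intro: open_chart_image)
  have dG: "?G differentiable (at ?u)"
    using transition_differentiable[OF pre_AB, of c b x] c b by auto
  have "FD ?F ?u = FD (\<lambda>u. sol_mult k (?G u)) ?u"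
    by (rule FD_cong[OF Z]) (use c N(4) in \<open>auto simp: cinv_cmap[OF pre_A]\<close>)
  then have FD: "FD ?F ?u v = dmult k 0 (?G ?u) (FD ?G ?u v)" for v
    using FD_sol_mult[OF differentiable_const dG, of k v] FD_eqI[OF has_derivative_const[of k "at ?u"]] by simp
  have dF: "?F differentiable (at ?u)"
    using smooth_on_differentiable[OF smooth_dev_slice[OF W(1)]] W(2) by blast
  let ?e = "\<lambda>k::3. axis k 1 :: real^3"
  have "det (vector [FD ?F ?u (?e 1), FD ?F ?u (?e 2), FD ?F ?u (?e 3)] :: real^3^3) =
      det (vector [FD ?G ?u (?e 1), FD ?G ?u (?e 2), FD ?G ?u (?e 3)] :: real^3^3)"
    unfolding FD using sol_vol_dmult[of k "?G ?u" "FD ?G ?u (?e 1)" "FD ?G ?u (?e 2)" "FD ?G ?u (?e 3)"]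
    unfolding sol_vol_det .
  then have "det (matrix (FD ?F ?u)) * det (vector [?e 1, ?e 2, ?e 3] :: real^3^3) =
      det (matrix (FD ?G ?u)) * det (vector [?e 1, ?e 2, ?e 3] :: real^3^3)"
    unfolding det_vector_linear[OF FD_linear[OF dF]] det_vector_linear[OF FD_linear[OF dG]] .
  moreover have "det (vector [?e 1, ?e 2, ?e 3] :: real^3^3) = 1"
    by (simp add: det_3 axis_def)
  moreover have "det (matrix (FD ?G ?u)) > 0"
    using oriented_atlas_det[OF oriented_AB, of c b x] c b by auto
  ultimately show ?thesis by simp
qed

text \<open>For the developing section the local map into Sol is \<open>dev W\<close>, with
  differential \<open>?L\<close>. The Gram determinant of \<open>g\<close> is the square of det
  \<open>?L\<close>, and its root is det \<open>?L\<close> itself by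
  \<open>dev_orientation\<close>.\<close>

lemma riemannian_volume_eq:
  assumes g: "induced_metric A p D g"
  shows "riemannian_volume A g = manifold_integral A (pullback3 A bun (\<lambda>x. mk x 0) vol)"
  unfolding riemannian_volume_def
proof (rule manifold_integral_coeff_cong)
  fix c x assume c: "c \<in> A" "x \<in> cdom c"
  interpret dev: sol_section A B p m\<^sub>0 D \<rho> "\<lambda>x. mk x 0"
    by unfold_locales (rule developing_section)
  \<comment> \<open>\<open>riemannian_vol_form\<close> is computed in the chart picked by
    \<open>chart_at\<close>, so the sheet is taken over that chart rather than over
    \<open>c\<close>.\<close>
  define c0 where "c0 = chart_at A x"
  have c0: "c0 \<in> A" "x \<in> cdom c0" using chart_at[OF pre_A c] by (simp_all add: c0_def)
  obtain W where W: "slice c0 W" "x \<in> p ` W" by (rule dev.slice_for[OF c0])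
  let ?L = "FD (dev W \<circ> cinv c0) (cmap c0 x)"
  have F: "secF (\<lambda>x. mk x 0) c0 W = dev W \<circ> cinv c0"
    by (simp add: secF_def fun_eq_iff)
  have lin: "linear ?L"
    using smooth_on_differentiable[OF smooth_dev_slice[OF W(1)]] W(2) by (intro FD_linear) blast
  have "riemannian_vol_form A g x u v w = pullback3 A bun (\<lambda>x. mk x 0) vol x u v w"
    if t: "u \<in> tangent_space A x" "v \<in> tangent_space A x" "w \<in> tangent_space A x" for u v w
    unfolding riemannian_vol_form_def Let_def c0_def[symmetric] inner_vol_def metric_in_chart[OF g W]
      sol_metric_pullback_det dev.pullback_vol[OF W t] F det_vector_linear[OF lin]
    using dev_orientation[OF W] by simp
  then show "coeff3 A c (riemannian_vol_form A g) x = coeff3 A c (pullback3 A bun (\<lambda>x. mk x 0) vol) x"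
    by (simp add: coeff3_def coord_vec_tangent[OF pre_A c])
qed

end

theorem corollary4p4:
  fixes A B :: "('a::t2_space, real^3) chart set"
    and p :: "'b::t2_space \<Rightarrow> 'a" and m\<^sub>0 :: 'b
    and D :: "'b \<Rightarrow> real^3" and \<rho> :: "(real \<Rightarrow> 'a) set \<Rightarrow> real^3"
    and g :: "('a, real^3, real) form2"
  assumes "closed_oriented_3manifold A"
    and "universal_covering p"
    and "sol_structure A B"
    and "developing_map B p D"
    and "holonomy p m\<^sub>0 D \<rho>"
    and "induced_metric A p D g"
  shows "(\<forall>a u v w. inner_vol (sol_metric a) u v w = sol_vol a u v w) \<and>
    CS_vol A p m\<^sub>0 \<rho> = Vol_G A p m\<^sub>0 \<rho> \<and> Vol_G A p m\<^sub>0 \<rho> = riemannian_volume A g"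
proof -
  interpret sol_manifold A B p m\<^sub>0 D \<rho>
    using assms(1-5) by unfold_locales
  show ?thesis
    using CS_vol_eq Vol_G_eq riemannian_volume_eq[OF assms(6)] inner_vol_sol_metric by simp
qed

end
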